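(* Let $1<p<\infty$, $X$ a complex Banach space, and $m:\mathbb R^d\to\mathbb C$ an even homogeneous function (i.e. $m(-\xi)=m(\xi)$ and $m(c\xi)=m(\xi)$ for $c>0$) such that $m|_{\mathbb R^d\setminus\{0\}}$ is continuous. Let $A:=\mathrm{Ran}(m|_{\mathbb R^d\setminus\{0\}})\subset\mathbb C$. Then $\|T_m\|_{\mathcal L(L^p(\mathbb R^d;X))}\ge\beta_{p,X}^A$. In particular, if $X$ is not a UMD space and $m$ is not constant, then $T_m$ is unbounded on $L^p(\mathbb R^d;X)$.
   Context: For bounded measurable $m$, the Fourier multiplier $T_m$ is defined on $\mathcal S(\mathbb R^d)\otimes X$ (finite sums $\sum f_k\otimes x_k$ with $f_k$ Schwartz) by $T_m(f\otimes x)=\mathcal F^{-1}(m\mathcal F f)\,x$, where $\mathcal Ff(t)=(2\pi)^{-d}\int e^{-i\langle t,u\rangle}f(u)\,du$ and $\mathcal F^{-1}f(t)=\int e^{i\langle t,u\rangle}f(u)\,du$; $\|T_m\|_{\mathcal L(L^p(\mathbb R^d;X))}$ denotes the norm of its (densely defined) extension, set to $\infty$ if it is unbounded. The UMD$_p^A$ constant $\beta_{p,X}^A\in[0,\infty]$ is the least $\beta\ge0$ such that for every martingale difference sequence $(d_n)_{n=1}^N$ in $L^p(\Omega;X)$ and every deterministic sequence $(\varepsilon_n)_{n=1}^N$ in $A$, $\bigl(\mathbb E\|\sum_n\varepsilon_nd_n\|^p\bigr)^{1/p}\le\beta\bigl(\mathbb E\|\sum_nd_n\|^p\bigr)^{1/p}$.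 $X$ is UMD iff this is finite for $A=\{|\varepsilon|=1\}$.
   Formalization: "m is not constant" is read as: m is not constant on R^d \ {0}; if m equals a constant off the origin and differs only at 0, then T_m is a multiple of the identity and is bounded, so the claim would fail. *)

theory Defs
  imports "HOL-Analysis.Analysis" "HOL-Probability.Probability"
begin

text \<open>A complex Banach space is modelled as a real Banach space (type class banach)
  together with a complex scalar multiplication cs that extends the real one and
  satisfies the vector space axioms and absolute homogeneity of the norm.\<close>

definition complex_banach_scaling :: "(complex \<Rightarrow> 'x::banach \<Rightarrow> 'x) \<Rightarrow> bool" where
  "complex_banach_scaling cs \<longleftrightarrow>
     (\<forall>r x. cs (complex_of_real r) x = r *\<^sub>R x) \<and>
     (\<forall>a b x. cs (a + b) x = cs a x + cs b x) \<and>
     (\<forall>a x y. cs a (x + y) = cs a x + cs a y) \<and>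
     (\<forall>a b x. cs (a * b) x = cs a (cs b x)) \<and>
     (\<forall>a x. norm (cs a x) = cmod a * norm x)"

definition partial_deriv :: "'n::finite \<Rightarrow> (real^'n \<Rightarrow> complex) \<Rightarrow> real^'n \<Rightarrow> complex" where
  "partial_deriv i g x = vector_derivative (\<lambda>s. g (x + s *\<^sub>R axis i 1)) (at 0)"

fun iter_partial :: "'n::finite list \<Rightarrow> (real^'n \<Rightarrow> complex) \<Rightarrow> real^'n \<Rightarrow> complex" where
  "iter_partial [] g = g"
| "iter_partial (i # is) g = partial_deriv i (iter_partial is g)"

definition schwartz :: "(real^'n::finite \<Rightarrow> complex) \<Rightarrow> bool" where
  "schwartz f \<longleftrightarrow>
     (\<forall>is i x. ((\<lambda>s. iter_partial is f (x + s *\<^sub>R axis i 1))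
                  has_vector_derivative iter_partial (i # is) f x) (at 0)) \<and>
     (\<forall>is. continuous_on UNIV (iter_partial is f)) \<and>
     (\<forall>is (k::nat). bounded (range (\<lambda>x. (1 + norm x) ^ k *\<^sub>R iter_partial is f x)))"

definition fourier :: "(real^'n::finite \<Rightarrow> complex) \<Rightarrow> real^'n \<Rightarrow> complex" where
  "fourier f t = complex_of_real ((2 * pi) powr (- real CARD('n))) *
     (\<integral>u. exp (- \<i> * complex_of_real (inner t u)) * f u \<partial>lborel)"

definition inv_fourier :: "(real^'n::finite \<Rightarrow> complex) \<Rightarrow> real^'n \<Rightarrow> complex" where
  "inv_fourier f t = (\<integral>u. exp (\<i> * complex_of_real (inner t u)) * f u \<partial>lborel)"

text \<open>Elements of the algebraic tensor product S(R^d) (x) X are represented by finite lists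
  of pairs (f_k, x_k) with f_k Schwartz; the function is t \<mapsto> sum_k f_k(t) x_k.\<close>
definition tensor_fun :: "(complex \<Rightarrow> 'x \<Rightarrow> 'x::banach) \<Rightarrow> ((real^'n::finite \<Rightarrow> complex) \<times> 'x) list
    \<Rightarrow> real^'n \<Rightarrow> 'x" where
  "tensor_fun cs L t = (\<Sum>k<length L. cs (fst (L ! k) t) (snd (L ! k)))"

definition fourier_mult :: "(complex \<Rightarrow> 'x \<Rightarrow> 'x::banach) \<Rightarrow> (real^'n::finite \<Rightarrow> complex)
    \<Rightarrow> ((real^'n \<Rightarrow> complex) \<times> 'x) list \<Rightarrow> real^'n \<Rightarrow> 'x" where
  "fourier_mult cs m L t =
     (\<Sum>k<length L. cs (inv_fourier (\<lambda>\<xi>. m \<xi> * fourier (fst (L ! k)) \<xi>) t) (snd (L ! k)))"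

definition Lp_pow :: "real \<Rightarrow> (real^'n::finite \<Rightarrow> 'x::banach) \<Rightarrow> ennreal" where
  "Lp_pow p g = (\<integral>\<^sup>+ t. ennreal (norm (g t) powr p) \<partial>lborel)"

text \<open>Norm of T_m on L^p(R^d;X): least C with ||T_m g||_p \<le> C ||g||_p on S (x) X;
  infinity (top) if no such C exists.\<close>
definition multiplier_norm :: "real \<Rightarrow> (complex \<Rightarrow> 'x \<Rightarrow> 'x::banach) \<Rightarrow> (real^'n::finite \<Rightarrow> complex)
    \<Rightarrow> ennreal" where
  "multiplier_norm p cs m = Inf {ennreal C | C. C \<ge> 0 \<and>
     (\<forall>L. (\<forall>k<length L. schwartz (fst (L ! k))) \<longrightarrow>
          Lp_pow p (fourier_mult cs m L) \<le> ennreal (C powr p) * Lp_pow p (tensor_fun cs L))}"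

definition strongly_measurable :: "'w measure \<Rightarrow> ('w \<Rightarrow> 'x::banach) \<Rightarrow> bool" where
  "strongly_measurable N f \<longleftrightarrow>
     (\<exists>s :: nat \<Rightarrow> 'w \<Rightarrow> 'x. (\<forall>i. s i \<in> borel_measurable N \<and> finite (s i ` space N)) \<and>
        (\<forall>\<omega>\<in>space N. (\<lambda>i. s i \<omega>) \<longlonglongrightarrow> f \<omega>))"

text \<open>(d_n)_{n=1}^N is an X-valued L^p martingale difference sequence on the probability
  space M with respect to the filtration F_1 \<subseteq> ... \<subseteq> F_N (convention d_1 = f_1, f_0 = 0):
  d_n is strongly F_n-measurable and in L^p(M;X), and E(d_n | F_{n-1}) = 0 for n \<ge> 2,
  i.e. the Bochner integral of d_n over each B in F_{n-1} vanishes.  Since the library's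
  Bochner integral is only available for separable spaces, the vanishing of this Bochner
  integral is expressed through all bounded (real-)linear functionals (Hahn-Banach).\<close>
definition martingale_diff_seq :: "real \<Rightarrow> 'w measure \<Rightarrow> (nat \<Rightarrow> 'w measure)
    \<Rightarrow> (nat \<Rightarrow> 'w \<Rightarrow> 'x::banach) \<Rightarrow> nat \<Rightarrow> bool" where
  "martingale_diff_seq p M F d N \<longleftrightarrow>
     (\<forall>n\<in>{1..N}. subalgebra M (F n)) \<and>
     (\<forall>n m. 1 \<le> n \<longrightarrow> n \<le> m \<longrightarrow> m \<le> N \<longrightarrow> sets (F n) \<subseteq> sets (F m)) \<and>
     (\<forall>n\<in>{1..N}. strongly_measurable (F n) (d n) \<and>
                  integrable M (\<lambda>\<omega>. norm (d n \<omega>) powr p)) \<and>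
     (\<forall>n\<in>{2..N}. \<forall>B\<in>sets (F (n - 1)). \<forall>\<phi> :: 'x \<Rightarrow> real. bounded_linear \<phi> \<longrightarrow>
          (LINT \<omega>:B|M. \<phi> (d n \<omega>)) = 0)"

text \<open>UMD^A_p constant, with the probability spaces ranging over measures on the type 'w.
  (A theorem with a free type variable 'w quantifies over all such types.)\<close>
definition umd_constant :: "'w itself \<Rightarrow> real \<Rightarrow> (complex \<Rightarrow> 'x \<Rightarrow> 'x::banach) \<Rightarrow> complex set
    \<Rightarrow> ennreal" where
  "umd_constant _ p cs A = Inf {ennreal b | b. b \<ge> 0 \<and>
     (\<forall>(M::'w measure) F (d :: nat \<Rightarrow> 'w \<Rightarrow> 'x) N \<epsilon>.
        prob_space M \<longrightarrow> martingale_diff_seq p M F d N \<longrightarrow> (\<forall>n. \<epsilon> n \<in> A) \<longrightarrow>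
        (\<integral>\<^sup>+ \<omega>. ennreal (norm (\<Sum>n=1..N. cs (\<epsilon> n) (d n \<omega>)) powr p) \<partial>M)
          \<le> ennreal (b powr p) * (\<integral>\<^sup>+ \<omega>. ennreal (norm (\<Sum>n=1..N. d n \<omega>) powr p) \<partial>M))}"

end

(* The transform by a multiplier sequence is first bounded for trigonometric polynomials on a torus.
   Let x carry N phases s^2 xi_1.x, ..., s^(N+1) xi_N.x.  On a Gaussian times a character with frequency
   s xi_0 + sum_j s^(j+1) k_j xi_j the multiplier acts, as s tends to infinity, like the scalar
   m (xi_n), n being the last index with k_n nonzero: the top term fixes the direction, and m is even
   and homogeneous.  Integrating the multiplier inequality over independent rotations of all phases
   turns both sides into exact integrals over the torus, so that Fatou's lemma gives, with the given
   constant, the transform inequality for "martingales" of trigonometric polynomials.  The extra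
   frequency s xi_0 avoids the frequency zero and allows a first difference that is not centered.

   Polynomials in Re z_j approximate indicators of intervals for the uniform variable
   arccos (Re z_j) / pi, and these simulate an arbitrary finite tree.  A general martingale is
   approximated by simple functions s_n; recentering s_n on the finite partition generated by
   s_1, ..., s_(n-1) costs little because the conditional means are small, by a norming functional and
   Jensen's inequality. *)

theory Submission
  imports Defs
begin

section \<open>Norming functionals\<close>

text \<open>The inequality has to come out with exactly the given constant, and this shapes the
  steps. The phases are rotated independently, so that averages over the torus are exact integrals
  without an equidistribution error. Main terms are split by convexity with a weight
  \<open>t\<close> that tends to 0; crude bounds are used for error terms only. A real function of
  \<open>Re z\<close> contains each frequency together with its negative, and evenness of
  \<open>m\<close> makes the multiplier act on both by one scalar. Mean zero in the last coordinate
  says that every monomial has a nonzero last exponent: this is how the martingale property is seen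
  by the frequencies. \<open>X\<close> may be nonseparable. Measurability therefore goes through
  limits of simple functions, and the vanishing of conditional expectations, given by functionals,
  is turned into norm estimates by the Hahn-Banach theorem. For the second claim constants may be
  lost: a nonconstant \<open>m\<close> takes two distinct values, and transforms by these two alone
  control all transforms by unimodular numbers.\<close>

definition sublinear :: "('a::real_vector \<Rightarrow> real) \<Rightarrow> bool" where
  "sublinear q \<longleftrightarrow> (\<forall>x y. q (x + y) \<le> q x + q y) \<and> (\<forall>c>0. \<forall>x. q (c *\<^sub>R x) \<le> c * q x)"

lemma sublinear_add: "sublinear q \<Longrightarrow> q (x + y) \<le> q x + q y"
  and sublinear_scaleR_le: "sublinear q \<Longrightarrow> c > 0 \<Longrightarrow> q (c *\<^sub>R x) \<le> c * q x"
  by (auto simp: sublinear_def)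

lemma sublinear_zero:
  assumes "sublinear q" shows "q 0 = 0"
  using sublinear_scaleR_le[OF assms, of 2 0] sublinear_scaleR_le[OF assms, of "1/2" 0] by simp

lemma sublinear_scaleR:
  assumes "sublinear q" "c \<ge> 0" shows "q (c *\<^sub>R x) = c * q x"
proof (cases "c = 0")
  case True then show ?thesis by (simp add: sublinear_zero[OF assms(1)])
next
  case False
  then have c: "c > 0" using assms(2) by simp
  have "q x = q ((1/c) *\<^sub>R (c *\<^sub>R x))" using c by simp
  also have "\<dots> \<le> (1/c) * q (c *\<^sub>R x)" using c by (intro sublinear_scaleR_le assms(1)) simp
  finally have "c * q x \<le> q (c *\<^sub>R x)" using c by (simp add: field_simps)
  then show ?thesis using sublinear_scaleR_le[OF assms(1) c, of x] by simp
qed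

lemma sublinear_lower:
  assumes "sublinear q" shows "- q (- x) \<le> q x"
  using sublinear_add[OF assms, of x "-x"] sublinear_zero[OF assms] by simp

text \<open>The auxiliary functional of the Hahn-Banach theorem. For sublinear \<open>q\<close>, the
  choice \<open>t = 0\<close> puts it below \<open>q\<close>, and \<open>t = 1\<close> makes its
  value at \<open>- y\<close> at most \<open>- q y\<close>, so a linear functional below it must
  agree with \<open>q\<close> at \<open>y\<close>.\<close>

definition sublinear_shift :: "('a::real_vector \<Rightarrow> real) \<Rightarrow> 'a \<Rightarrow> 'a \<Rightarrow> real" where
  "sublinear_shift q y x = (INF t\<in>{0..}. q (x + t *\<^sub>R y) - t * q y)"

lemma sublinear_shift_bdd:
  assumes "sublinear q"
  shows "bdd_below ((\<lambda>t. q (x + t *\<^sub>R y) - t * q y) ` {0..})"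
proof (rule bdd_belowI2[where m = "- q (- x)"])
  fix t :: real assume "t \<in> {0..}"
  then have "t * q y = q (t *\<^sub>R y)" by (simp add: sublinear_scaleR[OF assms])
  also have "\<dots> \<le> q (x + t *\<^sub>R y) + q (- x)"
    using sublinear_add[OF assms, of "x + t *\<^sub>R y" "-x"] by simp
  finally show "- q (- x) \<le> q (x + t *\<^sub>R y) - t * q y" by simp
qed

lemma sublinear_shift_le:
  assumes "sublinear q" "t \<ge> 0"
  shows "sublinear_shift q y x \<le> q (x + t *\<^sub>R y) - t * q y"
  unfolding sublinear_shift_def by (rule cINF_lower[OF sublinear_shift_bdd[OF assms(1)]]) (use assms in auto)

text \<open>Parameters \<open>t1\<close> and \<open>t2\<close> for the summands give
  \<open>t1 + t2\<close> for the sum, and \<open>t\<close> for \<open>x\<close> gives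
  \<open>c * t\<close> for the multiple; both are again nonnegative.\<close>

lemma sublinear_sublinear_shift:
  assumes q: "sublinear q" shows "sublinear (sublinear_shift q y)"
  unfolding sublinear_def
proof (intro conjI allI impI)
  fix x1 x2
  have "sublinear_shift q y (x1 + x2) - (q (x1 + t1 *\<^sub>R y) - t1 * q y) \<le> q (x2 + t2 *\<^sub>R y) - t2 * q y"
    if "t1 \<ge> 0" "t2 \<ge> 0" for t1 t2
  proof -
    have "sublinear_shift q y (x1 + x2) \<le> q ((x1 + x2) + (t1 + t2) *\<^sub>R y) - (t1 + t2) * q y"
      using that by (intro sublinear_shift_le q) auto
    moreover have "q ((x1 + x2) + (t1 + t2) *\<^sub>R y) \<le> q (x1 + t1 *\<^sub>R y) + q (x2 + t2 *\<^sub>R y)"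
      using sublinear_add[OF q, of "x1 + t1 *\<^sub>R y" "x2 + t2 *\<^sub>R y"] by (simp add: algebra_simps)
    ultimately show ?thesis by (simp add: algebra_simps)
  qed
  then have "sublinear_shift q y (x1 + x2) - (q (x1 + t1 *\<^sub>R y) - t1 * q y) \<le> sublinear_shift q y x2"
    if "t1 \<ge> 0" for t1
    using that unfolding sublinear_shift_def[of q y x2] by (intro cINF_greatest) auto
  then have "sublinear_shift q y (x1 + x2) - sublinear_shift q y x2 \<le> q (x1 + t1 *\<^sub>R y) - t1 * q y"
    if "t1 \<ge> 0" for t1 using that by (simp add: algebra_simps)
  then have "sublinear_shift q y (x1 + x2) - sublinear_shift q y x2 \<le> sublinear_shift q y x1"
    unfolding sublinear_shift_def[of q y x1] by (intro cINF_greatest) auto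
  then show "sublinear_shift q y (x1 + x2) \<le> sublinear_shift q y x1 + sublinear_shift q y x2" by simp
next
  fix c :: real and x assume c: "c > 0"
  have "sublinear_shift q y (c *\<^sub>R x) / c \<le> q (x + t *\<^sub>R y) - t * q y" if "t \<ge> 0" for t
  proof -
    have "sublinear_shift q y (c *\<^sub>R x) \<le> q (c *\<^sub>R x + (c * t) *\<^sub>R y) - (c * t) * q y"
      using that c by (intro sublinear_shift_le q) auto
    also have "c *\<^sub>R x + (c * t) *\<^sub>R y = c *\<^sub>R (x + t *\<^sub>R y)" by (simp add: algebra_simps)
    also have "q \<dots> = c * q (x + t *\<^sub>R y)" using c by (intro sublinear_scaleR q) auto
    finally show ?thesis using c by (simp add: field_simps)
  qed
  then have "sublinear_shift q y (c *\<^sub>R x) / c \<le> sublinear_shift q y x"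
    unfolding sublinear_shift_def[of q y x] by (intro cINF_greatest) auto
  then show "sublinear_shift q y (c *\<^sub>R x) \<le> c * sublinear_shift q y x"
    using c by (simp add: field_simps)
qed

text \<open>Zorn's lemma with pointwise infima as lower bounds of chains. These stay finite because
  every sublinear \<open>q\<close> below \<open>p\<close> satisfies
  \<open>- p (- x) \<le> q x\<close>.\<close>

lemma minimal_sublinear_exists:
  assumes p: "sublinear p"
  shows "\<exists>q. sublinear q \<and> q \<le> p \<and> (\<forall>r. sublinear r \<longrightarrow> r \<le> q \<longrightarrow> r = q)"
proof -
  define A where "A = {q. sublinear q \<and> q \<le> p}"
  \<comment> \<open>The order is reversed: the maximal element delivered by Zorn's lemma is a
    minimal functional.\<close>
  define R :: "('a \<Rightarrow> real) \<Rightarrow> ('a \<Rightarrow> real) \<Rightarrow> bool" where "R = (\<lambda>f g. g \<le> f)"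
  have "\<exists>m\<in>A. \<forall>a\<in>A. R m a \<longrightarrow> a = m"
  proof (rule predicate_Zorn)
    show "partial_order_on A (relation_of R A)"
      by (rule partial_order_on_relation_ofI) (auto simp: R_def)
  next
    fix C assume C: "C \<in> Chains (relation_of R A)"
    then have CA: "C \<subseteq> A" by (auto simp: Chains_def relation_of_def)
    have chain: "f \<le> g \<or> g \<le> f" if "f \<in> C" "g \<in> C" for f g
      using C that by (auto simp: Chains_def relation_of_def R_def)
    show "\<exists>u\<in>A. \<forall>a\<in>C. R a u"
    proof (cases "C = {}")
      case True then show ?thesis using p by (auto simp: A_def)
    next
      case False
      define u where "u x = (INF q\<in>C. q x)" for x
      have bdd: "bdd_below ((\<lambda>q. q x) ` C)" for x
      proof (rule bdd_belowI2[where m = "- p (- x)"])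
        fix q assume "q \<in> C"
        then have "sublinear q" "q (- x) \<le> p (- x)" using CA by (auto simp: A_def le_fun_def)
        then show "- p (- x) \<le> q x" using sublinear_lower[of q x] by linarith
      qed
      have u_le: "u x \<le> q x" if "q \<in> C" for q x
        unfolding u_def by (rule cINF_lower[OF bdd that])
      have le_u: "b \<le> u x" if "\<And>q. q \<in> C \<Longrightarrow> b \<le> q x" for b x
        unfolding u_def using False that by (intro cINF_greatest) auto
      have "sublinear u" unfolding sublinear_def
      proof (intro conjI allI impI)
        fix x y
        have *: "u (x + y) \<le> f x + g y" if fg: "f \<in> C" "g \<in> C" for f g
        proof -
          \<comment> \<open>Of two members of a chain, the smaller one can stand for both.\<close>
          obtain h where h: "h \<in> C" "h \<le> f" "h \<le> g" using chain[OF fg] fg by blast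
          have "u (x + y) \<le> h (x + y)" by (rule u_le[OF h(1)])
          also have "\<dots> \<le> h x + h y" using h(1) CA by (intro sublinear_add) (auto simp: A_def)
          also have "\<dots> \<le> f x + g y" using h(2,3) by (intro add_mono) (auto simp: le_fun_def)
          finally show ?thesis .
        qed
        have "u (x + y) - f x \<le> u y" if "f \<in> C" for f
          using *[OF that] by (intro le_u) (simp add: algebra_simps)
        then have "u (x + y) - u y \<le> u x" by (intro le_u) (simp add: algebra_simps)
        then show "u (x + y) \<le> u x + u y" by simp
      next
        fix c :: real and x :: 'a assume c: "c > 0"
        have "u (c *\<^sub>R x) / c \<le> u x"
        proof (rule le_u)
          fix q assume q: "q \<in> C"
          have "u (c *\<^sub>R x) \<le> q (c *\<^sub>R x)" by (rule u_le[OF q])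
          also have "\<dots> \<le> c * q x" using q CA c by (intro sublinear_scaleR_le) (auto simp: A_def)
          finally show "u (c *\<^sub>R x) / c \<le> q x" using c by (simp add: field_simps)
        qed
        then show "u (c *\<^sub>R x) \<le> c * u x" using c by (simp add: field_simps)
      qed
      moreover have "u \<le> p"
      proof -
        obtain q where "q \<in> C" using False by blast
        then have "u \<le> q" "q \<le> p" using u_le[of q] CA by (auto simp: A_def le_fun_def)
        then show ?thesis by simp
      qed
      ultimately show ?thesis using u_le by (intro bexI[of _ u]) (auto simp: A_def R_def le_fun_def)
    qed
  qed
  then obtain q where "q \<in> A" and min: "\<And>r. r \<in> A \<Longrightarrow> r \<le> q \<Longrightarrow> r = q"
    unfolding R_def by blast
  then show ?thesis
    by (intro exI[of _ q]) (auto simp: A_def intro: order_trans)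
qed

text \<open>A minimal sublinear functional equals all its shifts, which forces additivity.\<close>

lemma minimal_sublinear_linear:
  assumes q: "sublinear q" and min: "\<And>r. sublinear r \<Longrightarrow> r \<le> q \<Longrightarrow> r = q"
  shows "linear q"
proof -
  have add: "q (x + y) = q x + q y" for x y
  proof -
    have "sublinear_shift q y \<le> q"
      using sublinear_shift_le[OF q, of 0 y] by (simp add: le_fun_def)
    then have "sublinear_shift q y = q" by (intro min sublinear_sublinear_shift q)
    then have "q x \<le> q (x + y) - q y"
      using sublinear_shift_le[OF q, of 1 y x] by simp
    then show ?thesis using sublinear_add[OF q, of x y] by simp
  qed
  have neg: "q (- x) = - q x" for x
    using add[of x "-x"] sublinear_zero[OF q] by simp
  show ?thesis
  proof (rule linearI)
    fix c x show "q (c *\<^sub>R x) = c *\<^sub>R q x"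
    proof (cases "c \<ge> 0")
      case True then show ?thesis by (simp add: sublinear_scaleR[OF q])
    next
      case False
      then have "q ((- c) *\<^sub>R x) = - c * q x" by (intro sublinear_scaleR q) auto
      then show ?thesis using neg[of "c *\<^sub>R x"] by simp
    qed
  qed (rule add)
qed

text \<open>Minimising below the norm shifted in direction \<open>x0\<close> builds the prescribed
  value in: it gives \<open>q (- x0) \<le> - norm x0\<close>, and linearity turns this into
  \<open>norm x0 \<le> q x0\<close>.\<close>

theorem norming_functional_exists:
  fixes x0 :: "'a::real_normed_vector"
  obtains \<phi> :: "'a \<Rightarrow> real"
  where "bounded_linear \<phi>" "\<phi> x0 = norm x0" "\<And>x. \<bar>\<phi> x\<bar> \<le> norm x"
proof -
  have n: "sublinear (norm :: 'a \<Rightarrow> real)"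
    by (auto simp: sublinear_def norm_triangle_ineq)
  define p where "p = sublinear_shift (norm :: 'a \<Rightarrow> real) x0"
  have p: "sublinear p" unfolding p_def by (rule sublinear_sublinear_shift[OF n])
  have p_le: "p x \<le> norm x" for x
    using sublinear_shift_le[OF n, of 0 x0 x] by (simp add: p_def)
  have p0: "p (- x0) \<le> - norm x0"
    using sublinear_shift_le[OF n, of 1 x0 "- x0"] by (simp add: p_def)
  obtain q where q: "sublinear q" "q \<le> p" "\<And>r. sublinear r \<Longrightarrow> r \<le> q \<Longrightarrow> r = q"
    using minimal_sublinear_exists[OF p] by blast
  have lin: "linear q" by (rule minimal_sublinear_linear[OF q(1,3)])
  have le: "q x \<le> norm x" for x using q(2) p_le[of x] by (meson le_funD order_trans)
  have neg: "q (- x) = - q x" for x by (rule linear_neg[OF lin])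
  have abs: "\<bar>q x\<bar> \<le> norm x" for x using le[of x] le[of "-x"] neg[of x] by simp
  have "bounded_linear q"
    using lin abs by (intro bounded_linear_intro[where K = 1]) (auto simp: linear_add linear_scale)
  moreover have "q x0 = norm x0"
    using le[of x0] neg[of x0] p0 le_funD[OF q(2), of "- x0"] by simp
  ultimately show ?thesis using that abs by blast
qed

section \<open>Modulated Gaussians\<close>

definition mod_gauss :: "'a::euclidean_space \<Rightarrow> 'a \<Rightarrow> complex" where
  "mod_gauss l x = exp (\<i> * complex_of_real (l \<bullet> x) - complex_of_real (x \<bullet> x / 2))"

abbreviation gauss :: "'a::euclidean_space \<Rightarrow> complex" where
  "gauss x \<equiv> complex_of_real (exp (- ((norm x)\<^sup>2 / 2)))"

text \<open>The coefficients that appear under differentiation: every iterated partial derivative of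
  \<open>mod_gauss l\<close> is such a polynomial times \<open>mod_gauss l\<close>.\<close>

inductive coord_poly :: "(real^'n::finite \<Rightarrow> complex) \<Rightarrow> bool" where
  const: "coord_poly (\<lambda>x. c)"
| coord: "coord_poly (\<lambda>x. complex_of_real (x $ i))"
| add: "coord_poly P \<Longrightarrow> coord_poly Q \<Longrightarrow> coord_poly (\<lambda>x. P x + Q x)"
| mult: "coord_poly P \<Longrightarrow> coord_poly Q \<Longrightarrow> coord_poly (\<lambda>x. P x * Q x)"

lemma coord_poly_continuous: "coord_poly P \<Longrightarrow> continuous_on UNIV P"
  by (induction rule: coord_poly.induct) (auto intro!: continuous_intros)

lemma coord_poly_growth: "coord_poly P \<Longrightarrow> \<exists>C k. \<forall>x. cmod (P x) \<le> C * (1 + norm x) ^ k"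
proof (induction rule: coord_poly.induct)
  case (const c)
  then show ?case by (intro exI[of _ "cmod c"] exI[of _ 0]) auto
next
  case (coord i)
  have "\<bar>x $ i\<bar> \<le> 1 + norm x" for x
    using component_le_norm_cart[of x i] by linarith
  then show ?case by (intro exI[of _ 1] exI[of _ 1]) auto
next
  case (add P Q)
  then obtain C k D l where P: "\<And>x. cmod (P x) \<le> C * (1 + norm x) ^ k"
    and Q: "\<And>x. cmod (Q x) \<le> D * (1 + norm x) ^ l" by blast
  have "cmod (P x + Q x) \<le> (\<bar>C\<bar> + \<bar>D\<bar>) * (1 + norm x) ^ (k + l)" for x
  proof -
    have "cmod (P x + Q x) \<le> C * (1 + norm x) ^ k + D * (1 + norm x) ^ l"
      using P[of x] Q[of x] norm_triangle_ineq[of "P x" "Q x"] by linarith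
    also have "\<dots> \<le> \<bar>C\<bar> * (1 + norm x) ^ (k + l) + \<bar>D\<bar> * (1 + norm x) ^ (k + l)"
      by (intro add_mono mult_mono power_increasing) auto
    finally show ?thesis by (simp add: algebra_simps)
  qed
  then show ?case by blast
next
  case (mult P Q)
  then obtain C k D l where P: "\<And>x. cmod (P x) \<le> C * (1 + norm x) ^ k"
    and Q: "\<And>x. cmod (Q x) \<le> D * (1 + norm x) ^ l" by blast
  have "cmod (P x * Q x) \<le> (C * D) * (1 + norm x) ^ (k + l)" for x
  proof -
    have "cmod (P x * Q x) \<le> (C * (1 + norm x) ^ k) * (D * (1 + norm x) ^ l)"
      unfolding norm_mult using P[of x] Q[of x] by (intro mult_mono) (auto intro: order_trans[OF norm_ge_zero])
    then show ?thesis by (simp add: power_add algebra_simps)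
  qed
  then show ?case by blast
qed

lemma coord_poly_deriv:
  "coord_poly P \<Longrightarrow> \<exists>P'. coord_poly P' \<and> (\<forall>x. ((\<lambda>s. P (x + s *\<^sub>R axis i 1)) has_vector_derivative P' x) (at 0))"
proof (induction rule: coord_poly.induct)
  case (const c)
  then show ?case by (intro exI[of _ "\<lambda>x. 0"]) (auto intro: coord_poly.const)
next
  case (coord j)
  have "((\<lambda>s. complex_of_real ((x + s *\<^sub>R axis i 1) $ j)) has_vector_derivative complex_of_real (axis i 1 $ j)) (at 0)" for x
    by (auto intro!: derivative_eq_intros simp: has_vector_derivative_complex_iff)
  then show ?case by (intro exI[of _ "\<lambda>x. complex_of_real (axis i 1 $ j)"]) (auto intro: coord_poly.const)
next
  case (add P Q)
  then obtain P' Q' where "coord_poly P'" "coord_poly Q'"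
    and P: "\<And>x. ((\<lambda>s. P (x + s *\<^sub>R axis i 1)) has_vector_derivative P' x) (at 0)"
    and Q: "\<And>x. ((\<lambda>s. Q (x + s *\<^sub>R axis i 1)) has_vector_derivative Q' x) (at 0)" by blast
  then show ?case
    by (intro exI[of _ "\<lambda>x. P' x + Q' x"]) (auto intro!: coord_poly.add has_vector_derivative_add P Q)
next
  case (mult P Q)
  then obtain P' Q' where *: "coord_poly P'" "coord_poly Q'"
    and P: "\<And>x. ((\<lambda>s. P (x + s *\<^sub>R axis i 1)) has_vector_derivative P' x) (at 0)"
    and Q: "\<And>x. ((\<lambda>s. Q (x + s *\<^sub>R axis i 1)) has_vector_derivative Q' x) (at 0)" by blast
  have "((\<lambda>s. P (x + s *\<^sub>R axis i 1) * Q (x + s *\<^sub>R axis i 1)) has_vector_derivative P x * Q' x + P' x * Q x) (at 0)" for x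
    using has_vector_derivative_mult[OF P[of x] Q[of x]] by simp
  with * mult.hyps show ?case
    by (intro exI[of _ "\<lambda>x. P x * Q' x + P' x * Q x"]) (auto intro!: coord_poly.add coord_poly.mult)
qed

lemma mod_gauss_deriv:
  fixes x :: "real^'n::finite"
  shows "((\<lambda>s. mod_gauss l (x + s *\<^sub>R axis i 1)) has_vector_derivative
    (\<i> * of_real (l $ i) - of_real (x $ i)) * mod_gauss l x) (at 0)"
proof -
  \<comment> \<open>The exponent along the line \<open>x + s *\<^sub>R axis i 1\<close>, a quadratic
    polynomial in a complex \<open>s\<close>; its derivative at 0 is the linear coefficient.\<close>
  define w where "w s = \<i> * of_real (l \<bullet> x) - of_real (x \<bullet> x / 2)
      + s * (\<i> * of_real (l $ i) - of_real (x $ i)) - s ^ 2 / 2" for s :: complex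
  have e: "mod_gauss l (x + s *\<^sub>R axis i 1) = exp (w (of_real s))" for s
    unfolding mod_gauss_def w_def
    by (intro arg_cong[where f = exp])
       (simp add: inner_add_left inner_add_right inner_axis inner_axis' power2_eq_square field_simps)
  have "((\<lambda>s. exp (w s)) has_field_derivative
      (\<i> * of_real (l $ i) - of_real (x $ i)) * mod_gauss l x) (at 0)"
    using e[of 0] unfolding w_def by (auto intro!: derivative_eq_intros)
  then have "((\<lambda>s. exp (w s)) has_field_derivative
      (\<i> * of_real (l $ i) - of_real (x $ i)) * mod_gauss l x) (at (of_real 0))" by simp
  from has_vector_derivative_real_field[OF this] show ?thesis
    by (simp add: e o_def)
qed

lemma norm_mod_gauss: "cmod (mod_gauss l x) = exp (- ((norm x)\<^sup>2 / 2))"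
  by (simp add: mod_gauss_def power2_norm_eq_inner)

lemma continuous_mod_gauss: "continuous_on UNIV (mod_gauss l)"
  unfolding mod_gauss_def by (auto intro!: continuous_intros)

text \<open>By \<open>1 + r \<le> exp r\<close> the exponent is at most
  \<open>k * r - r^2 / 2\<close>, and completing the square bounds this by
  \<open>k^2 / 2\<close>.\<close>

lemma poly_gauss_bounded:
  fixes r :: real assumes "r \<ge> 0"
  shows "(1 + r) ^ k * exp (- (r\<^sup>2 / 2)) \<le> exp ((real k)\<^sup>2 / 2)"
proof -
  have "(1 + r) ^ k \<le> exp r ^ k" using assms by (intro power_mono exp_ge_add_one_self) auto
  then have "(1 + r) ^ k * exp (- (r\<^sup>2 / 2)) \<le> exp (real k * r) * exp (- (r\<^sup>2 / 2))"
    by (intro mult_right_mono) (auto simp: exp_of_nat_mult)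
  also have "\<dots> = exp (real k * r - r\<^sup>2 / 2)" by (simp add: exp_add[symmetric])
  also have "\<dots> \<le> exp ((real k)\<^sup>2 / 2)"
    using zero_le_power2[of "r - real k"] by (simp add: power2_eq_square algebra_simps)
  finally show ?thesis .
qed

lemma schwartz_mod_gauss: "schwartz (mod_gauss (l :: real^'n::finite))"
proof -
  have D: "\<exists>P'. coord_poly P' \<and> (\<forall>x. ((\<lambda>s. P (x + s *\<^sub>R axis i 1) * mod_gauss l (x + s *\<^sub>R axis i 1))
      has_vector_derivative P' x * mod_gauss l x) (at 0))" if P: "coord_poly P" for P and i :: 'n
  proof -
    obtain P' where P': "coord_poly P'"
      and d: "\<And>x. ((\<lambda>s. P (x + s *\<^sub>R axis i 1)) has_vector_derivative P' x) (at 0)"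
      using coord_poly_deriv[OF P, of i] by blast
    let ?Q = "\<lambda>x. P x * (\<i> * of_real (l $ i) + (-1) * of_real (x $ i)) + P' x"
    have "coord_poly ?Q" by (intro coord_poly.intros P P')
    moreover have "((\<lambda>s. P (x + s *\<^sub>R axis i 1) * mod_gauss l (x + s *\<^sub>R axis i 1))
      has_vector_derivative ?Q x * mod_gauss l x) (at 0)" for x
      using has_vector_derivative_mult[OF d[of x] mod_gauss_deriv[of l x i]] by (simp add: algebra_simps)
    ultimately show ?thesis by blast
  qed
  have form: "\<exists>P. coord_poly P \<and> iter_partial is (mod_gauss l) = (\<lambda>x. P x * mod_gauss l x)" for "is"
  proof (induction "is")
    case Nil
    then show ?case by (intro exI[of _ "\<lambda>x. 1"]) (auto intro: coord_poly.const)
  next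
    case (Cons i "is")
    then obtain P where P: "coord_poly P" "iter_partial is (mod_gauss l) = (\<lambda>x. P x * mod_gauss l x)" by blast
    from D[OF P(1), of i] obtain P' where P': "coord_poly P'"
      "\<And>x. ((\<lambda>s. P (x + s *\<^sub>R axis i 1) * mod_gauss l (x + s *\<^sub>R axis i 1))
      has_vector_derivative P' x * mod_gauss l x) (at 0)" by blast
    have "iter_partial (i # is) (mod_gauss l) x = P' x * mod_gauss l x" for x
      using P'(2)[of x] by (simp add: P(2) partial_deriv_def vector_derivative_at)
    with P'(1) show ?case by blast
  qed
  show ?thesis unfolding schwartz_def
  proof (intro conjI allI)
    fix "is" i x
    obtain P where P: "coord_poly P" "iter_partial is (mod_gauss l) = (\<lambda>x. P x * mod_gauss l x)"
      using form by blast
    from D[OF P(1), of i] obtain P' where P': "coord_poly P'"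
      "\<And>x. ((\<lambda>s. P (x + s *\<^sub>R axis i 1) * mod_gauss l (x + s *\<^sub>R axis i 1))
      has_vector_derivative P' x * mod_gauss l x) (at 0)" by blast
    show "((\<lambda>s. iter_partial is (mod_gauss l) (x + s *\<^sub>R axis i 1)) has_vector_derivative
            iter_partial (i # is) (mod_gauss l) x) (at 0)"
      using P'(2)[of x] by (simp add: P(2) partial_deriv_def vector_derivative_at)
  next
    fix "is"
    obtain P where "iter_partial is (mod_gauss l) = (\<lambda>x. P x * mod_gauss l x)" "coord_poly P"
      using form by blast
    then show "continuous_on UNIV (iter_partial is (mod_gauss l))"
      by (simp only:) (intro continuous_on_mult coord_poly_continuous continuous_mod_gauss)
  next
    fix "is" k
    obtain P where P: "coord_poly P" "iter_partial is (mod_gauss l) = (\<lambda>x. P x * mod_gauss l x)"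
      using form by blast
    obtain C j where C: "\<And>x. cmod (P x) \<le> C * (1 + norm x) ^ j"
      using coord_poly_growth[OF P(1)] by blast
    have "0 \<le> cmod (P 0)" by simp
    also have "\<dots> \<le> C" using C[of 0] by simp
    finally have C0: "C \<ge> 0" .
    have "norm ((1 + norm x) ^ k *\<^sub>R (P x * mod_gauss l x)) \<le> C * exp ((real (k + j))\<^sup>2 / 2)" for x
    proof -
      have "norm ((1 + norm x) ^ k *\<^sub>R (P x * mod_gauss l x))
          = (1 + norm x) ^ k * cmod (P x) * exp (- ((norm x)\<^sup>2 / 2))"
        by (simp add: norm_mult norm_mod_gauss)
      also have "\<dots> \<le> (1 + norm x) ^ k * (C * (1 + norm x) ^ j) * exp (- ((norm x)\<^sup>2 / 2))"
        by (intro mult_right_mono mult_left_mono C) auto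
      also have "\<dots> = C * ((1 + norm x) ^ (k + j) * exp (- ((norm x)\<^sup>2 / 2)))"
        by (simp add: power_add)
      also have "\<dots> \<le> C * exp ((real (k + j))\<^sup>2 / 2)"
        by (intro mult_left_mono poly_gauss_bounded C0) auto
      finally show ?thesis .
    qed
    then show "bounded (range (\<lambda>x. (1 + norm x) ^ k *\<^sub>R iter_partial is (mod_gauss l) x))"
      unfolding P(2) by (intro boundedI[where B = "C * exp ((real (k + j))\<^sup>2 / 2)"]) auto
  qed
qed

section \<open>The Gaussian density and its Fourier transform\<close>

definition gauss_dens :: "'a::euclidean_space \<Rightarrow> real" where
  "gauss_dens x = (\<Prod>b\<in>Basis. std_normal_density (x \<bullet> b))"

lemma norm_sq_Basis: "(norm (x::'a::euclidean_space))\<^sup>2 = (\<Sum>b\<in>Basis. (x \<bullet> b)\<^sup>2)"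
  unfolding power2_norm_eq_inner by (subst euclidean_inner) (simp add: power2_eq_square)

lemma gauss_dens_eq:
  "gauss_dens (x::'a::euclidean_space) = (2 * pi) powr (- real DIM('a) / 2) * exp (- ((norm x)\<^sup>2 / 2))"
proof -
  have "gauss_dens x = (1 / sqrt (2 * pi)) ^ DIM('a) * exp (\<Sum>b\<in>Basis. - (x \<bullet> b)\<^sup>2 / 2)"
    by (simp add: gauss_dens_def std_normal_density_def prod.distrib exp_sum)
       (simp add: prod_dividef power_one_over)
  also have "(\<Sum>b\<in>Basis. - (x \<bullet> b)\<^sup>2 / 2) = - ((norm x)\<^sup>2 / 2)"
    by (simp add: sum_negf sum_divide_distrib[symmetric] norm_sq_Basis)
  also have "1 / sqrt (2 * pi) = (2 * pi) powr (- 1/2)"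
    by (simp add: powr_half_sqrt powr_minus_divide)
  also have "((2 * pi) powr (- 1/2)) ^ DIM('a) = (2 * pi) powr (- real DIM('a) / 2)"
    by (simp add: powr_realpow[symmetric] powr_powr)
  finally show ?thesis .
qed

lemma gauss_dens_nonneg: "gauss_dens x \<ge> 0"
  by (simp add: gauss_dens_def prod_nonneg)

lemma integral_lborel_prod_Basis:
  fixes f :: "'a::euclidean_space \<Rightarrow> real \<Rightarrow> 'b::{real_normed_field,banach,second_countable_topology}"
  assumes int: "\<And>b. b \<in> Basis \<Longrightarrow> integrable lborel (f b)"
  shows "(\<integral>x. (\<Prod>b\<in>Basis. f b (x \<bullet> b)) \<partial>lborel) = (\<Prod>b\<in>Basis. \<integral>t. f b t \<partial>lborel)"
    and "integrable lborel (\<lambda>x. \<Prod>b\<in>Basis. f b (x \<bullet> b))"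
proof -
  interpret product_sigma_finite "\<lambda>_::'a. lborel :: real measure" by standard
  have [measurable]: "f b \<in> borel_measurable borel" if "b \<in> Basis" for b
    using borel_measurable_integrable[OF int[OF that]] by simp
  have m: "(\<lambda>x. \<Prod>b\<in>Basis. f b (x \<bullet> b)) \<in> borel_measurable borel"
    by (intro borel_measurable_prod) measurable
  have s: "(\<Sum>b\<in>Basis. g b *\<^sub>R b) \<bullet> c = g c" if "c \<in> Basis" for g and c :: 'a
    using that by (simp add: inner_sum_left_Basis)
  have t: "(\<lambda>g. \<Sum>b\<in>Basis. g b *\<^sub>R b) \<in> measurable (Pi\<^sub>M Basis (\<lambda>_. lborel)) (borel :: 'a measure)"
    by measurable
  have "(\<integral>x. (\<Prod>b\<in>Basis. f b (x \<bullet> b)) \<partial>lborel)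
      = (\<integral>g. (\<Prod>b\<in>Basis. f b (g b)) \<partial>(Pi\<^sub>M Basis (\<lambda>_. lborel)))"
    by (subst lborel_eq, subst integral_distr[OF t m]) (simp add: s cong: prod.cong)
  then show "(\<integral>x. (\<Prod>b\<in>Basis. f b (x \<bullet> b)) \<partial>lborel) = (\<Prod>b\<in>Basis. \<integral>t. f b t \<partial>lborel)"
    by (simp add: product_integral_prod int)
  show "integrable lborel (\<lambda>x. \<Prod>b\<in>Basis. f b (x \<bullet> b))"
    by (subst lborel_eq, subst integrable_distr_eq[OF t m])
       (simp add: s product_integrable_prod int cong: prod.cong)
qed

lemma integrable_gauss_dens: "integrable lborel (gauss_dens :: 'a::euclidean_space \<Rightarrow> real)"
  unfolding gauss_dens_def by (intro integral_lborel_prod_Basis) auto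

lemma gauss_dens_measurable [measurable]: "gauss_dens \<in> borel_measurable borel"
  using borel_measurable_integrable[OF integrable_gauss_dens] by simp

text \<open>The integrand is a product over the coordinates, and each factor integrates to a value
  of the characteristic function of the standard normal law.\<close>

lemma char_gauss_dens:
  fixes t :: "'a::euclidean_space"
  shows "(\<integral>u. iexp (t \<bullet> u) * gauss_dens u \<partial>lborel) = exp (- ((norm t)\<^sup>2 / 2))"
proof -
  have 1: "(\<integral>u. complex_of_real (std_normal_density u) * iexp (s * u) \<partial>lborel) = exp (- (s\<^sup>2) / 2)" for s :: real
  proof -
    have "char std_normal_distribution s = complex_of_real (exp (- (s\<^sup>2) / 2))"
      by (simp add: char_std_normal_distribution)
    then show ?thesis unfolding char_def
      by (subst (asm) integral_density) (auto simp: normal_density_nonneg scaleR_conv_of_real)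
  qed
  have i: "integrable lborel (\<lambda>u. complex_of_real (std_normal_density u) * iexp (s * u))" for s :: real
    by (rule Bochner_Integration.integrable_bound[of lborel std_normal_density])
       (auto simp: norm_mult)
  have "iexp (t \<bullet> u) * gauss_dens u
      = (\<Prod>b\<in>Basis. complex_of_real (std_normal_density (u \<bullet> b)) * iexp ((t \<bullet> b) * (u \<bullet> b)))" for u
    by (simp add: prod.distrib gauss_dens_def euclidean_inner[of t u] sum_distrib_left exp_sum mult.commute)
  then have "(\<integral>u. iexp (t \<bullet> u) * gauss_dens u \<partial>lborel)
      = (\<integral>u. (\<Prod>b\<in>Basis. complex_of_real (std_normal_density (u \<bullet> b)) * iexp ((t \<bullet> b) * (u \<bullet> b))) \<partial>lborel)"
    by (simp only:)
  also have "\<dots> = (\<Prod>b\<in>Basis. complex_of_real (exp (- ((t \<bullet> b)\<^sup>2) / 2)))"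
    by (subst integral_lborel_prod_Basis(1)[OF i]) (simp only: 1)
  also have "\<dots> = complex_of_real (exp (\<Sum>b\<in>Basis. - (t \<bullet> b)\<^sup>2 / 2))" by (simp add: exp_sum)
  also have "(\<Sum>b\<in>Basis. - (t \<bullet> b)\<^sup>2 / 2) = - ((norm t)\<^sup>2 / 2)"
    by (simp add: sum_negf sum_divide_distrib[symmetric] norm_sq_Basis)
  finally show ?thesis .
qed

text \<open>With the normalisation of \<open>fourier\<close>, the powers of \<open>2 * pi\<close>
  combine so that a modulated Gaussian of height 1 is transformed into the probability density
  centered at its frequency.\<close>

lemma fourier_mod_gauss:
  fixes l :: "real^'n::finite"
  shows "fourier (mod_gauss l) t = gauss_dens (t - l)"
proof -
  let ?d = "real CARD('n)"
  have g: "mod_gauss l u = of_real ((2 * pi) powr (?d / 2)) * (iexp (l \<bullet> u) * gauss_dens u)" for u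
  proof -
    have "(2 * pi) powr (?d / 2) * gauss_dens u = exp (- ((norm u)\<^sup>2 / 2))"
      by (simp add: gauss_dens_eq powr_minus field_simps)
    then have "of_real ((2 * pi) powr (?d / 2)) * (iexp (l \<bullet> u) * gauss_dens u)
      = iexp (l \<bullet> u) * exp (- ((norm u)\<^sup>2 / 2))"
      by (metis mult.left_commute of_real_mult)
    also have "\<dots> = mod_gauss l u"
      unfolding mod_gauss_def diff_conv_add_uminus exp_add by (simp add: power2_norm_eq_inner exp_of_real[symmetric])
    finally show ?thesis ..
  qed
  have "(\<integral>u. exp (- \<i> * complex_of_real (t \<bullet> u)) * mod_gauss l u \<partial>lborel)
     = (\<integral>u. of_real ((2 * pi) powr (?d / 2)) * (iexp ((l - t) \<bullet> u) * gauss_dens u) \<partial>lborel)"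
    by (intro Bochner_Integration.integral_cong) (auto simp: g inner_diff_left exp_diff exp_minus algebra_simps field_simps)
  also have "\<dots> = of_real ((2 * pi) powr (?d / 2)) * exp (- ((norm (l - t))\<^sup>2 / 2))"
    using char_gauss_dens[of "l - t"] by (simp add: of_real_exp)
  finally have "fourier (mod_gauss l) t = of_real ((2 * pi) powr (- ?d) * (2 * pi) powr (?d / 2) * exp (- ((norm (l - t))\<^sup>2 / 2)))"
    unfolding fourier_def by (simp add: of_real_exp)
  also have "(2 * pi) powr (- ?d) * (2 * pi) powr (?d / 2) = (2 * pi) powr (- ?d / 2)"
    by (simp add: powr_add[symmetric])
  finally show ?thesis by (simp add: gauss_dens_eq norm_minus_commute)
qed

section \<open>The multiplier seen from a single frequency\<close>

definition local_mult :: "('a::euclidean_space \<Rightarrow> complex) \<Rightarrow> 'a \<Rightarrow> 'a \<Rightarrow> complex" where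
  "local_mult m l x = (\<integral>u. iexp (x \<bullet> u) * (m (l + u) * gauss_dens u) \<partial>lborel)"

text \<open>Translation by \<open>l\<close> moves the density back to the origin and splits off the
  modulation; \<open>local_mult\<close> is what remains of the multiplier.\<close>

lemma inv_fourier_mod_gauss:
  fixes l :: "real^'n::finite"
  assumes [measurable]: "m \<in> borel_measurable borel"
  shows "inv_fourier (\<lambda>\<xi>. m \<xi> * fourier (mod_gauss l) \<xi>) x = iexp (l \<bullet> x) * local_mult m l x"
proof -
  have "inv_fourier (\<lambda>\<xi>. m \<xi> * fourier (mod_gauss l) \<xi>) x
     = (\<integral>u. iexp (x \<bullet> u) * (m u * gauss_dens (u - l)) \<partial>(distr lborel borel ((+) l)))"
    unfolding inv_fourier_def fourier_mod_gauss lborel_distr_plus ..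
  also have "\<dots> = (\<integral>u. iexp (l \<bullet> x) * (iexp (x \<bullet> u) * (m (l + u) * gauss_dens u)) \<partial>lborel)"
    by (subst integral_distr)
       (auto intro!: Bochner_Integration.integral_cong simp: inner_add_right exp_add algebra_simps inner_commute[of x l])
  finally show ?thesis unfolding local_mult_def by simp
qed

text \<open>A symbol that becomes constant near the moving frequency leaves this constant times the
  transform of the density, which is \<open>gauss\<close>. The integrands are dominated by
  \<open>B * gauss_dens\<close>.\<close>

lemma local_mult_tendsto:
  assumes [measurable]: "m \<in> borel_measurable borel" and B: "\<And>\<xi>. cmod (m \<xi>) \<le> B"
    and lim: "\<And>u. (\<lambda>s. m (l s + u)) \<longlonglongrightarrow> e"
  shows "(\<lambda>s. local_mult m (l s) x) \<longlonglongrightarrow> e * gauss x"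
proof -
  have "(\<lambda>s. local_mult m (l s) x) \<longlonglongrightarrow> (\<integral>u. iexp (x \<bullet> u) * (e * gauss_dens u) \<partial>lborel)"
    unfolding local_mult_def
  proof (rule integral_dominated_convergence[where w = "\<lambda>u. B * gauss_dens u"])
    show "integrable lborel (\<lambda>u. B * gauss_dens u)" using integrable_gauss_dens by auto
  qed (auto intro!: tendsto_intros lim mult_right_mono B simp: norm_mult gauss_dens_nonneg)
  also have "(\<integral>u. iexp (x \<bullet> u) * (e * gauss_dens u) \<partial>lborel)
     = (\<integral>u. e * (iexp (x \<bullet> u) * gauss_dens u) \<partial>lborel)"
    by (intro Bochner_Integration.integral_cong) auto
  also have "\<dots> = e * gauss x"
    by (simp add: char_gauss_dens of_real_exp)
  finally show ?thesis .
qed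

lemma local_mult_measurable [measurable]:
  assumes [measurable]: "m \<in> borel_measurable borel"
  shows "local_mult m l \<in> borel_measurable borel"
  unfolding local_mult_def[abs_def] by measurable

section \<open>The torus\<close>

text \<open>The measure lives on the sphere alone, so 0 is not in the space: integer powers are
  continuous on it, and rotations map it to itself.\<close>

definition circ :: "complex measure" where
  "circ = distr (uniform_measure lborel {0..<1}) (restrict_space borel (sphere 0 1)) (\<lambda>t. cis (2 * pi * t))"

lemma space_circ [simp]: "space circ = sphere 0 1"
  by (simp add: circ_def space_restrict_space)

lemma sets_circ [measurable_cong]: "sets circ = sets (restrict_space borel (sphere 0 1))"
  by (simp add: circ_def)

lemma cis_measurable_circ [measurable]:
  "(\<lambda>t. cis (2 * pi * t)) \<in> measurable borel (restrict_space borel (sphere 0 1))"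
proof (rule measurable_restrict_space2)
  show "(\<lambda>t. cis (2 * pi * t)) \<in> borel \<rightarrow>\<^sub>M borel"
    unfolding cis_conv_exp by measurable
qed auto

lemma prob_space_circ: "prob_space circ"
  unfolding circ_def
proof (rule prob_space.prob_space_distr)
  show "prob_space (uniform_measure lborel {0..<1::real})"
    by (rule prob_space_uniform_measure) auto
qed measurable

lemma measurable_circ_continuous:
  "continuous_on (sphere 0 1) f \<Longrightarrow> f \<in> borel_measurable circ"
  using borel_measurable_continuous_on_restrict[of "sphere 0 1" f] by (simp add: measurable_cong_sets[OF sets_circ])

lemma nn_integral_circ:
  assumes "f \<in> borel_measurable circ"
  shows "(\<integral>\<^sup>+z. f z \<partial>circ) = (\<integral>\<^sup>+t. f (cis (2 * pi * t)) * indicator {0..<1} t \<partial>lborel)"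
proof -
  have f [measurable]: "f \<in> borel_measurable (restrict_space borel (sphere 0 1))"
    using assms by (simp add: measurable_cong_sets[OF sets_circ])
  have m: "(\<lambda>t. f (cis (2 * pi * t))) \<in> borel_measurable borel"
    by (rule measurable_compose[OF cis_measurable_circ f])
  have "(\<integral>\<^sup>+z. f z \<partial>circ) = (\<integral>\<^sup>+t. f (cis (2 * pi * t)) \<partial>uniform_measure lborel {0..<1})"
    unfolding circ_def by (rule nn_integral_distr) measurable
  also have "\<dots> = (\<integral>\<^sup>+t. f (cis (2 * pi * t)) * indicator {0..<1} t \<partial>lborel) / emeasure lborel {0..<1::real}"
    by (rule nn_integral_uniform_measure) (use m in auto)
  finally show ?thesis by (simp add: divide_ennreal_def)
qed

text \<open>The window \<open>{a..<1+a}\<close> is cut at 1 and its right piece is moved back by one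
  period.\<close>

lemma nn_integral_unit_period:
  fixes f :: "real \<Rightarrow> ennreal"
  assumes [measurable]: "f \<in> borel_measurable borel" and per: "\<And>t. f (1 + t) = f t"
    and a: "0 \<le> a" "a < 1"
  shows "(\<integral>\<^sup>+t. f (a + t) * indicator {0..<1} t \<partial>lborel) = (\<integral>\<^sup>+t. f t * indicator {0..<1} t \<partial>lborel)"
proof -
  have "(\<integral>\<^sup>+t. f (a + t) * indicator {0..<1} t \<partial>lborel) = (\<integral>\<^sup>+t. f t * indicator {a..<1+a} t \<partial>lborel)"
    by (subst (2) nn_integral_real_affine[where c = 1 and t = a])
       (auto intro!: nn_integral_cong simp: indicator_def)
  also have "\<dots> = (\<integral>\<^sup>+t. f t * indicator {a..<1} t + f t * indicator {1..<1+a} t \<partial>lborel)"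
    using a by (intro nn_integral_cong) (auto simp: indicator_def)
  also have "\<dots> = (\<integral>\<^sup>+t. f t * indicator {a..<1} t \<partial>lborel) + (\<integral>\<^sup>+t. f t * indicator {1..<1+a} t \<partial>lborel)"
    by (rule nn_integral_add) auto
  also have "(\<integral>\<^sup>+t. f t * indicator {1..<1+a} t \<partial>lborel) = (\<integral>\<^sup>+t. f t * indicator {0..<a} t \<partial>lborel)"
    by (subst nn_integral_real_affine[where c = 1 and t = 1])
       (auto intro!: nn_integral_cong simp: indicator_def per)
  also have "(\<integral>\<^sup>+t. f t * indicator {a..<1} t \<partial>lborel) + (\<integral>\<^sup>+t. f t * indicator {0..<a} t \<partial>lborel)
      = (\<integral>\<^sup>+t. f t * indicator {a..<1} t + f t * indicator {0..<a} t \<partial>lborel)"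
    by (rule nn_integral_add[symmetric]) auto
  also have "\<dots> = (\<integral>\<^sup>+t. f t * indicator {0..<1} t \<partial>lborel)"
    using a by (intro nn_integral_cong) (auto simp: indicator_def)
  finally show ?thesis .
qed

lemma sphere_mult_measurable:
  assumes "w \<in> sphere 0 1"
  shows "(\<lambda>z. w * z) \<in> measurable circ circ"
proof -
  have "(\<lambda>z. w * z) \<in> measurable (restrict_space borel (sphere 0 1)) (restrict_space borel (sphere 0 1))"
    using assms by (intro measurable_restrict_space2 borel_measurable_continuous_on_restrict continuous_intros)
       (auto simp: space_restrict_space norm_mult)
  then show ?thesis by (simp add: measurable_cong_sets[OF sets_circ sets_circ])
qed

lemma nn_integral_circ_rotate:
  assumes w: "w \<in> sphere 0 1" and f: "f \<in> borel_measurable circ"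
  shows "(\<integral>\<^sup>+z. f (w * z) \<partial>circ) = (\<integral>\<^sup>+z. f z \<partial>circ)"
proof -
  have f' [measurable]: "f \<in> borel_measurable (restrict_space borel (sphere 0 1))"
    using f by (simp add: measurable_cong_sets[OF sets_circ])
  define b where "b = Arg2pi w / (2 * pi)"
  have b: "0 \<le> b" "b < 1" using Arg2pi[of w] by (auto simp: b_def)
  have wb: "w = cis (2 * pi * b)" using w Arg2pi_eq[of w] by (simp add: b_def cis_conv_exp)
  have m: "(\<lambda>t. f (cis (2 * pi * t))) \<in> borel_measurable borel"
    by (rule measurable_compose[OF cis_measurable_circ f'])
  have "(\<integral>\<^sup>+z. f (w * z) \<partial>circ) = (\<integral>\<^sup>+t. f (cis (2 * pi * (b + t))) * indicator {0..<1} t \<partial>lborel)"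
    using measurable_compose[OF sphere_mult_measurable[OF w] f]
    by (subst nn_integral_circ) (auto simp: wb cis_mult algebra_simps)
  also have "\<dots> = (\<integral>\<^sup>+t. f (cis (2 * pi * t)) * indicator {0..<1} t \<partial>lborel)"
    by (rule nn_integral_unit_period[OF m _ b]) (simp add: distrib_left cis_mult[symmetric])
  finally show ?thesis by (simp add: nn_integral_circ[OF f])
qed

lemma distr_circ_rotate:
  assumes w: "w \<in> sphere 0 1"
  shows "distr circ circ (\<lambda>z. w * z) = circ"
proof (rule measure_eqI)
  fix A assume "A \<in> sets (distr circ circ (\<lambda>z. w * z))"
  then have A [measurable]: "A \<in> sets circ" by simp
  note sphere_mult_measurable[OF w, measurable]
  have "emeasure (distr circ circ (\<lambda>z. w * z)) A = (\<integral>\<^sup>+z. indicator A (w * z) \<partial>circ)"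
    using nn_integral_distr[OF sphere_mult_measurable[OF w], of "indicator A"] A by simp
  also have "\<dots> = emeasure circ A"
    by (subst nn_integral_circ_rotate[OF w]) auto
  finally show "emeasure (distr circ circ (\<lambda>z. w * z)) A = emeasure circ A" .
qed simp

lemma integral_circ_power_int:
  assumes "k \<noteq> 0"
  shows "(\<integral>z. z powi k \<partial>circ) = 0"
proof -
  \<comment> \<open>A rotation with \<open>w powi k = -1\<close>; invariance under it turns the
    integral into its own negative.\<close>
  define w where "w = cis (pi / of_int k)"
  have w: "w \<in> sphere 0 1" "w powi k = -1"
    using assms by (auto simp: w_def cis_power_int)
  have m: "(\<lambda>z::complex. z powi k) \<in> borel_measurable circ"
    by (intro measurable_circ_continuous continuous_intros) auto
  have "(\<integral>z. z powi k \<partial>circ) = (\<integral>z. z powi k \<partial>(distr circ circ (\<lambda>z. w * z)))"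
    by (simp add: distr_circ_rotate[OF w(1)])
  also have "\<dots> = (\<integral>z. (w * z) powi k \<partial>circ)"
    by (rule integral_distr[OF sphere_mult_measurable[OF w(1)] m])
  also have "\<dots> = - (\<integral>z. z powi k \<partial>circ)" by (simp add: power_int_mult_distrib w(2))
  finally show ?thesis by simp
qed

text \<open>The angle scaled to the unit interval, with both half-circles folded together. Unlike
  the argument it is continuous on the whole circle, and it depends on \<open>Re z\<close> only,
  which is a Laurent polynomial there.\<close>

definition circ_unif :: "complex \<Rightarrow> real" where
  "circ_unif z = arccos (Re z) / pi"

lemma Re_sphere: "z \<in> sphere 0 1 \<Longrightarrow> Re z \<in> {-1..1}"
  using abs_Re_le_cmod[of z] by auto

lemma circ_unif_measurable [measurable]: "circ_unif \<in> borel_measurable circ"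
  unfolding circ_unif_def[abs_def] using Re_sphere
  by (intro measurable_circ_continuous continuous_intros) (auto simp: abs_le_iff)

lemma circ_unif_uniform:
  assumes "0 \<le> a" "a \<le> b" "b \<le> 1"
  shows "(\<integral>\<^sup>+z. indicator {a..<b} (circ_unif z) \<partial>circ) = ennreal (b - a)"
proof -
  have V1: "circ_unif (cis (2 * pi * t)) = 2 * t" if "0 \<le> t" "t \<le> 1/2" for t
    using that by (simp add: circ_unif_def arccos_cos)
  have V2: "circ_unif (cis (2 * pi * t)) = 2 - 2 * t" if "1/2 \<le> t" "t \<le> 1" for t
  proof -
    have "cos (2 * pi * t) = cos (2 * pi - 2 * pi * t)"
      by (simp add: cos_diff)
    moreover have "arccos (cos (2 * pi - 2 * pi * t)) = 2 * pi - 2 * pi * t"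
      using that by (intro arccos_cos) (auto simp: mult_le_cancel_left field_simps)
    ultimately show ?thesis by (simp add: circ_unif_def field_simps)
  qed
  have "(\<integral>\<^sup>+z. indicator {a..<b} (circ_unif z) \<partial>circ)
     = (\<integral>\<^sup>+t. indicator {a..<b} (circ_unif (cis (2 * pi * t))) * indicator {0..<1} t \<partial>lborel)"
    by (rule nn_integral_circ) measurable
  also have "\<dots> = (\<integral>\<^sup>+t. indicator {a/2..<b/2} t + indicator {1-b/2<..1-a/2} t \<partial>lborel)"
  proof (rule nn_integral_cong_AE)
    \<comment> \<open>At \<open>t = 1\<close> the two sides differ when \<open>a = 0 < b\<close>;
      leaving out \<open>1/2\<close> just separates the two branches.\<close>
    have "AE t in lborel. t \<noteq> 1/2" "AE t in lborel. t \<noteq> (1::real)" by (rule AE_lborel_singleton)+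
    then show "AE t in lborel. (indicator {a..<b} (circ_unif (cis (2 * pi * t))) * indicator {0..<1} t :: ennreal)
      = indicator {a/2..<b/2} t + indicator {1-b/2<..1-a/2} t"
    proof eventually_elim
      case (elim t)
      consider "t < 0" | "0 \<le> t" "t < 1/2" | "1/2 < t" "t < 1" | "t > 1" using elim by linarith
      then show ?case
        using assms V1[of t] V2[of t] by cases (auto simp: indicator_def)
    qed
  qed
  also have "\<dots> = emeasure lborel {a/2..<b/2} + emeasure lborel {1-b/2<..1-a/2}"
    by (subst nn_integral_add) auto
  also have "\<dots> = ennreal (b - a)"
    using assms by (simp add: ennreal_plus[symmetric] diff_divide_distrib[symmetric] del: ennreal_plus)
  finally show ?thesis .
qed

section \<open>The torus as a product of circles\<close>

definition torus :: "nat \<Rightarrow> (nat \<Rightarrow> complex) measure" where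
  "torus N = Pi\<^sub>M {1..N} (\<lambda>_. circ)"

lemma space_torus: "space (torus N) = {1..N} \<rightarrow>\<^sub>E sphere 0 1"
  by (simp add: torus_def space_PiM)

lemma torus_component: "z \<in> space (torus N) \<Longrightarrow> j \<in> {1..N} \<Longrightarrow> z j \<in> sphere 0 1"
  by (auto simp: space_torus)

lemma prob_space_torus: "prob_space (torus N)"
  unfolding torus_def by (intro prob_space_PiM prob_space_circ)

interpretation circ: prob_space circ by (rule prob_space_circ)
interpretation torus: prob_space "torus N" by (rule prob_space_torus)
interpretation circ_prod: product_sigma_finite "\<lambda>_::nat. circ" by standard

lemma torus_component_measurable [measurable]:
  "j \<in> {1..N} \<Longrightarrow> (\<lambda>z. z j) \<in> measurable (torus N) circ"
  unfolding torus_def by measurable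

lemma torus_monomial_measurable [measurable]:
  "(\<lambda>z. \<Prod>j\<in>{1..N}. z j powi k j) \<in> borel_measurable (torus N)"
proof (rule borel_measurable_prod)
  fix j assume "j \<in> {1..N}"
  moreover have "(\<lambda>z::complex. z powi k j) \<in> borel_measurable circ"
    by (intro measurable_circ_continuous continuous_intros) auto
  ultimately show "(\<lambda>z. z j powi k j) \<in> borel_measurable (torus N)"
    by (intro measurable_compose[OF torus_component_measurable])
qed

definition torus_mult :: "nat \<Rightarrow> (nat \<Rightarrow> complex) \<Rightarrow> (nat \<Rightarrow> complex) \<Rightarrow> nat \<Rightarrow> complex" where
  "torus_mult N w z = (\<lambda>j\<in>{1..N}. w j * z j)"

lemma torus_mult_measurable:
  assumes "\<And>j. j \<in> {1..N} \<Longrightarrow> w j \<in> sphere 0 1"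
  shows "torus_mult N w \<in> measurable (torus N) (torus N)"
  unfolding torus_mult_def torus_def
proof (rule measurable_restrict)
  fix j assume j: "j \<in> {1..N}"
  show "(\<lambda>z. w j * z j) \<in> measurable (Pi\<^sub>M {1..N} (\<lambda>_. circ)) circ"
    by (rule measurable_compose[OF measurable_component_singleton[OF j] sphere_mult_measurable[OF assms[OF j]]])
qed

text \<open>A product measure is determined by its rectangles, and on these each coordinate is
  rotated separately.\<close>

lemma distr_torus_mult:
  assumes w: "\<And>j. j \<in> {1..N} \<Longrightarrow> w j \<in> sphere 0 1"
  shows "distr (torus N) (torus N) (torus_mult N w) = torus N"
proof -
  have m: "torus_mult N w \<in> measurable (torus N) (torus N)" by (rule torus_mult_measurable) (rule w)
  have "distr (torus N) (torus N) (torus_mult N w) = Pi\<^sub>M {1..N} (\<lambda>_. circ)"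
  proof (rule circ_prod.PiM_eqI)
    fix A :: "nat \<Rightarrow> complex set" assume A: "\<And>i. i \<in> {1..N} \<Longrightarrow> A i \<in> sets circ"
    have s: "Pi\<^sub>E {1..N} A \<in> sets (torus N)" unfolding torus_def using A by auto
    have "torus_mult N w -` (Pi\<^sub>E {1..N} A) \<inter> space (torus N)
       = Pi\<^sub>E {1..N} (\<lambda>j. (\<lambda>z. w j * z) -` A j \<inter> space circ)"
      unfolding space_torus torus_mult_def by (auto simp: PiE_iff restrict_def extensional_def)
    moreover have "emeasure (distr (torus N) (torus N) (torus_mult N w)) (Pi\<^sub>E {1..N} A)
      = emeasure (torus N) (torus_mult N w -` (Pi\<^sub>E {1..N} A) \<inter> space (torus N))"
      by (rule emeasure_distr[OF m s])
    ultimately have "emeasure (distr (torus N) (torus N) (torus_mult N w)) (Pi\<^sub>E {1..N} A)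
      = emeasure (torus N) (Pi\<^sub>E {1..N} (\<lambda>j. (\<lambda>z. w j * z) -` A j \<inter> space circ))"
      by (simp only:)
    also have "\<dots> = (\<Prod>j\<in>{1..N}. emeasure circ ((\<lambda>z. w j * z) -` A j \<inter> space circ))"
      unfolding torus_def using A w
      by (intro circ_prod.emeasure_PiM) (auto intro!: measurable_sets[OF sphere_mult_measurable] simp del: space_circ)
    also have "\<dots> = (\<Prod>j\<in>{1..N}. emeasure circ (A j))"
    proof (rule prod.cong)
      fix j assume j: "j \<in> {1..N}"
      have "emeasure circ ((\<lambda>z. w j * z) -` A j \<inter> space circ) = emeasure (distr circ circ (\<lambda>z. w j * z)) (A j)"
        by (rule emeasure_distr[symmetric]) (use A[OF j] sphere_mult_measurable[OF w[OF j]] in auto)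
      then show "emeasure circ ((\<lambda>z. w j * z) -` A j \<inter> space circ) = emeasure circ (A j)"
        by (simp add: distr_circ_rotate[OF w[OF j]])
    qed simp
    finally show "emeasure (distr (torus N) (torus N) (torus_mult N w)) (Pi\<^sub>E {1..N} A)
      = (\<Prod>i\<in>{1..N}. emeasure circ (A i))" .
  qed (auto simp: torus_def)
  then show ?thesis by (simp add: torus_def)
qed

lemma nn_integral_torus_mult:
  assumes w: "\<And>j. j \<in> {1..N} \<Longrightarrow> w j \<in> sphere 0 1" and f: "f \<in> borel_measurable (torus N)"
  shows "(\<integral>\<^sup>+z. f (torus_mult N w z) \<partial>torus N) = (\<integral>\<^sup>+z. f z \<partial>torus N)"
proof -
  have m: "torus_mult N w \<in> measurable (torus N) (torus N)" by (rule torus_mult_measurable) (rule w)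
  have "distr (torus N) (torus N) (torus_mult N w) = torus N" by (rule distr_torus_mult) (rule w)
  then show ?thesis using nn_integral_distr[OF m, of f] f by simp
qed

section \<open>Multipliers on lacunary frequencies\<close>

lemma strongly_measurable_iff_simple:
  "strongly_measurable N f \<longleftrightarrow>
     (\<exists>s. (\<forall>i. simple_function N (s i)) \<and> (\<forall>\<omega>\<in>space N. (\<lambda>i. s i \<omega>) \<longlonglongrightarrow> f \<omega>))"
  by (auto simp: strongly_measurable_def simple_function_iff_borel_measurable)

lemma strongly_measurableE:
  assumes "strongly_measurable N f"
  obtains s where "\<And>i. simple_function N (s i)" "\<And>\<omega>. \<omega> \<in> space N \<Longrightarrow> (\<lambda>i. s i \<omega>) \<longlonglongrightarrow> f \<omega>"
  using assms unfolding strongly_measurable_iff_simple by blast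

lemma strongly_measurable_simple: "simple_function N f \<Longrightarrow> strongly_measurable N f"
  unfolding strongly_measurable_iff_simple by (intro exI[of _ "\<lambda>_. f"]) simp

lemma strongly_measurable_borel:
  fixes f :: "'a \<Rightarrow> 'b::{banach, second_countable_topology}"
  assumes "f \<in> borel_measurable N" shows "strongly_measurable N f"
  using borel_measurable_implies_sequence_metric[OF assms] unfolding strongly_measurable_iff_simple by blast

lemma strongly_measurable_compose:
  assumes f: "strongly_measurable N f" and g: "continuous_on UNIV g"
  shows "strongly_measurable N (\<lambda>\<omega>. g (f \<omega>))"
proof -
  obtain s where s: "\<And>i. simple_function N (s i)" "\<And>\<omega>. \<omega> \<in> space N \<Longrightarrow> (\<lambda>i. s i \<omega>) \<longlonglongrightarrow> f \<omega>"
    by (rule strongly_measurableE[OF f]) (rule that)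
  have "(\<lambda>i. g (s i \<omega>)) \<longlonglongrightarrow> g (f \<omega>)" if "\<omega> \<in> space N" for \<omega>
    using continuous_on_tendsto_compose[OF g s(2)[OF that]] by simp
  moreover have "simple_function N (\<lambda>\<omega>. g (s i \<omega>))" for i
    by (rule simple_function_compose1[OF s(1)])
  ultimately show ?thesis unfolding strongly_measurable_iff_simple
    by (intro exI[of _ "\<lambda>i \<omega>. g (s i \<omega>)"] conjI allI ballI)
qed

text \<open>In a nonseparable space the sum of two Borel measurable functions can fail to be
  measurable; simple approximations, however, can be added termwise.\<close>

lemma strongly_measurable_add:
  assumes f: "strongly_measurable N f" and g: "strongly_measurable N g"
  shows "strongly_measurable N (\<lambda>\<omega>. f \<omega> + g \<omega>)"
proof -
  obtain s where s: "\<And>i. simple_function N (s i)" "\<And>\<omega>. \<omega> \<in> space N \<Longrightarrow> (\<lambda>i. s i \<omega>) \<longlonglongrightarrow> f \<omega>"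
    by (rule strongly_measurableE[OF f]) (rule that)
  obtain t where t: "\<And>i. simple_function N (t i)" "\<And>\<omega>. \<omega> \<in> space N \<Longrightarrow> (\<lambda>i. t i \<omega>) \<longlonglongrightarrow> g \<omega>"
    by (rule strongly_measurableE[OF g]) (rule that)
  have "simple_function N (\<lambda>\<omega>. s i \<omega> + t i \<omega>)" for i
    by (rule simple_function_add[OF s(1) t(1)])
  moreover have "(\<lambda>i. s i \<omega> + t i \<omega>) \<longlonglongrightarrow> f \<omega> + g \<omega>" if "\<omega> \<in> space N" for \<omega>
    by (rule tendsto_add[OF s(2)[OF that] t(2)[OF that]])
  ultimately show ?thesis unfolding strongly_measurable_iff_simple
    by (intro exI[of _ "\<lambda>i \<omega>. s i \<omega> + t i \<omega>"] conjI allI ballI)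
qed

lemma strongly_measurable_sum:
  assumes "\<And>i. i \<in> I \<Longrightarrow> strongly_measurable N (f i)"
  shows "strongly_measurable N (\<lambda>\<omega>. \<Sum>i\<in>I. f i \<omega>)"
proof (cases "finite I")
  case True
  then show ?thesis using assms
  proof (induction I)
    case empty
    show ?case using strongly_measurable_simple[OF simple_function_const] by simp
  next
    case (insert i I)
    have "strongly_measurable N (\<lambda>\<omega>. f i \<omega> + (\<Sum>i\<in>I. f i \<omega>))"
      by (rule strongly_measurable_add[OF insert.prems insert.IH[OF insert.prems]]) auto
    with insert.hyps show ?case by simp
  qed
next
  case False
  then show ?thesis using strongly_measurable_simple[OF simple_function_const] by simp
qed

lemma strongly_measurable_imp_borel:
  assumes "strongly_measurable N f" shows "f \<in> borel_measurable N"
proof -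
  obtain s where s: "\<And>i. simple_function N (s i)" "\<And>\<omega>. \<omega> \<in> space N \<Longrightarrow> (\<lambda>i. s i \<omega>) \<longlonglongrightarrow> f \<omega>"
    by (rule strongly_measurableE[OF assms]) (rule that)
  show ?thesis
    by (rule borel_measurable_LIMSEQ_metric[OF borel_measurable_simple_function[OF s(1)] s(2)])
qed

lemma strongly_measurable_norm:
  assumes "strongly_measurable N f" shows "(\<lambda>\<omega>. norm (f \<omega>)) \<in> borel_measurable N"
  by (rule strongly_measurable_imp_borel[OF strongly_measurable_compose[OF assms, of norm]])
    (intro continuous_intros)

definition norm_pow :: "'w measure \<Rightarrow> real \<Rightarrow> ('w \<Rightarrow> 'x::banach) \<Rightarrow> ennreal" where
  "norm_pow M p f = (\<integral>\<^sup>+\<omega>. ennreal (norm (f \<omega>) powr p) \<partial>M)"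

lemma norm_pow_measurable:
  "strongly_measurable M f \<Longrightarrow> (\<lambda>\<omega>. ennreal (norm (f \<omega>) powr p)) \<in> borel_measurable M"
proof -
  assume "strongly_measurable M f"
  note [measurable] = strongly_measurable_norm[OF this]
  show ?thesis by measurable
qed

section \<open>Complex scalars on a real Banach space\<close>

locale complex_scaling =
  fixes cs :: "complex \<Rightarrow> 'x::banach \<Rightarrow> 'x"
  assumes scaling: "complex_banach_scaling cs"
begin

lemma cs_of_real: "cs (complex_of_real r) x = r *\<^sub>R x"
  and cs_add_left: "cs (a + b) x = cs a x + cs b x"
  and cs_add_right: "cs a (x + y) = cs a x + cs a y"
  and cs_mult: "cs (a * b) x = cs a (cs b x)"
  and norm_cs: "norm (cs a x) = cmod a * norm x"
  using scaling unfolding complex_banach_scaling_def by blast+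

lemma bounded_linear_cs_left: "bounded_linear (\<lambda>a. cs a x)"
proof (rule bounded_linear_intro[where K = "norm x"])
  fix r a show "cs (r *\<^sub>R a) x = r *\<^sub>R cs a x"
    by (simp add: scaleR_conv_of_real cs_mult cs_of_real)
qed (auto simp: cs_add_left norm_cs)

lemma bounded_linear_cs_right: "bounded_linear (cs a)"
proof (rule bounded_linear_intro[where K = "cmod a"])
  fix r x
  have "cs a (cs (complex_of_real r) x) = cs (complex_of_real r) (cs a x)"
    by (simp add: cs_mult[symmetric] mult.commute)
  then show "cs a (r *\<^sub>R x) = r *\<^sub>R cs a x" by (simp add: cs_of_real)
qed (auto simp: cs_add_right norm_cs mult.commute)

lemma cs_sum_left: "cs (\<Sum>i\<in>I. a i) x = (\<Sum>i\<in>I. cs (a i) x)"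
  using linear_sum[OF bounded_linear.linear[OF bounded_linear_cs_left]] by simp

lemma cs_sum_right: "cs a (\<Sum>i\<in>I. x i) = (\<Sum>i\<in>I. cs a (x i))"
  using linear_sum[OF bounded_linear.linear[OF bounded_linear_cs_right]] by simp

lemma cs_zero_left [simp]: "cs 0 x = 0"
  using linear_0[OF bounded_linear.linear[OF bounded_linear_cs_left]] .

lemma cs_zero_right [simp]: "cs a 0 = 0"
  using linear_0[OF bounded_linear.linear[OF bounded_linear_cs_right]] .

lemma cs_one [simp]: "cs 1 x = x"
  using cs_of_real[of 1 x] by simp

lemma cs_diff_right: "cs a (x - y) = cs a x - cs a y"
  using linear_diff[OF bounded_linear.linear[OF bounded_linear_cs_right]] .

lemma tendsto_cs_left: "(f \<longlongrightarrow> a) F \<Longrightarrow> ((\<lambda>t. cs (f t) x) \<longlongrightarrow> cs a x) F"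
  by (rule bounded_linear.tendsto[OF bounded_linear_cs_left])

lemma strongly_measurable_cs_left:
  "c \<in> borel_measurable N \<Longrightarrow> strongly_measurable N (\<lambda>\<omega>. cs (c \<omega>) x)"
  by (rule strongly_measurable_compose[OF strongly_measurable_borel
      linear_continuous_on[OF bounded_linear_cs_left]])

lemma strongly_measurable_cs_right:
  "strongly_measurable N f \<Longrightarrow> strongly_measurable N (\<lambda>\<omega>. cs a (f \<omega>))"
  by (rule strongly_measurable_compose[OF _ linear_continuous_on[OF bounded_linear_cs_right]])

lemma norm_cs_sum_measurable:
  "(\<And>i. i \<in> I \<Longrightarrow> c i \<in> borel_measurable N) \<Longrightarrow> (\<lambda>\<omega>. norm (\<Sum>i\<in>I. cs (c i \<omega>) (x i))) \<in> borel_measurable N"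
  by (rule strongly_measurable_norm[OF strongly_measurable_sum[OF strongly_measurable_cs_left]])

end

text \<open>\<open>C\<close> is any constant admissible for the multiplier rather than its norm, so
  the case of an infinite norm does not arise here.\<close>

locale even_homogeneous_multiplier = complex_scaling cs
  for cs :: "complex \<Rightarrow> 'x::banach \<Rightarrow> 'x" +
  fixes p C :: real and m :: "real^'n::finite \<Rightarrow> complex"
  assumes p: "1 < p" and C: "0 \<le> C"
    and even: "\<And>\<xi>. m (- \<xi>) = m \<xi>"
    and homogeneous: "\<And>c \<xi>. c > 0 \<Longrightarrow> m (c *\<^sub>R \<xi>) = m \<xi>"
    and continuous: "continuous_on (UNIV - {0}) m"
    and bound: "\<And>L. (\<forall>k<length L. schwartz (fst (L ! k))) \<Longrightarrow>
          Lp_pow p (fourier_mult cs m L) \<le> ennreal (C powr p) * Lp_pow p (tensor_fun cs L)"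
begin

lemma m_measurable [measurable]: "m \<in> borel_measurable borel"
  using continuous by (intro borel_measurable_continuous_countable_exceptions[of "{0}"]) (auto simp: Compl_eq_Diff_UNIV)

lemma m_bounded: "\<exists>B. \<forall>\<xi>. cmod (m \<xi>) \<le> B"
proof -
  have "compact (m ` sphere 0 1)"
    by (intro compact_continuous_image continuous_on_subset[OF continuous]) auto
  then obtain B where B: "\<And>\<xi>. norm \<xi> = 1 \<Longrightarrow> cmod (m \<xi>) \<le> B"
    using compact_imp_bounded bounded_iff by (metis imageI mem_sphere_0)
  \<comment> \<open>The value at 0 is fixed by neither continuity nor homogeneity and enters the
    bound separately.\<close>
  have "cmod (m \<xi>) \<le> max B (cmod (m 0))" for \<xi>
  proof (cases "\<xi> = 0")
    case False
    then have "m \<xi> = m ((1 / norm \<xi>) *\<^sub>R \<xi>)" by (intro homogeneous[symmetric]) auto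
    then show ?thesis using B[of "(1 / norm \<xi>) *\<^sub>R \<xi>"] False by simp
  qed auto
  then show ?thesis by blast
qed

definition lac_freq :: "nat \<Rightarrow> (nat \<Rightarrow> real^'n) \<Rightarrow> (nat \<Rightarrow> int) \<Rightarrow> real \<Rightarrow> real^'n" where
  "lac_freq N \<xi> k s = s *\<^sub>R \<xi> 0 + (\<Sum>j\<in>{1..N}. (s ^ (j + 1) * of_int (k j)) *\<^sub>R \<xi> j)"

text \<open>The term with the highest power of \<open>s\<close> dominates and fixes the direction of the frequency;
  its sign does not matter since \<open>m\<close> is even.\<close>

lemma m_lac_freq_tendsto:
  assumes \<xi>: "\<And>j. \<xi> j \<noteq> 0" and n: "n \<le> N" and top: "n \<ge> 1 \<Longrightarrow> k n \<noteq> 0"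
    and above: "\<And>j. j > n \<Longrightarrow> k j = 0"
  shows "(\<lambda>l. m (lac_freq N \<xi> k (real l) + u)) \<longlonglongrightarrow> m (\<xi> n)"
proof -
  define y where "y l = inverse (real l)" for l
  have y: "y \<longlonglongrightarrow> 0" unfolding y_def by (rule lim_inverse_n)
  \<comment> \<open>The limit direction. At level 0 all \<open>k j\<close> with
    \<open>j \<ge> 1\<close> vanish and only the extra frequency is left.\<close>
  define v where "v = (if n = 0 then \<xi> 0 else of_int (k n) *\<^sub>R \<xi> n)"
  have v: "v \<noteq> 0" using \<xi> top by (auto simp: v_def)
  have mv: "m v = m (\<xi> n)"
  proof (cases "n = 0")
    case False
    then consider "k n > 0" | "k n < 0" using top by force
    then show ?thesis
    proof cases
      case 1 then show ?thesis using False by (simp add: v_def homogeneous)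
    next
      case 2
      have "m (- v) = m ((- of_int (k n)) *\<^sub>R \<xi> n)" using False by (simp add: v_def)
      also have "\<dots> = m (\<xi> n)" using 2 by (intro homogeneous) simp
      finally show ?thesis by (simp add: even)
    qed
  qed (simp add: v_def)
  \<comment> \<open>The frequency plus \<open>u\<close>, multiplied by \<open>y l ^ (n + 1)\<close>,
    the inverse of the leading power of the scale; homogeneity makes this factor invisible to
    \<open>m\<close>. Terms with \<open>j < n\<close> keep a positive power of \<open>y l\<close>
    and vanish in the limit.\<close>
  let ?F = "\<lambda>l. (y l) ^ n *\<^sub>R \<xi> 0 + (\<Sum>j\<in>{1..n}. ((y l) ^ (n - j) * of_int (k j)) *\<^sub>R \<xi> j) + (y l) ^ (n + 1) *\<^sub>R u"
  have "?F \<longlonglongrightarrow> 0 ^ n *\<^sub>R \<xi> 0 + (\<Sum>j\<in>{1..n}. (0 ^ (n - j) * of_int (k j)) *\<^sub>R \<xi> j) + 0 ^ (n + 1) *\<^sub>R u"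
    by (intro tendsto_intros y)
  also have "(\<Sum>j\<in>{1..n}. (0 ^ (n - j) * of_int (k j)) *\<^sub>R \<xi> j) = (\<Sum>j\<in>{1..n}. if j = n then of_int (k n) *\<^sub>R \<xi> n else 0)"
    by (intro sum.cong) auto
  also have "0 ^ n *\<^sub>R \<xi> 0 + \<dots> + 0 ^ (n + 1) *\<^sub>R u = v" by (auto simp: v_def)
  finally have F: "?F \<longlonglongrightarrow> v" .
  have "isCont m v" using continuous v by (simp add: continuous_on_eq_continuous_at open_delete)
  from isCont_tendsto_compose[OF this F] have "(\<lambda>l. m (?F l)) \<longlonglongrightarrow> m (\<xi> n)" by (simp add: mv)
  moreover have "\<forall>\<^sub>F l in sequentially. m (?F l) = m (lac_freq N \<xi> k (real l) + u)"
    using eventually_gt_at_top[of 0]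
  proof eventually_elim
    case (elim l)
    have yl: "y l > 0" "y l * real l = 1" using elim by (auto simp: y_def)
    have pw: "y l ^ (n + 1) * real l ^ (j + 1) = y l ^ (n - j)" if "j \<le> n" for j
    proof -
      have "y l ^ (n + 1) * real l ^ (j + 1) = y l ^ (n - j) * (y l * real l) ^ (j + 1)"
        unfolding power_mult_distrib mult.assoc[symmetric] power_add[symmetric] using that by simp
      then show ?thesis by (simp add: yl)
    qed
    have "lac_freq N \<xi> k (real l) = real l *\<^sub>R \<xi> 0 + (\<Sum>j\<in>{1..n}. (real l ^ (j + 1) * of_int (k j)) *\<^sub>R \<xi> j)"
      unfolding lac_freq_def using n above
      by (intro arg_cong2[where f = "(+)"] sum.mono_neutral_right refl) auto
    then have "y l ^ (n + 1) *\<^sub>R (lac_freq N \<xi> k (real l) + u)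
      = (y l ^ (n + 1) * real l ^ (0 + 1)) *\<^sub>R \<xi> 0
        + (\<Sum>j\<in>{1..n}. ((y l ^ (n + 1) * real l ^ (j + 1)) * of_int (k j)) *\<^sub>R \<xi> j) + y l ^ (n + 1) *\<^sub>R u"
      by (simp add: scaleR_add_right scaleR_sum_right mult.assoc)
    also have "\<dots> = ?F l"
      using pw[of 0] by (intro arg_cong2[where f = "(+)"] sum.cong refl) (auto simp only: pw atLeastAtMost_iff diff_zero)
    finally have "?F l = y l ^ (n + 1) *\<^sub>R (lac_freq N \<xi> k (real l) + u)" ..
    then show ?case using yl by (simp only: homogeneous zero_less_power)
  qed
  ultimately show ?thesis by (rule Lim_transform_eventually)
qed

end

definition monomial :: "nat \<Rightarrow> (nat \<Rightarrow> int) \<Rightarrow> (nat \<Rightarrow> complex) \<Rightarrow> complex" where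
  "monomial N k z = (\<Prod>j\<in>{1..N}. z j powi k j)"

lemma monomial_measurable [measurable]: "monomial N k \<in> borel_measurable (torus N)"
  unfolding monomial_def[abs_def] by (rule torus_monomial_measurable)

lemma monomial_torus_mult: "monomial N k (torus_mult N w z) = monomial N k w * monomial N k z"
  by (simp add: monomial_def torus_mult_def power_int_mult_distrib prod.distrib)

context even_homogeneous_multiplier
begin

lemma cs_cs: "cs a (cs b y) = cs (b * a) y"
  by (simp add: cs_mult[symmetric] mult.commute)

text \<open>The scalars \<open>c\<close> are kept apart from the vectors \<open>x\<close>: they
  carry the dependence on the point of the Euclidean space and on the scale, while \<open>x\<close>
  stays fixed in all limits.\<close>

definition torus_pow :: "nat \<Rightarrow> 'i set \<Rightarrow> ('i \<Rightarrow> nat \<Rightarrow> int) \<Rightarrow> ('i \<Rightarrow> 'x) \<Rightarrow> ('i \<Rightarrow> complex) \<Rightarrow> ennreal" where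
  "torus_pow N I k x c = (\<integral>\<^sup>+z. ennreal (norm (\<Sum>i\<in>I. cs (monomial N (k i) z * c i) (x i)) powr p) \<partial>torus N)"

lemma exp_lac_freq:
  "iexp (lac_freq N \<xi> k s \<bullet> t) = iexp (s * (\<xi> 0 \<bullet> t))
     * monomial N k (\<lambda>j. iexp (s ^ (j + 1) * (\<xi> j \<bullet> t)))"
proof -
  have "\<i> * complex_of_real (lac_freq N \<xi> k s \<bullet> t) = \<i> * complex_of_real (s * (\<xi> 0 \<bullet> t))
     + (\<Sum>j\<in>{1..N}. of_int (k j) * (\<i> * complex_of_real (s ^ (j + 1) * (\<xi> j \<bullet> t))))"
    by (simp add: lac_freq_def inner_add_left inner_sum_left algebra_simps sum_distrib_left)
  then show ?thesis
    by (simp only: exp_add exp_sum monomial_def exp_power_int finite_atLeastAtMost)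
qed

text \<open>For fixed \<open>t\<close> the phases of the exponentials are absorbed by a rotation of the torus.\<close>

lemma torus_pow_swap:
  fixes I :: "'i set" and k :: "'i \<Rightarrow> nat \<Rightarrow> int" and x :: "'i \<Rightarrow> 'x"
    and N :: nat and \<xi> :: "nat \<Rightarrow> real^'n" and s :: real
  assumes fin: "finite I" and c [measurable]: "\<And>i. i \<in> I \<Longrightarrow> c i \<in> borel_measurable borel"
  defines "G \<equiv> \<lambda>z t. ennreal (norm (\<Sum>i\<in>I. cs (monomial N (k i) z *
      (iexp (lac_freq N \<xi> (k i) s \<bullet> t) * c i t)) (x i)) powr p)"
  shows "(\<integral>\<^sup>+z. (\<integral>\<^sup>+t. G z t \<partial>lborel) \<partial>torus N) = (\<integral>\<^sup>+t. torus_pow N I k x (\<lambda>i. c i t) \<partial>lborel)"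
    and "(\<lambda>z. \<integral>\<^sup>+t. G z t \<partial>lborel) \<in> borel_measurable (torus N)"
    and "(\<lambda>t. torus_pow N I k x (\<lambda>i. c i t)) \<in> borel_measurable borel"
proof -
  interpret pair_sigma_finite "torus N" "lborel :: (real^'n) measure" ..
  have "(\<lambda>q. norm (\<Sum>i\<in>I. cs (monomial N (k i) (fst q) *
      (iexp (lac_freq N \<xi> (k i) s \<bullet> snd q) * c i (snd q))) (x i)))
      \<in> borel_measurable (torus N \<Otimes>\<^sub>M lborel)"
    by (rule norm_cs_sum_measurable) measurable
  then have G [measurable]: "case_prod G \<in> borel_measurable (torus N \<Otimes>\<^sub>M lborel)"
    unfolding G_def case_prod_beta by measurable
  have m: "(\<lambda>z. norm (\<Sum>i\<in>I. cs (monomial N (k i) z * c i t) (x i))) \<in> borel_measurable (torus N)" for t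
    by (rule norm_cs_sum_measurable) measurable
  have "(\<integral>\<^sup>+z. G z t \<partial>torus N) = torus_pow N I k x (\<lambda>i. c i t)" for t
  proof -
    \<comment> \<open>The phase of the extra frequency is common to all \<open>i\<close> and
      unimodular, so it does not affect the norm.\<close>
    define u where "u = iexp (s * (\<xi> 0 \<bullet> t))"
    define w where "w = (\<lambda>j. iexp (s ^ (j + 1) * (\<xi> j \<bullet> t)))"
    have e: "iexp (lac_freq N \<xi> (k i) s \<bullet> t) = u * monomial N (k i) w" for i
      unfolding u_def w_def by (rule exp_lac_freq)
    have "monomial N (k i) z * (u * monomial N (k i) w * c i t)
        = u * (monomial N (k i) (torus_mult N w z) * c i t)" for i z
      by (simp add: monomial_torus_mult)
    then have "(\<Sum>i\<in>I. cs (monomial N (k i) z * (iexp (lac_freq N \<xi> (k i) s \<bullet> t) * c i t)) (x i))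
       = cs u (\<Sum>i\<in>I. cs (monomial N (k i) (torus_mult N w z) * c i t) (x i))" for z
      by (simp only: e cs_mult[of u] cs_sum_right)
    moreover have "cmod u = 1" by (simp add: u_def)
    ultimately have "G z t = ennreal (norm (\<Sum>i\<in>I. cs (monomial N (k i) (torus_mult N w z) * c i t) (x i)) powr p)" for z
      by (simp add: G_def norm_cs)
    then have "(\<integral>\<^sup>+z. G z t \<partial>torus N) = (\<integral>\<^sup>+z. ennreal (norm (\<Sum>i\<in>I. cs (monomial N (k i) (torus_mult N w z) * c i t) (x i)) powr p) \<partial>torus N)"
      by simp
    also have "\<dots> = torus_pow N I k x (\<lambda>i. c i t)"
      unfolding torus_pow_def using m
      by (intro nn_integral_torus_mult[where f = "\<lambda>z. ennreal (norm (\<Sum>i\<in>I. cs (monomial N (k i) z * c i t) (x i)) powr p)"])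
         (auto simp: w_def)
    finally show ?thesis .
  qed
  then have tp: "torus_pow N I k x (\<lambda>i. c i t) = (\<integral>\<^sup>+z. G z t \<partial>torus N)" for t ..
  show "(\<integral>\<^sup>+z. (\<integral>\<^sup>+t. G z t \<partial>lborel) \<partial>torus N) = (\<integral>\<^sup>+t. torus_pow N I k x (\<lambda>i. c i t) \<partial>lborel)"
    unfolding tp by (rule Fubini'[OF G, symmetric])
  have "(\<lambda>(t, z). G z t) \<in> borel_measurable (lborel \<Otimes>\<^sub>M torus N)"
    using measurable_pair_swap[OF G] by simp
  then have "(\<lambda>t. \<integral>\<^sup>+z. G z t \<partial>torus N) \<in> borel_measurable lborel"
    by (rule torus.borel_measurable_nn_integral)
  then show "(\<lambda>t. torus_pow N I k x (\<lambda>i. c i t)) \<in> borel_measurable borel"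
    unfolding tp by simp
  show "(\<lambda>z. \<integral>\<^sup>+t. G z t \<partial>lborel) \<in> borel_measurable (torus N)" by measurable
qed

lemma mod_gauss_split: "mod_gauss l t = iexp (l \<bullet> t) * gauss t"
  unfolding mod_gauss_def diff_conv_add_uminus exp_add by (simp add: power2_norm_eq_inner exp_of_real[symmetric])

text \<open>For fixed \<open>z\<close> the monomials are absorbed into the vectors, so the
  hypothesis on finite tensors applies. Integrating over \<open>z\<close> and exchanging the
  integrals then removes the exponentials from both sides.\<close>

lemma torus_pow_le:
  assumes fin: "finite I"
  shows "(\<integral>\<^sup>+t. torus_pow N I k x (\<lambda>i. local_mult m (lac_freq N \<xi> (k i) s) t) \<partial>lborel)
     \<le> ennreal (C powr p) * (\<integral>\<^sup>+t. torus_pow N I k x (\<lambda>i. gauss t) \<partial>(lborel :: (real^'n) measure))"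
proof -
  obtain il where il: "set il = I" "distinct il" using finite_distinct_list[OF fin] by blast
  define L where "L z = map (\<lambda>i. (mod_gauss (lac_freq N \<xi> (k i) s), cs (monomial N (k i) z) (x i))) il" for z
  have sum_L: "(\<Sum>j<length (L z). f (fst (L z ! j)) (snd (L z ! j)))
      = (\<Sum>i\<in>I. f (mod_gauss (lac_freq N \<xi> (k i) s)) (cs (monomial N (k i) z) (x i)))"
    for f :: "(real^'n \<Rightarrow> complex) \<Rightarrow> 'x \<Rightarrow> 'x" and z
  proof -
    have "(\<Sum>j<length (L z). f (fst (L z ! j)) (snd (L z ! j))) = (\<Sum>q\<leftarrow>L z. f (fst q) (snd q))"
      by (simp add: sum_list_sum_nth atLeast0LessThan)
    also have "\<dots> = (\<Sum>i\<in>I. f (mod_gauss (lac_freq N \<xi> (k i) s)) (cs (monomial N (k i) z) (x i)))"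
      using il by (simp add: L_def sum_list_distinct_conv_sum_set o_def)
    finally show ?thesis .
  qed
  have tens: "tensor_fun cs (L z) t = (\<Sum>i\<in>I. cs (monomial N (k i) z *
      (iexp (lac_freq N \<xi> (k i) s \<bullet> t) * gauss t)) (x i))" for z t
    unfolding tensor_fun_def sum_L[of "\<lambda>g y. cs (g t) y"]
    by (simp only: mod_gauss_split cs_cs)
  have four: "fourier_mult cs m (L z) t = (\<Sum>i\<in>I. cs (monomial N (k i) z *
      (iexp (lac_freq N \<xi> (k i) s \<bullet> t) * local_mult m (lac_freq N \<xi> (k i) s) t)) (x i))" for z t
    unfolding fourier_mult_def sum_L[of "\<lambda>g y. cs (inv_fourier (\<lambda>\<xi>. m \<xi> * fourier g \<xi>) t) y"]
    by (simp only: inv_fourier_mod_gauss[OF m_measurable] cs_cs)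
  have "\<forall>j<length (L z). schwartz (fst (L z ! j))" for z
    by (simp add: L_def schwartz_mod_gauss)
  then have le: "Lp_pow p (fourier_mult cs m (L z)) \<le> ennreal (C powr p) * Lp_pow p (tensor_fun cs (L z))" for z
    by (rule bound)
  note swapF = torus_pow_swap(1,2)[OF fin, where c = "\<lambda>i. local_mult m (lac_freq N \<xi> (k i) s)"
      and k = k and x = x and s = s and \<xi> = \<xi> and N = N, OF local_mult_measurable[OF m_measurable], folded four]
  have gm: "(\<lambda>t::real^'n. gauss t) \<in> borel_measurable borel"
    by measurable
  note swapT = torus_pow_swap(1,2)[OF fin, where c = "\<lambda>i t. gauss t"
      and k = k and x = x and s = s and \<xi> = \<xi> and N = N, OF gm, folded tens]
  have "(\<integral>\<^sup>+t. torus_pow N I k x (\<lambda>i. local_mult m (lac_freq N \<xi> (k i) s) t) \<partial>lborel)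
      = (\<integral>\<^sup>+z. Lp_pow p (fourier_mult cs m (L z)) \<partial>torus N)"
    unfolding Lp_pow_def by (rule swapF(1)[symmetric])
  also have "\<dots> \<le> (\<integral>\<^sup>+z. ennreal (C powr p) * Lp_pow p (tensor_fun cs (L z)) \<partial>torus N)"
    by (intro nn_integral_mono le)
  also have "\<dots> = ennreal (C powr p) * (\<integral>\<^sup>+z. Lp_pow p (tensor_fun cs (L z)) \<partial>torus N)"
    unfolding Lp_pow_def by (rule nn_integral_cmult[OF swapT(2)])
  also have "(\<integral>\<^sup>+z. Lp_pow p (tensor_fun cs (L z)) \<partial>torus N)
     = (\<integral>\<^sup>+t. torus_pow N I k x (\<lambda>i. gauss t) \<partial>(lborel :: (real^'n) measure))"
    unfolding Lp_pow_def by (rule swapT(1))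
  finally show ?thesis .
qed

lemma torus_pow_scale:
  assumes "r \<ge> 0"
  shows "torus_pow N I k x (\<lambda>i. a i * complex_of_real r) = ennreal (r powr p) * torus_pow N I k x a"
proof -
  have m: "(\<lambda>z. norm (\<Sum>i\<in>I. cs (monomial N (k i) z * a i) (x i))) \<in> borel_measurable (torus N)"
    by (rule norm_cs_sum_measurable) measurable
  have "(\<Sum>i\<in>I. cs (monomial N (k i) z * (a i * complex_of_real r)) (x i))
      = cs (complex_of_real r) (\<Sum>i\<in>I. cs (monomial N (k i) z * a i) (x i))" for z
    by (simp only: cs_sum_right cs_cs mult.assoc)
  then have "ennreal (norm (\<Sum>i\<in>I. cs (monomial N (k i) z * (a i * complex_of_real r)) (x i)) powr p)
     = ennreal (r powr p) * ennreal (norm (\<Sum>i\<in>I. cs (monomial N (k i) z * a i) (x i)) powr p)" for z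
    using assms by (simp add: norm_cs powr_mult ennreal_mult)
  then show ?thesis
    unfolding torus_pow_def using m by (simp add: nn_integral_cmult)
qed

lemma torus_pow_liminf:
  assumes "\<And>i. i \<in> I \<Longrightarrow> (\<lambda>l. c l i) \<longlonglongrightarrow> a i"
  shows "torus_pow N I k x a \<le> liminf (\<lambda>l. torus_pow N I k x (c l))"
proof -
  have m: "(\<lambda>z. norm (\<Sum>i\<in>I. cs (monomial N (k i) z * a i) (x i))) \<in> borel_measurable (torus N)" for a
    by (rule norm_cs_sum_measurable) measurable
  have "torus_pow N I k x a = (\<integral>\<^sup>+z. liminf (\<lambda>l. ennreal (norm (\<Sum>i\<in>I. cs (monomial N (k i) z * c l i) (x i)) powr p)) \<partial>torus N)"
    unfolding torus_pow_def
  proof (rule nn_integral_cong)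
    fix z
    have "(\<lambda>l. ennreal (norm (\<Sum>i\<in>I. cs (monomial N (k i) z * c l i) (x i)) powr p))
       \<longlonglongrightarrow> ennreal (norm (\<Sum>i\<in>I. cs (monomial N (k i) z * a i) (x i)) powr p)"
      using p by (intro tendsto_ennrealI tendsto_powr' tendsto_norm tendsto_sum tendsto_cs_left tendsto_mult tendsto_const assms) auto
    then show "ennreal (norm (\<Sum>i\<in>I. cs (monomial N (k i) z * a i) (x i)) powr p)
       = liminf (\<lambda>l. ennreal (norm (\<Sum>i\<in>I. cs (monomial N (k i) z * c l i) (x i)) powr p))"
      by (intro lim_imp_Liminf[symmetric]) auto
  qed
  also have "\<dots> \<le> liminf (\<lambda>l. torus_pow N I k x (c l))"
    unfolding torus_pow_def by (intro nn_integral_liminf) (use m in measurable)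
  finally show ?thesis .
qed

text \<open>The right-hand side of \<open>torus_pow_le\<close> does not depend on the scale, so only
  the left-hand side has to pass to a limit. The Gaussian contributes the same factor
  \<open>K\<close> to both sides, which cancels because it is positive and finite.\<close>

proposition torus_multiplier_bound:
  assumes fin: "finite I" and \<xi>: "\<And>j. \<xi> j \<noteq> 0"
    and lev: "\<And>i. i \<in> I \<Longrightarrow> lev i \<le> N"
    and top: "\<And>i. i \<in> I \<Longrightarrow> lev i \<ge> 1 \<Longrightarrow> k i (lev i) \<noteq> 0"
    and above: "\<And>i j. i \<in> I \<Longrightarrow> j > lev i \<Longrightarrow> k i j = 0"
  shows "torus_pow N I k x (\<lambda>i. m (\<xi> (lev i))) \<le> ennreal (C powr p) * torus_pow N I k x (\<lambda>i. 1)"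
proof -
  obtain B where B: "\<And>\<xi>. cmod (m \<xi>) \<le> B" using m_bounded by blast
  define g where "g t = exp (- ((norm t)\<^sup>2 / 2))" for t :: "real^'n"
  define K where "K = (\<integral>\<^sup>+t. ennreal (g t powr p) \<partial>lborel)"
  have g [measurable]: "g \<in> borel_measurable borel" unfolding g_def by measurable
  have "integrable lborel g"
  proof -
    have "g t = (2 * pi) powr (real DIM(real^'n) / 2) * gauss_dens t" for t
      by (simp add: g_def gauss_dens_eq powr_minus field_simps)
    then have "g = (\<lambda>t. (2 * pi) powr (real DIM(real^'n) / 2) * gauss_dens t)" by blast
    then show ?thesis using integrable_gauss_dens by (auto intro: integrable_mult_right)
  qed
  have "K \<le> (\<integral>\<^sup>+t. ennreal (g t) \<partial>lborel)"
    unfolding K_def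
  proof (intro nn_integral_mono ennreal_leI)
    fix t
    have "g t powr p \<le> g t powr 1" using p by (intro powr_mono') (auto simp: g_def)
    then show "g t powr p \<le> g t" by (simp add: g_def)
  qed
  also have "\<dots> < \<top>"
    using \<open>integrable lborel g\<close> by (subst nn_integral_eq_integral) (auto simp: g_def)
  finally have Kfin: "K \<noteq> \<top>" by simp
  have K0: "K \<noteq> 0"
  proof
    assume "K = 0"
    then have "emeasure lborel {t \<in> space lborel. ennreal (g t powr p) \<noteq> 0} = 0"
      unfolding K_def by (subst (asm) nn_integral_0_iff) auto
    then show False by (simp add: g_def)
  qed
  let ?F = "\<lambda>l t. torus_pow N I k x (\<lambda>i. local_mult m (lac_freq N \<xi> (k i) (real l)) t)"
  have Fm: "?F l \<in> borel_measurable lborel" for l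
    using torus_pow_swap(3)[OF fin, where c = "\<lambda>i. local_mult m (lac_freq N \<xi> (k i) (real l))", OF local_mult_measurable[OF m_measurable]]
    by simp
  have "K * torus_pow N I k x (\<lambda>i. m (\<xi> (lev i))) = (\<integral>\<^sup>+t. torus_pow N I k x (\<lambda>i. m (\<xi> (lev i)) * complex_of_real (g t)) \<partial>lborel)"
    unfolding K_def by (subst torus_pow_scale) (auto simp: nn_integral_multc g_def)
  also have "\<dots> \<le> (\<integral>\<^sup>+t. liminf (\<lambda>l. ?F l t) \<partial>lborel)"
    unfolding g_def
    by (intro nn_integral_mono torus_pow_liminf local_mult_tendsto[OF m_measurable B] m_lac_freq_tendsto \<xi> lev top above)
  also have "\<dots> \<le> liminf (\<lambda>l. \<integral>\<^sup>+t. ?F l t \<partial>lborel)"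
    by (rule nn_integral_liminf[OF Fm])
  also have "\<dots> \<le> ennreal (C powr p) * (\<integral>\<^sup>+t. torus_pow N I k x (\<lambda>i. complex_of_real (g t)) \<partial>lborel)"
    unfolding g_def
    by (rule order_trans[OF Liminf_le_Limsup[OF sequentially_bot] Limsup_bounded[OF always_eventually]])
       (intro allI torus_pow_le fin)
  also have "(\<integral>\<^sup>+t. torus_pow N I k x (\<lambda>i. complex_of_real (g t)) \<partial>lborel)
     = (\<integral>\<^sup>+t. torus_pow N I k x (\<lambda>i. 1 * complex_of_real (g t)) \<partial>lborel)" by simp
  also have "\<dots> = K * torus_pow N I k x (\<lambda>i. 1)"
    unfolding K_def by (subst torus_pow_scale) (auto simp: nn_integral_multc g_def)
  finally show ?thesis
    using ennreal_mult_le_mult_iff[OF K0 Kfin] by (simp add: mult.left_commute)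
qed

end

section \<open>Products of functions on the circle\<close>

text \<open>A list of coefficients and exponents, so that centering can be done on the list by
  dropping the terms with exponent 0; exponents may repeat.\<close>

definition laurent_eval :: "(complex \<times> int) list \<Rightarrow> complex \<Rightarrow> complex" where
  "laurent_eval l z = (\<Sum>(a, e)\<leftarrow>l. a * z powi e)"

lemma laurent_eval_Nil [simp]: "laurent_eval [] z = 0"
  and laurent_eval_Cons [simp]: "laurent_eval ((a, e) # l) z = a * z powi e + laurent_eval l z"
  and laurent_eval_append [simp]: "laurent_eval (l @ l') z = laurent_eval l z + laurent_eval l' z"
  by (simp_all add: laurent_eval_def)

lemma laurent_eval_nth: "laurent_eval l z = (\<Sum>q<length l. fst (l ! q) * z powi snd (l ! q))"
  by (simp add: laurent_eval_def sum_list_sum_nth atLeast0LessThan case_prod_beta)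

lemma laurent_eval_mult:
  "\<exists>l''. \<forall>z. z \<noteq> 0 \<longrightarrow> laurent_eval l'' z = laurent_eval l z * laurent_eval l' z"
proof (induction l)
  case Nil
  then show ?case by (intro exI[of _ "[]"]) auto
next
  case (Cons c l)
  obtain a e where c: "c = (a, e)" by force
  from Cons obtain r where r: "\<And>z. z \<noteq> 0 \<Longrightarrow> laurent_eval r z = laurent_eval l z * laurent_eval l' z" by blast
  have s: "laurent_eval (map (\<lambda>(b, d). (a * b, e + d)) l') z = a * z powi e * laurent_eval l' z" if "z \<noteq> 0" for z
    by (induction l') (auto simp: power_int_add that algebra_simps)
  show ?case
    by (intro exI[of _ "map (\<lambda>(b, d). (a * b, e + d)) l' @ r"]) (auto simp: c r s distrib_right)
qed

lemma laurent_eval_measurable: "laurent_eval l \<in> borel_measurable circ"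
  unfolding laurent_eval_nth[abs_def]
  by (intro measurable_circ_continuous continuous_intros) auto

lemma laurent_eval_integrable: "integrable circ (laurent_eval l)"
proof (rule circ.integrable_const_bound[where B = "\<Sum>q<length l. cmod (fst (l ! q))"])
  show "AE z in circ. cmod (laurent_eval l z) \<le> (\<Sum>q<length l. cmod (fst (l ! q)))"
  proof (rule AE_I2)
    fix z assume "z \<in> space circ"
    then show "cmod (laurent_eval l z) \<le> (\<Sum>q<length l. cmod (fst (l ! q)))"
      unfolding laurent_eval_nth by (intro sum_norm_le) (auto simp: norm_mult norm_power_int)
  qed
qed (rule laurent_eval_measurable)

text \<open>Every nonzero power integrates to 0, so the mean is the sum of the coefficients at
  exponent 0.\<close>

lemma laurent_eval_centered:
  "laurent_eval (filter (\<lambda>(a, e). e \<noteq> 0) l) z = laurent_eval l z - (\<integral>z. laurent_eval l z \<partial>circ)"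
proof (induction l)
  case (Cons c l)
  obtain a e where c: "c = (a, e)" by force
  have i: "integrable circ (\<lambda>z. a * z powi e)"
    using laurent_eval_integrable[of "[(a, e)]"] by (simp cong: Bochner_Integration.integrable_cong)
  have "(\<integral>z. laurent_eval (c # l) z \<partial>circ) = (\<integral>z. a * z powi e \<partial>circ) + (\<integral>z. laurent_eval l z \<partial>circ)"
    using i laurent_eval_integrable by (simp add: c Bochner_Integration.integral_add)
  also have "(\<integral>z. a * z powi e \<partial>circ) = (if e = 0 then a else 0)"
    by (auto simp: integral_circ_power_int circ.prob_space[unfolded space_circ])
  finally show ?case using Cons by (auto simp: c)
qed simp

text \<open>On the circle the inverse is the conjugate, hence
  \<open>Re z = (z + inverse z) / 2\<close>, and Laurent polynomials are closed under sums and
  products.\<close>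

lemma real_polynomial_laurent:
  assumes "real_polynomial_function (q :: real \<Rightarrow> real)"
  shows "\<exists>l. \<forall>z\<in>sphere 0 1. complex_of_real (q (Re z)) = laurent_eval l z"
  using assms
proof (induction q rule: real_polynomial_function.induct)
  case (linear f)
  have "f y = y * f 1" for y
    using linear_scale[OF bounded_linear.linear[OF linear], of y 1] by simp
  moreover have "complex_of_real (Re z * c) = laurent_eval [(of_real c / 2, 1), (of_real c / 2, -1)] z"
    if "z \<in> sphere 0 1" for z c
  proof -
    have "inverse z = cnj z" using that complex_div_cnj[of 1 z] by (simp add: inverse_eq_divide)
    then have "laurent_eval [(of_real c / 2, 1), (of_real c / 2, -1)] z = of_real c / 2 * (z + cnj z)"
      by (simp add: power_int_minus distrib_left)
    then show ?thesis by (simp add: complex_add_cnj)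
  qed
  ultimately show ?case by metis
next
  case (const c)
  then show ?case by (intro exI[of _ "[(of_real c, 0)]"]) auto
next
  case (add f g)
  then obtain l l' where "\<forall>z\<in>sphere 0 1. complex_of_real (f (Re z)) = laurent_eval l z"
    "\<forall>z\<in>sphere 0 1. complex_of_real (g (Re z)) = laurent_eval l' z" by blast
  then show ?case by (intro exI[of _ "l @ l'"]) auto
next
  case (mult f g)
  then obtain l l' where l: "\<forall>z\<in>sphere 0 1. complex_of_real (f (Re z)) = laurent_eval l z"
    "\<forall>z\<in>sphere 0 1. complex_of_real (g (Re z)) = laurent_eval l' z" by blast
  obtain l'' where "\<forall>z. z \<noteq> 0 \<longrightarrow> laurent_eval l'' z = laurent_eval l z * laurent_eval l' z"
    using laurent_eval_mult[of l l'] by blast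
  moreover have "z \<noteq> 0" if "z \<in> sphere 0 1" for z :: complex using that by auto
  ultimately show ?case using l by (intro exI[of _ l'']) simp
qed

text \<open>Pointwise limits under one uniform bound, so that dominated convergence applies both to
  means over the circle and to integrals over the torus. The bound 2 leaves room for a difference of
  two ramps, of modulus at most 1, and an approximation error of at most 1.\<close>

definition poly_limit :: "(complex \<Rightarrow> real) \<Rightarrow> bool" where
  "poly_limit \<psi> \<longleftrightarrow> (\<exists>q. (\<forall>n. real_polynomial_function (q n)) \<and> (\<forall>n::nat. \<forall>y\<in>{-1..1}. \<bar>q n y\<bar> \<le> 2) \<and>
     (\<forall>z\<in>sphere 0 1. (\<lambda>n. q n (Re z)) \<longlonglongrightarrow> \<psi> z))"

text \<open>The ramp rises to the left of \<open>a\<close>, on an interval of length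
  \<open>1 / n\<close>, so the limit includes the end \<open>a\<close> and is attained at every
  point, not just almost everywhere.\<close>

lemma ramp_tendsto:
  "(\<lambda>n. max 0 (min 1 (real n * (v - a) + 1))) \<longlonglongrightarrow> (if a \<le> v then 1 else 0)"
proof (cases "a \<le> v")
  case True
  then have "max 0 (min 1 (real n * (v - a) + 1)) = 1" for n by simp
  with True show ?thesis by simp
next
  case False
  have "\<forall>\<^sub>F n in sequentially. max 0 (min 1 (real n * (v - a) + 1)) = 0"
  proof -
    obtain k where k: "real k > 1 / (a - v)" using reals_Archimedean2 by blast
    have "max 0 (min 1 (real n * (v - a) + 1)) = 0" if "n \<ge> k" for n
    proof -
      have "1 / (a - v) < real n" using k that by linarith
      then have "1 < real n * (a - v)" using False by (simp add: field_simps)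
      then show ?thesis by (simp add: algebra_simps)
    qed
    then show ?thesis unfolding eventually_sequentially by blast
  qed
  with False show ?thesis by (auto intro: tendsto_eventually)
qed

lemma poly_limit_indicator:
  assumes "a \<le> b"
  shows "poly_limit (\<lambda>z. indicator {a..<b} (circ_unif z))"
proof -
  define r where "r n c v = max 0 (min 1 (real n * (v - c) + 1))" for n and c v :: real
  define f where "f n y = r n a (arccos y / pi) - r n b (arccos y / pi)" for n y
  have "continuous_on {-1..1} (f n)" for n
    unfolding f_def r_def by (intro continuous_intros) auto
  then have "\<exists>g. real_polynomial_function g \<and> (\<forall>y\<in>{-1..1}. \<bar>f n y - g y\<bar> < 1 / real (Suc n))" for n
    by (metis Stone_Weierstrass_real_polynomial_function compact_Icc of_nat_0_less_iff zero_less_Suc zero_less_divide_1_iff)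
  then have "\<exists>q. \<forall>n. real_polynomial_function (q n) \<and> (\<forall>y\<in>{-1..1}. \<bar>f n y - q n y\<bar> < 1 / real (Suc n))"
    by (intro choice) blast
  then obtain q where q: "\<And>n. real_polynomial_function (q n)"
    and qf: "\<And>n y. y \<in> {-1..1} \<Longrightarrow> \<bar>f n y - q n y\<bar> < 1 / real (Suc n)" by blast
  have "\<bar>q n y\<bar> \<le> 2" if "y \<in> {-1..1}" for n y
  proof -
    have "\<bar>f n y\<bar> \<le> 1" by (auto simp: f_def r_def)
    moreover have "1 / real (Suc n) \<le> 1" by simp
    ultimately show ?thesis using qf[OF that, of n] by linarith
  qed
  moreover have "(\<lambda>n. q n (Re z)) \<longlonglongrightarrow> indicator {a..<b} (circ_unif z)" if z: "z \<in> sphere 0 1" for z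
  proof -
    have "(\<lambda>n. f n (Re z)) \<longlonglongrightarrow> (if a \<le> circ_unif z then 1 else 0) - (if b \<le> circ_unif z then 1 else 0)"
      unfolding f_def r_def circ_unif_def by (intro tendsto_diff ramp_tendsto)
    moreover have "(\<lambda>n. f n (Re z) - q n (Re z)) \<longlonglongrightarrow> 0"
    proof (rule Lim_null_comparison)
      show "\<forall>\<^sub>F n in sequentially. norm (f n (Re z) - q n (Re z)) \<le> 1 / real (Suc n)"
        using qf[OF Re_sphere[OF z]] by (intro always_eventually) (auto intro: less_imp_le)
      show "(\<lambda>n. 1 / real (Suc n)) \<longlonglongrightarrow> 0" using LIMSEQ_inverse_real_of_nat by (simp add: inverse_eq_divide)
    qed
    ultimately have "(\<lambda>n. f n (Re z) - (f n (Re z) - q n (Re z))) \<longlonglongrightarrow>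
        ((if a \<le> circ_unif z then 1 else 0) - (if b \<le> circ_unif z then 1 else 0)) - 0"
      by (rule tendsto_diff)
    then show ?thesis using assms by (auto simp: indicator_def split: if_splits)
  qed
  ultimately show ?thesis unfolding poly_limit_def using q by blast
qed

context complex_scaling
begin

lemma norm_cs_sum_dominated:
  fixes c :: "nat \<Rightarrow> 'i \<Rightarrow> 'w \<Rightarrow> complex"
  assumes M: "prob_space M" and p: "p > 0"
    and c: "\<And>n i. i \<in> I \<Longrightarrow> c n i \<in> borel_measurable M"
    and bd: "\<And>n i z. i \<in> I \<Longrightarrow> z \<in> space M \<Longrightarrow> cmod (c n i z) \<le> B i"
    and lim: "\<And>i z. i \<in> I \<Longrightarrow> z \<in> space M \<Longrightarrow> (\<lambda>n. c n i z) \<longlonglongrightarrow> a i z"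
  shows "(\<lambda>n. norm_pow M p (\<lambda>z. \<Sum>i\<in>I. cs (c n i z) (x i)))
     \<longlonglongrightarrow> norm_pow M p (\<lambda>z. \<Sum>i\<in>I. cs (a i z) (x i))"
  unfolding norm_pow_def
proof (rule nn_integral_dominated_convergence[where w = "\<lambda>_. ennreal ((\<Sum>i\<in>I. B i * norm (x i)) powr p)"])
  interpret prob_space M by fact
  have a: "a i \<in> borel_measurable M" if "i \<in> I" for i
    by (rule borel_measurable_LIMSEQ_metric[OF c[OF that] lim[OF that]])
  have mc: "(\<lambda>z. norm (\<Sum>i\<in>I. cs (c n i z) (x i))) \<in> borel_measurable M" for n
    by (rule norm_cs_sum_measurable[OF c])
  have ma: "(\<lambda>z. norm (\<Sum>i\<in>I. cs (a i z) (x i))) \<in> borel_measurable M"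
    by (rule norm_cs_sum_measurable[OF a])
  show "(\<lambda>z. ennreal (norm (\<Sum>i\<in>I. cs (c n i z) (x i)) powr p)) \<in> borel_measurable M" for n
    using mc by measurable
  show "(\<lambda>z. ennreal (norm (\<Sum>i\<in>I. cs (a i z) (x i)) powr p)) \<in> borel_measurable M"
    using ma by measurable
  show "(\<integral>\<^sup>+z. ennreal ((\<Sum>i\<in>I. B i * norm (x i)) powr p) \<partial>M) < \<infinity>"
    by (simp add: emeasure_space_1)
  show "AE z in M. ennreal (norm (\<Sum>i\<in>I. cs (c n i z) (x i)) powr p) \<le> ennreal ((\<Sum>i\<in>I. B i * norm (x i)) powr p)" for n
    using p by (intro AE_I2 ennreal_leI powr_mono2 sum_norm_le) (auto simp: norm_cs intro!: mult_right_mono bd)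
  show "AE z in M. (\<lambda>n. ennreal (norm (\<Sum>i\<in>I. cs (c n i z) (x i)) powr p))
     \<longlonglongrightarrow> ennreal (norm (\<Sum>i\<in>I. cs (a i z) (x i)) powr p)"
    using p by (intro AE_I2 tendsto_ennrealI tendsto_powr' tendsto_norm tendsto_sum tendsto_cs_left tendsto_const lim) auto
qed simp

end

context even_homogeneous_multiplier
begin

text \<open>For \<open>lev i \<ge> 1\<close>, expanding the product gives monomials whose last
  nonzero exponent sits at index \<open>lev i\<close>: the last factor has no term with exponent 0,
  and later coordinates do not occur. Earlier exponents are arbitrary.\<close>

lemma laurent_product_bound:
  fixes l :: "'i \<Rightarrow> nat \<Rightarrow> (complex \<times> int) list"
  assumes fin: "finite I" and \<xi>: "\<And>j. \<xi> j \<noteq> 0"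
    and lev: "\<And>i. i \<in> I \<Longrightarrow> lev i \<le> N"
    and top: "\<And>i a e. i \<in> I \<Longrightarrow> lev i \<ge> 1 \<Longrightarrow> (a, e) \<in> set (l i (lev i)) \<Longrightarrow> e \<noteq> 0"
  shows "norm_pow (torus N) p (\<lambda>z. \<Sum>i\<in>I. cs (m (\<xi> (lev i)) * (\<Prod>j\<in>{1..lev i}. laurent_eval (l i j) (z j))) (x i))
    \<le> ennreal (C powr p) *
      norm_pow (torus N) p (\<lambda>z. \<Sum>i\<in>I. cs (\<Prod>j\<in>{1..lev i}. laurent_eval (l i j) (z j)) (x i))"
proof -
  \<comment> \<open>A function \<open>g\<close> in \<open>S i\<close> picks one term from each
    factor; the pairs \<open>(i, g)\<close> index the monomials.\<close>
  define S where "S i = Pi\<^sub>E {1..lev i} (\<lambda>j. {..<length (l i j)})" for i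
  define a where "a i g = (\<Prod>j\<in>{1..lev i}. fst (l i j ! g j))" for i g
  define k where "k ig j = (if j \<in> {1..lev (fst ig)} then snd (l (fst ig) j ! snd ig j) else 0)" for ig and j :: nat
  have finS: "finite (S i)" for i unfolding S_def by (intro finite_PiE) auto
  have expand: "(\<Prod>j\<in>{1..lev i}. laurent_eval (l i j) (z j)) = (\<Sum>g\<in>S i. a i g * monomial N (k (i, g)) z)"
    if i: "i \<in> I" for i z
  proof -
    have "(\<Prod>j\<in>{1..lev i}. laurent_eval (l i j) (z j))
       = (\<Sum>g\<in>S i. \<Prod>j\<in>{1..lev i}. fst (l i j ! g j) * z j powi snd (l i j ! g j))"
      unfolding laurent_eval_nth S_def by (rule prod_sum_PiE) auto
    also have "\<dots> = (\<Sum>g\<in>S i. a i g * monomial N (k (i, g)) z)"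
    proof (rule sum.cong)
      fix g
      have "monomial N (k (i, g)) z = (\<Prod>j\<in>{1..lev i}. z j powi k (i, g) j)"
        unfolding monomial_def using lev[OF i]
        by (intro prod.mono_neutral_right) (auto simp: k_def)
      also have "\<dots> = (\<Prod>j\<in>{1..lev i}. z j powi snd (l i j ! g j))"
        by (intro prod.cong) (auto simp: k_def)
      finally show "(\<Prod>j\<in>{1..lev i}. fst (l i j ! g j) * z j powi snd (l i j ! g j)) = a i g * monomial N (k (i, g)) z"
        by (simp add: prod.distrib a_def)
    qed simp
    finally show ?thesis .
  qed
  have E: "(\<Sum>i\<in>I. cs (c (lev i) * (\<Prod>j\<in>{1..lev i}. laurent_eval (l i j) (z j))) (x i))
     = (\<Sum>ig\<in>Sigma I S. cs (monomial N (k ig) z * c (lev (fst ig))) (cs (a (fst ig) (snd ig)) (x (fst ig))))" for c z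
  proof -
    have "(\<Sum>i\<in>I. cs (c (lev i) * (\<Prod>j\<in>{1..lev i}. laurent_eval (l i j) (z j))) (x i))
       = (\<Sum>i\<in>I. \<Sum>g\<in>S i. cs (monomial N (k (i, g)) z * c (lev i)) (cs (a i g) (x i)))"
      by (intro sum.cong refl) (simp only: expand sum_distrib_left cs_sum_left cs_cs mult_ac)
    then show ?thesis using fin finS by (simp add: sum.Sigma case_prod_beta)
  qed
  have "torus_pow N (Sigma I S) k (\<lambda>ig. cs (a (fst ig) (snd ig)) (x (fst ig))) (\<lambda>ig. m (\<xi> (lev (fst ig))))
    \<le> ennreal (C powr p) * torus_pow N (Sigma I S) k (\<lambda>ig. cs (a (fst ig) (snd ig)) (x (fst ig))) (\<lambda>ig. 1)"
  proof (rule torus_multiplier_bound[where lev = "\<lambda>ig. lev (fst ig)", OF _ \<xi>])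
    fix ig assume ig: "ig \<in> Sigma I S" "lev (fst ig) \<ge> 1"
    then have "snd ig (lev (fst ig)) < length (l (fst ig) (lev (fst ig)))" by (auto simp: S_def PiE_iff)
    then have "l (fst ig) (lev (fst ig)) ! snd ig (lev (fst ig)) \<in> set (l (fst ig) (lev (fst ig)))" by simp
    then have "snd (l (fst ig) (lev (fst ig)) ! snd ig (lev (fst ig))) \<noteq> 0"
      using ig by (intro top[of "fst ig" "fst (l (fst ig) (lev (fst ig)) ! snd ig (lev (fst ig)))"]) auto
    then show "k ig (lev (fst ig)) \<noteq> 0" using ig by (simp add: k_def)
  qed (use fin finS lev in \<open>auto simp: k_def\<close>)
  then show ?thesis
    unfolding torus_pow_def norm_pow_def using E[of "\<lambda>n. m (\<xi> n)"] E[of "\<lambda>n. 1"] by simp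
qed

text \<open>Only the last factor is centered. The approximating polynomials are centered in the same
  way, and since their means converge as well, both sides pass to the limit.\<close>

proposition centered_product_bound:
  fixes \<psi> :: "'i \<Rightarrow> nat \<Rightarrow> complex \<Rightarrow> real"
  assumes fin: "finite I" and \<xi>: "\<And>j. \<xi> j \<noteq> 0"
    and lev: "\<And>i. i \<in> I \<Longrightarrow> lev i \<le> N"
    and \<psi>: "\<And>i j. i \<in> I \<Longrightarrow> j \<in> {1..lev i} \<Longrightarrow> poly_limit (\<psi> i j)"
  defines "\<phi> \<equiv> \<lambda>i j z. \<psi> i j z - (if j = lev i then \<integral>z. \<psi> i j z \<partial>circ else 0)"
  shows "norm_pow (torus N) p (\<lambda>z. \<Sum>i\<in>I. cs (m (\<xi> (lev i)) * of_real (\<Prod>j\<in>{1..lev i}. \<phi> i j (z j))) (x i))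
    \<le> ennreal (C powr p) *
      norm_pow (torus N) p (\<lambda>z. \<Sum>i\<in>I. cs (of_real (\<Prod>j\<in>{1..lev i}. \<phi> i j (z j))) (x i))"
proof -
  have "\<forall>i j. \<exists>q. i \<in> I \<longrightarrow> j \<in> {1..lev i} \<longrightarrow> (\<forall>n. real_polynomial_function (q n)) \<and>
     (\<forall>n::nat. \<forall>y\<in>{-1..1}. \<bar>q n y\<bar> \<le> 2) \<and> (\<forall>z\<in>sphere 0 1. (\<lambda>n. q n (Re z)) \<longlonglongrightarrow> \<psi> i j z)"
    using \<psi> unfolding poly_limit_def by blast
  then obtain q where q: "\<And>i j n. i \<in> I \<Longrightarrow> j \<in> {1..lev i} \<Longrightarrow> real_polynomial_function (q i j n)"
    and q2: "\<And>i j n y. i \<in> I \<Longrightarrow> j \<in> {1..lev i} \<Longrightarrow> y \<in> {-1..1} \<Longrightarrow> \<bar>q i j n y\<bar> \<le> 2"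
    and qlim: "\<And>i j z. i \<in> I \<Longrightarrow> j \<in> {1..lev i} \<Longrightarrow> z \<in> sphere 0 1 \<Longrightarrow> (\<lambda>n. q i j n (Re z)) \<longlonglongrightarrow> \<psi> i j z"
    unfolding choice_iff by blast
  have "\<forall>i j n. \<exists>l. i \<in> I \<longrightarrow> j \<in> {1..lev i} \<longrightarrow> (\<forall>z\<in>sphere 0 1. complex_of_real (q i j n (Re z)) = laurent_eval l z)"
    using real_polynomial_laurent[OF q] by blast
  then obtain l where l: "\<And>i j n z. i \<in> I \<Longrightarrow> j \<in> {1..lev i} \<Longrightarrow> z \<in> sphere 0 1 \<Longrightarrow>
      complex_of_real (q i j n (Re z)) = laurent_eval (l i j n) z"
    unfolding choice_iff by blast
  \<comment> \<open>Dropping the terms with exponent 0 from the last factor both centers it and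
    meets the condition on the top exponents in \<open>laurent_product_bound\<close>.\<close>
  define l' where "l' n i j = (if j = lev i then filter (\<lambda>(a, e). e \<noteq> 0) (l i j n) else l i j n)" for n i j
  have qm: "(\<lambda>z. q i j n (Re z)) \<in> borel_measurable circ" if "i \<in> I" "j \<in> {1..lev i}" for i j n
  proof -
    have "(\<lambda>z. Re (laurent_eval (l i j n) z)) \<in> borel_measurable circ"
      using laurent_eval_measurable by measurable
    moreover have "Re (laurent_eval (l i j n) z) = q i j n (Re z)" if "z \<in> space circ" for z
      using l[OF \<open>i \<in> I\<close> \<open>j \<in> _\<close>, of z n] that by (metis Re_complex_of_real space_circ)
    ultimately show ?thesis by (subst (asm) measurable_cong)
  qed
  define \<phi>n where "\<phi>n n i j z = q i j n (Re z) - (if j = lev i then \<integral>z. q i j n (Re z) \<partial>circ else 0)" for n i j z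
  have \<phi>n_eval: "complex_of_real (\<phi>n n i j z) = laurent_eval (l' n i j) z"
    if ij: "i \<in> I" "j \<in> {1..lev i}" and z: "z \<in> sphere 0 1" for n i j z
  proof -
    have "(\<integral>z. laurent_eval (l i j n) z \<partial>circ) = (\<integral>z. complex_of_real (q i j n (Re z)) \<partial>circ)"
      using l[OF ij] by (intro Bochner_Integration.integral_cong) auto
    then show ?thesis
      unfolding \<phi>n_def l'_def using l[OF ij z, of n]
      by (cases "j = lev i") (simp_all add: laurent_eval_centered)
  qed
  have int_bd: "\<bar>\<integral>z. q i j n (Re z) \<partial>circ\<bar> \<le> 2" if ij: "i \<in> I" "j \<in> {1..lev i}" for i j n
  proof -
    have "AE z in circ. norm (q i j n (Re z)) \<le> 2"
      using q2[OF ij] Re_sphere by (intro AE_I2) auto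
    have "norm (\<integral>z. q i j n (Re z) \<partial>circ) \<le> (\<integral>z. 2 \<partial>circ)"
    proof (rule Bochner_Integration.integral_norm_bound_integral)
      show "integrable circ (\<lambda>z. q i j n (Re z))"
        by (rule circ.integrable_const_bound[OF \<open>AE z in circ. _\<close> qm[OF ij]])
    qed (use q2[OF ij] Re_sphere in auto)
    then show ?thesis by (simp add: circ.prob_space[unfolded space_circ])
  qed
  \<comment> \<open>2 for the polynomial and 2 for its mean.\<close>
  have \<phi>n_bd: "\<bar>\<phi>n n i j z\<bar> \<le> 4" if ij: "i \<in> I" "j \<in> {1..lev i}" and z: "z \<in> sphere 0 1" for n i j z
    using int_bd[OF ij, of n] q2[OF ij Re_sphere[OF z], of n] unfolding \<phi>n_def by auto
  have \<phi>n_lim: "(\<lambda>n. \<phi>n n i j z) \<longlonglongrightarrow> \<phi> i j z" if ij: "i \<in> I" "j \<in> {1..lev i}" and z: "z \<in> sphere 0 1" for i j z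
  proof -
    have "(\<lambda>n. \<integral>z. q i j n (Re z) \<partial>circ) \<longlonglongrightarrow> (\<integral>z. \<psi> i j z \<partial>circ)"
    proof (rule integral_dominated_convergence[where w = "\<lambda>_. 2"])
      show "\<psi> i j \<in> borel_measurable circ"
        by (rule borel_measurable_LIMSEQ_metric[OF qm[OF ij]]) (use qlim[OF ij] in auto)
      show "AE z in circ. norm (q i j n (Re z)) \<le> 2" for n
        using q2[OF ij] Re_sphere by (intro AE_I2) auto
    qed (use qm[OF ij] qlim[OF ij] in auto)
    then show ?thesis unfolding \<phi>n_def \<phi>_def using qlim[OF ij z] by (auto intro!: tendsto_diff)
  qed
  have \<phi>n_m: "(\<lambda>z. \<phi>n n i j (z j)) \<in> borel_measurable (torus N)" if ij: "i \<in> I" "j \<in> {1..lev i}" for n i j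
  proof -
    have "j \<in> {1..N}" using ij lev[OF ij(1)] by auto
    from torus_component_measurable[OF this] show ?thesis
      unfolding \<phi>n_def by (intro borel_measurable_diff measurable_compose[OF _ qm[OF ij]]) auto
  qed
  define P where "P n i z = complex_of_real (\<Prod>j\<in>{1..lev i}. \<phi>n n i j (z j))" for n i z
  have zs: "z j \<in> sphere 0 1" if "z \<in> space (torus N)" "i \<in> I" "j \<in> {1..lev i}" for z i j
    using that lev[of i] by (intro torus_component[of z N]) auto
  have P_m: "P n i \<in> borel_measurable (torus N)" if "i \<in> I" for n i
  proof -
    have "(\<lambda>z. \<Prod>j\<in>{1..lev i}. \<phi>n n i j (z j)) \<in> borel_measurable (torus N)"
      using \<phi>n_m[OF that] by (intro borel_measurable_prod)
    then show ?thesis unfolding P_def[abs_def] by measurable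
  qed
  have P_bd: "cmod (P n i z) \<le> 4 ^ lev i" if "i \<in> I" "z \<in> space (torus N)" for n i z
  proof -
    have "cmod (P n i z) = (\<Prod>j\<in>{1..lev i}. \<bar>\<phi>n n i j (z j)\<bar>)" by (simp add: P_def abs_prod del: of_real_prod)
    also have "\<dots> \<le> (\<Prod>j\<in>{1..lev i}. 4)" using that zs by (intro prod_mono) (auto intro!: \<phi>n_bd)
    finally show ?thesis by simp
  qed
  have P_lim: "(\<lambda>n. P n i z) \<longlonglongrightarrow> complex_of_real (\<Prod>j\<in>{1..lev i}. \<phi> i j (z j))" if "i \<in> I" "z \<in> space (torus N)" for i z
    unfolding P_def using that zs by (intro tendsto_of_real tendsto_prod \<phi>n_lim) auto
  have "norm_pow (torus N) p (\<lambda>z. \<Sum>i\<in>I. cs (m (\<xi> (lev i)) * P n i z) (x i))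
    \<le> ennreal (C powr p) * norm_pow (torus N) p (\<lambda>z. \<Sum>i\<in>I. cs (P n i z) (x i))" for n
  proof -
    have P_eval: "P n i z = (\<Prod>j\<in>{1..lev i}. laurent_eval (l' n i j) (z j))" if "i \<in> I" "z \<in> space (torus N)" for i z
      unfolding P_def of_real_prod using that zs by (intro prod.cong refl \<phi>n_eval) auto
    have "norm_pow (torus N) p (\<lambda>z. \<Sum>i\<in>I. cs (m (\<xi> (lev i)) * (\<Prod>j\<in>{1..lev i}. laurent_eval (l' n i j) (z j))) (x i))
      \<le> ennreal (C powr p) *
      norm_pow (torus N) p (\<lambda>z. \<Sum>i\<in>I. cs (\<Prod>j\<in>{1..lev i}. laurent_eval (l' n i j) (z j)) (x i))"
      by (rule laurent_product_bound[OF fin \<xi> lev]) (auto simp: l'_def)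
    then show ?thesis by (simp add: norm_pow_def P_eval cong: nn_integral_cong sum.cong)
  qed
  moreover have "(\<lambda>n. norm_pow (torus N) p (\<lambda>z. \<Sum>i\<in>I. cs (m (\<xi> (lev i)) * P n i z) (x i)))
    \<longlonglongrightarrow> norm_pow (torus N) p (\<lambda>z. \<Sum>i\<in>I. cs (m (\<xi> (lev i)) * of_real (\<Prod>j\<in>{1..lev i}. \<phi> i j (z j))) (x i))"
    using p P_bd
    by (intro norm_cs_sum_dominated[where B = "\<lambda>i. cmod (m (\<xi> (lev i))) * 4 ^ lev i"] prob_space_torus tendsto_mult tendsto_const P_lim
        borel_measurable_times P_m) (auto simp: norm_mult intro!: mult_left_mono)
  moreover have "(\<lambda>n. ennreal (C powr p) * norm_pow (torus N) p (\<lambda>z. \<Sum>i\<in>I. cs (P n i z) (x i)))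
    \<longlonglongrightarrow> ennreal (C powr p) * norm_pow (torus N) p (\<lambda>z. \<Sum>i\<in>I. cs (of_real (\<Prod>j\<in>{1..lev i}. \<phi> i j (z j))) (x i))"
    using norm_cs_sum_dominated[where I = I, OF prob_space_torus _ P_m P_bd P_lim, where p = p and x = x] p
    by (intro ennreal_tendsto_cmult) auto
  ultimately show ?thesis by (intro LIMSEQ_le) auto
qed

end

section \<open>Finite trees\<close>

definition words :: "'b set \<Rightarrow> nat \<Rightarrow> 'b list set" where
  "words R n = {a. set a \<subseteq> R \<and> length a = n}"

lemma finite_words: "finite R \<Longrightarrow> finite (words R n)"
  unfolding words_def by (rule finite_lists_length_eq)

lemma words_0 [simp]: "words R 0 = {[]}"
  by (auto simp: words_def)

lemma sum_words_Suc:
  assumes "finite R"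
  shows "(\<Sum>a\<in>words R (Suc n). f a) = (\<Sum>a\<in>words R n. \<Sum>b\<in>R. f (a @ [b]))"
proof -
  have "words R (Suc n) = (\<lambda>(a, b). a @ [b]) ` (words R n \<times> R)"
  proof (intro equalityI subsetI)
    fix a assume "a \<in> words R (Suc n)"
    then have a: "set a \<subseteq> R" "length a = Suc n" by (auto simp: words_def)
    then obtain c b where "a = c @ [b]" by (metis length_0_conv nat.distinct(1) rev_exhaust)
    with a show "a \<in> (\<lambda>(a, b). a @ [b]) ` (words R n \<times> R)" by (auto simp: words_def intro!: image_eqI[of _ _ "(c, b)"])
  qed (auto simp: words_def)
  moreover have "inj_on (\<lambda>(a, b). a @ [b]) (words R n \<times> R)" by (auto simp: inj_on_def)
  ultimately show ?thesis
    by (simp add: sum.reindex sum.cartesian_product o_def split_def)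
qed

lemma sum_words_le:
  assumes "finite R"
  shows "(\<Sum>a\<in>{a. set a \<subseteq> R \<and> length a \<le> N}. f a) = (\<Sum>n\<le>N. \<Sum>a\<in>words R n. f a)"
proof -
  have "{a. set a \<subseteq> R \<and> length a \<le> N} = (\<Union>n\<in>{..N}. words R n)" by (auto simp: words_def)
  then show ?thesis
    using finite_words[OF assms] by (simp only:) (subst sum.UNION_disjoint, auto, auto simp: words_def)
qed

text \<open>\<open>P a\<close> is the probability of the path \<open>a\<close> in a tree of depth \<open>N\<close> with children labelled by \<open>R\<close>.\<close>

locale prob_tree =
  fixes R :: "'b set" and P :: "'b list \<Rightarrow> real" and N :: nat
  assumes finR: "finite R" and P_nonneg: "set a \<subseteq> R \<Longrightarrow> 0 \<le> P a" and P_Nil: "P [] = 1"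
    and P_step: "set a \<subseteq> R \<Longrightarrow> length a < N \<Longrightarrow> (\<Sum>b\<in>R. P (a @ [b])) = P a"
begin

text \<open>An arbitrary numbering of the labels, used to put the intervals of the children side by
  side.\<close>

definition idx :: "'b \<Rightarrow> nat" where "idx = (SOME f. inj_on f R)"

text \<open>The conditional probability of the child \<open>b\<close> at the node \<open>a\<close>.
  Where \<open>P a = 0\<close>, division by zero makes it 0 and all intervals are empty.\<close>

definition wt :: "'b list \<Rightarrow> 'b \<Rightarrow> real" where "wt a b = P (a @ [b]) / P a"

definition lo :: "'b list \<Rightarrow> 'b \<Rightarrow> real" where
  "lo a b = (\<Sum>b'\<in>{b'\<in>R. idx b' < idx b}. wt a b')"

text \<open>A uniform variable selects child \<open>b\<close> of \<open>a\<close> when it falls into the interval of \<open>b\<close>.\<close>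

definition child :: "'b list \<Rightarrow> 'b \<Rightarrow> complex \<Rightarrow> real" where
  "child a b z = indicator {lo a b..<lo a b + wt a b} (circ_unif z)"

text \<open>Coordinate \<open>j\<close> of the torus decides the letter at list index
  \<open>j - 1\<close>, given the letters before it.\<close>

definition step :: "'b list \<Rightarrow> nat \<Rightarrow> complex \<Rightarrow> real" where
  "step a j = child (take (j - 1) a) (a ! (j - 1))"

definition path :: "'b list \<Rightarrow> (nat \<Rightarrow> complex) \<Rightarrow> real" where
  "path a z = (\<Prod>j\<in>{1..length a}. step a j (z j))"

lemma idx_inj: "inj_on idx R"
proof -
  obtain f :: "'b \<Rightarrow> nat" where "inj_on f R" using finite_imp_inj_to_nat_seg[OF finR] by metis
  then show ?thesis unfolding idx_def by (rule someI[of "\<lambda>f. inj_on f R"])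
qed

lemma wt_nonneg: "set a \<subseteq> R \<Longrightarrow> b \<in> R \<Longrightarrow> 0 \<le> wt a b"
  unfolding wt_def by (intro divide_nonneg_nonneg P_nonneg) auto

lemma lo_nonneg: "set a \<subseteq> R \<Longrightarrow> 0 \<le> lo a b"
  unfolding lo_def by (intro sum_nonneg wt_nonneg) auto

lemma lo_less:
  assumes "set a \<subseteq> R" "b \<in> R" "b' \<in> R" "idx b < idx b'"
  shows "lo a b + wt a b \<le> lo a b'"
proof -
  have "lo a b + wt a b = (\<Sum>c\<in>insert b {c\<in>R. idx c < idx b}. wt a c)"
    using finR by (simp add: lo_def add.commute)
  also have "\<dots> \<le> lo a b'"
    unfolding lo_def using assms finR by (intro sum_mono2) (auto intro!: wt_nonneg)
  finally show ?thesis .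
qed

lemma lo_le_1:
  assumes "set a \<subseteq> R" "b \<in> R" "length a < N"
  shows "lo a b + wt a b \<le> 1"
proof -
  have "lo a b + wt a b = (\<Sum>c\<in>insert b {c\<in>R. idx c < idx b}. wt a c)"
    using finR by (simp add: lo_def add.commute)
  also have "\<dots> \<le> (\<Sum>c\<in>R. wt a c)"
    using assms finR by (intro sum_mono2) (auto intro!: wt_nonneg)
  \<comment> \<open>This quotient is 1, or 0 if \<open>P a = 0\<close>.\<close>
  also have "\<dots> = P a / P a" using P_step[OF assms(1,3)] by (simp add: wt_def sum_divide_distrib[symmetric])
  also have "\<dots> \<le> 1" by simp
  finally show ?thesis .
qed

lemma child_cases: "child a b z = 0 \<or> child a b z = 1"
  by (auto simp: child_def indicator_def)

lemma child_measurable [measurable]: "child a b \<in> borel_measurable circ"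
  unfolding child_def[abs_def] by measurable

lemma nn_integral_child:
  assumes "set a \<subseteq> R" "b \<in> R" "length a < N"
  shows "(\<integral>\<^sup>+z. ennreal (child a b z) \<partial>circ) = ennreal (wt a b)"
  using circ_unif_uniform[of "lo a b" "lo a b + wt a b"] lo_nonneg[of a b] wt_nonneg[of a b] lo_le_1[of a b] assms
  by (simp add: child_def ennreal_indicator)

lemma integral_child:
  assumes "set a \<subseteq> R" "b \<in> R" "length a < N"
  shows "(\<integral>z. child a b z \<partial>circ) = wt a b"
  using nn_integral_child[OF assms] wt_nonneg[OF assms(1,2)]
  by (intro integral_eq_nn_integral[THEN trans]) (auto simp: child_def)

lemma step_snoc: "j \<in> {1..length a} \<Longrightarrow> step (a @ [b]) j = step a j"
  by (auto simp: step_def nth_append)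

lemma path_Nil [simp]: "path [] z = 1"
  by (simp add: path_def)

lemma path_snoc: "path (a @ [b]) z = path a z * child a b (z (Suc (length a)))"
proof -
  have "path (a @ [b]) z = (\<Prod>j\<in>{1..length a}. step (a @ [b]) j (z j)) * step (a @ [b]) (Suc (length a)) (z (Suc (length a)))"
    by (simp add: path_def)
  also have "(\<Prod>j\<in>{1..length a}. step (a @ [b]) j (z j)) = path a z"
    unfolding path_def by (intro prod.cong refl) (simp add: step_snoc)
  finally show ?thesis by (simp add: step_def)
qed

lemma path_cases: "path a z = 0 \<or> path a z = 1"
proof (induction a rule: rev_induct)
  case (snoc b a)
  then show ?case using child_cases[of a b "z (Suc (length a))"] by (auto simp: path_snoc)
qed simp

lemma path_take: "path c z = 1 \<Longrightarrow> path (take n c) z = 1"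
proof (induction c rule: rev_induct)
  case (snoc b c)
  then have "path c z = 1" using path_cases[of c z] by (auto simp: path_snoc)
  with snoc show ?case by (cases "n \<le> length c") auto
qed simp

lemma child_unique:
  assumes "set a \<subseteq> R" "b \<in> R" "b' \<in> R" "child a b z = 1" "child a b' z = 1"
  shows "b = b'"
proof (rule ccontr)
  assume "b \<noteq> b'"
  then have "idx b \<noteq> idx b'" using idx_inj assms by (auto dest: inj_onD)
  then consider "idx b < idx b'" | "idx b' < idx b" by linarith
  then show False
    using assms lo_less[of a b b'] lo_less[of a b' b] by cases (auto simp: child_def indicator_def split: if_splits)
qed

text \<open>Siblings have disjoint intervals, so by induction on the depth a point follows only one
  branch.\<close>

lemma path_unique:
  assumes c: "c \<in> words R N" "path c z = 1"
  shows "a \<in> words R n \<Longrightarrow> n \<le> N \<Longrightarrow> path a z = 1 \<Longrightarrow> a = take n c"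
proof (induction n arbitrary: a)
  case (Suc n)
  obtain a' b where a: "a = a' @ [b]"
    using Suc.prems(1) by (cases a rule: rev_cases) (auto simp: words_def)
  have a': "a' \<in> words R n" "b \<in> R" using Suc.prems a by (auto simp: words_def)
  have "path a' z * child a' b (z (Suc n)) = 1"
    using Suc.prems(3) a' by (simp add: a path_snoc words_def)
  then have p: "path a' z = 1" "child a' b (z (Suc n)) = 1"
    using path_cases[of a' z] by auto
  have e: "a' = take n c" using Suc.IH[OF a'(1) _ p(1)] Suc.prems by simp
  have n: "n < length c" using c Suc.prems by (auto simp: words_def)
  have t: "take (Suc n) c = take n c @ [c ! n]" by (rule take_Suc_conv_app_nth[OF n])
  have "path (take (Suc n) c) z = 1" by (rule path_take[OF c(2)])
  then have "child a' (c ! n) (z (Suc n)) = 1"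
    using p n by (simp add: t path_snoc e)
  moreover have "c ! n \<in> R" using c n by (auto simp: words_def)
  ultimately have "b = c ! n" using child_unique[of a' b "c ! n"] p a' by (auto simp: words_def)
  then show ?case by (simp add: a e t)
qed simp

lemma path_eq:
  assumes "c \<in> words R N" "path c z = 1" "a \<in> words R n" "n \<le> N"
  shows "path a z = (if a = take n c then 1 else 0)"
proof (cases "a = take n c")
  case True
  then show ?thesis using path_take[OF assms(2), of n] by simp
next
  case False
  then have "path a z \<noteq> 1" using path_unique[OF assms(1,2,3,4)] by blast
  then show ?thesis using False path_cases[of a z] by simp
qed

lemma path_measurable [measurable]:
  assumes "length a \<le> N" shows "path a \<in> borel_measurable (torus N)"
  unfolding path_def[abs_def] step_def
  by (intro borel_measurable_prod measurable_compose[OF torus_component_measurable child_measurable]) (use assms in auto)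

lemma sum_P_words: "n \<le> N \<Longrightarrow> (\<Sum>a\<in>words R n. P a) = 1"
proof (induction n)
  case (Suc n)
  have "(\<Sum>a\<in>words R (Suc n). P a) = (\<Sum>a\<in>words R n. \<Sum>b\<in>R. P (a @ [b]))"
    by (rule sum_words_Suc[OF finR])
  also have "\<dots> = (\<Sum>a\<in>words R n. P a)"
    using Suc.prems by (intro sum.cong refl P_step) (auto simp: words_def)
  finally show ?case using Suc by simp
qed (simp add: P_Nil)

lemma P_snoc_wt:
  assumes "set a \<subseteq> R" "b \<in> R" "length a < N" shows "P a * wt a b = P (a @ [b])"
proof (cases "P a = 0")
  case True
  then have "(\<Sum>b\<in>R. P (a @ [b])) = 0" using P_step assms by simp
  then have "P (a @ [b]) = 0"
    using assms finR P_nonneg by (subst (asm) sum_nonneg_eq_0_iff) auto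
  with True show ?thesis by simp
qed (simp add: wt_def)

text \<open>The coordinates are independent, so the integral is the product of the conditional
  probabilities along the path, which telescopes.\<close>

lemma nn_integral_path:
  assumes a: "a \<in> words R N"
  shows "(\<integral>\<^sup>+z. ennreal (path a z) \<partial>torus N) = ennreal (P a)"
proof -
  have sub: "set (take j a) \<subseteq> R" for j using a set_take_subset[of j a] by (auto simp: words_def)
  have len: "length a = N" using a by (simp add: words_def)
  have telescope: "(\<Prod>j\<in>{1..n}. wt (take (j - 1) a) (a ! (j - 1))) = P (take n a)" if "n \<le> N" for n
    using that
  proof (induction n)
    case (Suc n)
    then have "P (take n a) * wt (take n a) (a ! n) = P (take n a @ [a ! n])"
      using a len sub by (intro P_snoc_wt) (auto simp: words_def)
    with Suc show ?case using len by (simp add: take_Suc_conv_app_nth)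
  qed (simp add: P_Nil)
  have "(\<integral>\<^sup>+z. ennreal (path a z) \<partial>torus N) = (\<integral>\<^sup>+z. (\<Prod>j\<in>{1..N}. ennreal (step a j (z j))) \<partial>torus N)"
    unfolding path_def len by (intro nn_integral_cong prod_ennreal[symmetric]) (simp add: step_def child_def)
  also have "\<dots> = (\<Prod>j\<in>{1..N}. \<integral>\<^sup>+z. ennreal (step a j z) \<partial>circ)"
    unfolding torus_def by (rule circ_prod.product_nn_integral_prod) (auto simp: step_def)
  also have "\<dots> = (\<Prod>j\<in>{1..N}. ennreal (wt (take (j - 1) a) (a ! (j - 1))))"
    unfolding step_def using a len sub
    by (intro prod.cong refl nn_integral_child) (auto simp: words_def)
  also have "\<dots> = ennreal (\<Prod>j\<in>{1..N}. wt (take (j - 1) a) (a ! (j - 1)))"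
    using a len sub by (intro prod_ennreal wt_nonneg) (auto simp: words_def)
  also have "(\<Prod>j\<in>{1..N}. wt (take (j - 1) a) (a ! (j - 1))) = P (take N a)" by (rule telescope) simp
  finally show ?thesis using len by simp
qed

text \<open>The half-open intervals do not reach \<open>circ_unif z = 1\<close>, so a null set is
  lost. It is not described: the full paths are disjoint events, and their probabilities sum to
  1.\<close>

lemma AE_path: "AE z in torus N. \<exists>c\<in>words R N. path c z = 1"
proof -
  have m: "(\<lambda>z. \<Sum>a\<in>words R N. path a z) \<in> borel_measurable (torus N)"
    by (intro borel_measurable_sum path_measurable) (simp add: words_def)
  have pm: "(\<lambda>z. ennreal (path a z)) \<in> borel_measurable (torus N)" if "a \<in> words R N" for a
    using that by (intro measurable_compose[OF path_measurable measurable_ennreal]) (simp add: words_def)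
  have path_nonneg: "0 \<le> path a z" for a z using path_cases[of a z] by auto
  have le: "(\<Sum>a\<in>words R N. path a z) = (if \<exists>c\<in>words R N. path c z = 1 then 1 else 0)" for z
  proof (cases "\<exists>c\<in>words R N. path c z = 1")
    case True
    then obtain c where c: "c \<in> words R N" "path c z = 1" by blast
    have "(\<Sum>a\<in>words R N. path a z) = (\<Sum>a\<in>words R N. if a = c then 1 else 0)"
      using c path_eq[OF c] by (intro sum.cong) (auto simp: words_def)
    then show ?thesis using c finite_words[OF finR] by auto
  next
    case False
    then show ?thesis using path_cases by (auto intro!: sum.neutral)
  qed
  define E where "E = {z \<in> space (torus N). (\<Sum>a\<in>words R N. path a z) = 1}"
  have E: "E \<in> sets (torus N)" unfolding E_def using m by measurable
  have "emeasure (torus N) E = (\<integral>\<^sup>+z. indicator E z \<partial>torus N)" using E by simp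
  also have "\<dots> = (\<integral>\<^sup>+z. (\<Sum>a\<in>words R N. ennreal (path a z)) \<partial>torus N)"
    by (intro nn_integral_cong) (simp add: E_def sum_ennreal path_nonneg le)
  also have "\<dots> = (\<Sum>a\<in>words R N. ennreal (P a))"
    by (subst nn_integral_sum) (auto simp: nn_integral_path pm)
  also have "\<dots> = ennreal 1"
    using sum_P_words[of N] P_nonneg by (subst sum_ennreal) (auto simp: words_def)
  finally have "AE z in torus N. z \<in> E"
    using E by (subst torus.prob_eq_1[symmetric]) (auto simp: torus.emeasure_eq_measure)
  then show ?thesis by eventually_elim (auto simp: E_def le split: if_splits)
qed

end

text \<open>\<open>D a\<close> is the difference on the last edge of \<open>a\<close>, and
  \<open>D []\<close> is free. The condition is weighted by \<open>P\<close> instead of conditional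
  probabilities, which avoids a division.\<close>

locale tree_martingale = prob_tree R P N + complex_scaling cs
  for R :: "'b set" and P N and cs :: "complex \<Rightarrow> 'x::banach \<Rightarrow> 'x" +
  fixes D :: "'b list \<Rightarrow> 'x"
  assumes martingale: "set a \<subseteq> R \<Longrightarrow> length a < N \<Longrightarrow> (\<Sum>b\<in>R. P (a @ [b]) *\<^sub>R D (a @ [b])) = 0"
begin

text \<open>Centering the last step gives the shape required by
  \<open>centered_product_bound\<close>; by \<open>level_sum\<close> it does not change the values
  along a path.\<close>

definition cstep :: "'b list \<Rightarrow> nat \<Rightarrow> complex \<Rightarrow> real" where
  "cstep a j z = step a j z - (if j = length a then \<integral>z. step a j z \<partial>circ else 0)"

lemma prod_cstep_snoc:
  assumes "set a \<subseteq> R" "b \<in> R" "length a < N"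
  shows "(\<Prod>j\<in>{1..length (a @ [b])}. cstep (a @ [b]) j (z j)) = path a z * (child a b (z (Suc (length a))) - wt a b)"
proof -
  have "(\<Prod>j\<in>{1..length (a @ [b])}. cstep (a @ [b]) j (z j)) =
    (\<Prod>j\<in>{1..length a}. cstep (a @ [b]) j (z j)) * cstep (a @ [b]) (Suc (length a)) (z (Suc (length a)))"
    by simp
  also have "(\<Prod>j\<in>{1..length a}. cstep (a @ [b]) j (z j)) = path a z"
    unfolding path_def by (intro prod.cong refl) (simp add: cstep_def step_snoc)
  also have "cstep (a @ [b]) (Suc (length a)) (z (Suc (length a))) = child a b (z (Suc (length a))) - wt a b"
    using integral_child[OF assms] by (simp add: cstep_def step_def)
  finally show ?thesis .
qed

text \<open>The means subtracted in \<open>cstep\<close> contribute a multiple of the sum of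
  \<open>wt t b *\<^sub>R D (t @ [b])\<close> over the children of the current node, which is 0 by
  the martingale condition. Of the remaining indicators only that of the selected child
  survives.\<close>

lemma level_sum:
  assumes c: "c \<in> words R N" "path c z = 1" and n: "n \<le> N"
  shows "(\<Sum>a\<in>words R n. cs (\<kappa> * of_real (\<Prod>j\<in>{1..length a}. cstep a j (z j))) (D a)) = cs \<kappa> (D (take n c))"
proof (cases n)
  case 0
  then show ?thesis by simp
next
  case (Suc k)
  have k: "k < length c" using c n Suc by (simp add: words_def)
  \<comment> \<open>The only node of level \<open>k\<close> whose path indicator is not 0 at
    \<open>z\<close>.\<close>
  define t where "t = take k c"
  have t: "set t \<subseteq> R" "length t = k" "t \<in> words R k" "take n c = t @ [c ! k]" "c ! k \<in> R"
    using c k Suc set_take_subset[of k c] by (auto simp: t_def words_def take_Suc_conv_app_nth)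
  have ch: "child t b (z (Suc k)) = (if b = c ! k then 1 else 0)" if "b \<in> R" for b
  proof -
    have "path t z * child t (c ! k) (z (Suc k)) = 1"
      using path_take[OF c(2), of n] t(2,4) by (simp add: path_snoc)
    then have "child t (c ! k) (z (Suc k)) = 1" using path_cases[of t z] by auto
    then show ?thesis
      using child_unique[OF t(1) that t(5), of "z (Suc k)"] child_cases[of t b "z (Suc k)"]
      by (metis (full_types))
  qed
  have wt0: "(\<Sum>b\<in>R. wt t b *\<^sub>R D (t @ [b])) = 0"
  proof -
    have "(\<Sum>b\<in>R. wt t b *\<^sub>R D (t @ [b])) = (1 / P t) *\<^sub>R (\<Sum>b\<in>R. P (t @ [b]) *\<^sub>R D (t @ [b]))"
      by (simp add: wt_def scaleR_sum_right)
    then show ?thesis using martingale[OF t(1)] t n Suc by simp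
  qed
  have "(\<Sum>a\<in>words R n. cs (\<kappa> * of_real (\<Prod>j\<in>{1..length a}. cstep a j (z j))) (D a))
    = (\<Sum>a\<in>words R k. \<Sum>b\<in>R. cs (\<kappa> * of_real (\<Prod>j\<in>{1..length (a @ [b])}. cstep (a @ [b]) j (z j))) (D (a @ [b])))"
    unfolding Suc by (rule sum_words_Suc[OF finR])
  also have "\<dots> = (\<Sum>a\<in>words R k. if a = t then (\<Sum>b\<in>R. cs (\<kappa> * of_real (child t b (z (Suc k)) - wt t b)) (D (t @ [b]))) else 0)"
  proof (rule sum.cong[OF refl])
    fix a assume a: "a \<in> words R k"
    have pa: "path a z = (if a = t then 1 else 0)"
      using path_eq[OF c a] n Suc by (simp add: t_def)
    have sa: "set a \<subseteq> R" "length a < N" and la: "length a = k" using a n Suc by (auto simp: words_def)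
    have "(\<Sum>b\<in>R. cs (\<kappa> * of_real (\<Prod>j\<in>{1..length (a @ [b])}. cstep (a @ [b]) j (z j))) (D (a @ [b])))
      = (\<Sum>b\<in>R. cs (\<kappa> * of_real (path a z * (child a b (z (Suc k)) - wt a b))) (D (a @ [b])))"
    proof (rule sum.cong[OF refl])
      fix b assume b: "b \<in> R"
      show "cs (\<kappa> * of_real (\<Prod>j\<in>{1..length (a @ [b])}. cstep (a @ [b]) j (z j))) (D (a @ [b]))
        = cs (\<kappa> * of_real (path a z * (child a b (z (Suc k)) - wt a b))) (D (a @ [b]))"
        by (simp only: prod_cstep_snoc[OF sa(1) b sa(2)] la)
    qed
    then show "(\<Sum>b\<in>R. cs (\<kappa> * of_real (\<Prod>j\<in>{1..length (a @ [b])}. cstep (a @ [b]) j (z j))) (D (a @ [b])))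
       = (if a = t then (\<Sum>b\<in>R. cs (\<kappa> * of_real (child t b (z (Suc k)) - wt t b)) (D (t @ [b]))) else 0)"
      by (simp only: pa) simp
  qed
  also have "\<dots> = (\<Sum>b\<in>R. cs (\<kappa> * of_real (child t b (z (Suc k)) - wt t b)) (D (t @ [b])))"
    using t(3) finite_words[OF finR] by (simp add: sum.delta)
  also have "\<dots> = cs \<kappa> (\<Sum>b\<in>R. (child t b (z (Suc k)) - wt t b) *\<^sub>R D (t @ [b]))"
    by (simp only: cs_sum_right cs_mult cs_of_real)
  also have "(\<Sum>b\<in>R. (child t b (z (Suc k)) - wt t b) *\<^sub>R D (t @ [b]))
     = (\<Sum>b\<in>R. child t b (z (Suc k)) *\<^sub>R D (t @ [b])) - (\<Sum>b\<in>R. wt t b *\<^sub>R D (t @ [b]))"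
    by (simp add: scaleR_diff_left sum_subtractf)
  also have "\<dots> = (\<Sum>b\<in>R. child t b (z (Suc k)) *\<^sub>R D (t @ [b]))" by (simp add: wt0)
  also have "\<dots> = (\<Sum>b\<in>R. if b = c ! k then D (t @ [b]) else 0)"
    by (intro sum.cong refl) (simp add: ch)
  also have "\<dots> = D (take n c)" using t finR by (simp add: sum.delta)
  finally show ?thesis .
qed

text \<open>Almost every point follows one full path, on which the sum is constant. A general
  \<kappa> is allowed since the formula serves both the values of \<open>m\<close> and the constant
  1.\<close>

lemma tree_integral:
  "norm_pow (torus N) p (\<lambda>z. \<Sum>a\<in>{a. set a \<subseteq> R \<and> length a \<le> N}.
      cs (\<kappa> (length a) * of_real (\<Prod>j\<in>{1..length a}. cstep a j (z j))) (D a))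
   = ennreal (\<Sum>a\<in>words R N. P a * norm (\<Sum>n\<le>N. cs (\<kappa> n) (D (take n a))) powr p)"
proof -
  define G where "G a = norm (\<Sum>n\<le>N. cs (\<kappa> n) (D (take n a))) powr p" for a
  have "AE z in torus N. ennreal (norm (\<Sum>a\<in>{a. set a \<subseteq> R \<and> length a \<le> N}.
      cs (\<kappa> (length a) * of_real (\<Prod>j\<in>{1..length a}. cstep a j (z j))) (D a)) powr p)
      = (\<Sum>a\<in>words R N. ennreal (path a z) * ennreal (G a))"
    using AE_path
  proof eventually_elim
    case (elim z)
    then obtain c where c: "c \<in> words R N" "path c z = 1" by blast
    have "(\<Sum>a\<in>{a. set a \<subseteq> R \<and> length a \<le> N}.
      cs (\<kappa> (length a) * of_real (\<Prod>j\<in>{1..length a}. cstep a j (z j))) (D a))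
      = (\<Sum>n\<le>N. \<Sum>a\<in>words R n. cs (\<kappa> n * of_real (\<Prod>j\<in>{1..length a}. cstep a j (z j))) (D a))"
      unfolding sum_words_le[OF finR] by (intro sum.cong refl) (simp add: words_def)
    also have "\<dots> = (\<Sum>n\<le>N. cs (\<kappa> n) (D (take n c)))"
      by (intro sum.cong refl level_sum[OF c]) simp
    finally have "norm (\<Sum>a\<in>{a. set a \<subseteq> R \<and> length a \<le> N}.
      cs (\<kappa> (length a) * of_real (\<Prod>j\<in>{1..length a}. cstep a j (z j))) (D a)) powr p = G c"
      by (simp add: G_def)
    moreover have "(\<Sum>a\<in>words R N. ennreal (path a z) * ennreal (G a)) = (\<Sum>a\<in>words R N. if a = c then ennreal (G c) else 0)"
      using c path_eq[OF c] by (intro sum.cong) (auto simp: words_def)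
    ultimately show ?case using c finite_words[OF finR] by (simp add: sum.delta)
  qed
  then have "(\<integral>\<^sup>+z. ennreal (norm (\<Sum>a\<in>{a. set a \<subseteq> R \<and> length a \<le> N}.
      cs (\<kappa> (length a) * of_real (\<Prod>j\<in>{1..length a}. cstep a j (z j))) (D a)) powr p) \<partial>torus N)
      = (\<integral>\<^sup>+z. (\<Sum>a\<in>words R N. ennreal (path a z) * ennreal (G a)) \<partial>torus N)"
    by (rule nn_integral_cong_AE)
  also have "\<dots> = (\<Sum>a\<in>words R N. ennreal (P a) * ennreal (G a))"
  proof -
    have pm: "(\<lambda>z. ennreal (path a z)) \<in> borel_measurable (torus N)" if "a \<in> words R N" for a
      using that by (intro measurable_compose[OF path_measurable measurable_ennreal]) (simp add: words_def)
    show ?thesis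
      by (subst nn_integral_sum) (auto intro!: borel_measurable_times_ennreal pm simp: nn_integral_multc pm nn_integral_path)
  qed
  also have "\<dots> = ennreal (\<Sum>a\<in>words R N. P a * G a)"
    using P_nonneg by (subst sum_ennreal[symmetric]) (auto simp: words_def G_def ennreal_mult)
  finally show ?thesis unfolding G_def norm_pow_def .
qed

end

context even_homogeneous_multiplier
begin

proposition finite_tree_bound:
  assumes tree: "tree_martingale R P N cs D" and \<xi>: "\<And>j. \<xi> j \<noteq> 0"
  shows "(\<Sum>a\<in>words R N. P a * norm (\<Sum>n\<le>N. cs (m (\<xi> n)) (D (take n a))) powr p)
    \<le> C powr p * (\<Sum>a\<in>words R N. P a * norm (\<Sum>n\<le>N. D (take n a)) powr p)"
proof -
  interpret tree_martingale R P N cs D by (rule tree)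
  have pl: "poly_limit (step a j)" if "a \<in> {a. set a \<subseteq> R \<and> length a \<le> N}" "j \<in> {1..length a}" for a j
    unfolding step_def child_def[abs_def]
    using that set_take_subset[of "j - 1" a] by (intro poly_limit_indicator) (auto intro!: wt_nonneg)
  have "ennreal (\<Sum>a\<in>words R N. P a * norm (\<Sum>n\<le>N. cs (m (\<xi> n)) (D (take n a))) powr p)
    \<le> ennreal (C powr p) * ennreal (\<Sum>a\<in>words R N. P a * norm (\<Sum>n\<le>N. cs 1 (D (take n a))) powr p)"
    unfolding tree_integral[symmetric]
    using centered_product_bound[where I = "{a. set a \<subseteq> R \<and> length a \<le> N}" and lev = length and N = N and \<psi> = step
        and \<xi> = \<xi> and x = D, OF finite_lists_length_le[OF finR] \<xi> _ pl, folded cstep_def]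
    by simp
  then show ?thesis
    using P_nonneg by (subst (asm) ennreal_mult[symmetric])
      (auto simp: words_def intro!: sum_nonneg mult_nonneg_nonneg dest!: iffD1[OF ennreal_le_iff, rotated])
qed

end

section \<open>Martingales of simple functions\<close>

locale simple_process = prob_space M for M :: "'w measure" +
  fixes s :: "nat \<Rightarrow> 'w \<Rightarrow> 'x::real_normed_vector" and N :: nat
  assumes simple: "n \<in> {1..N} \<Longrightarrow> simple_function M (s n)"
begin

text \<open>One alphabet for all times. A word that no point follows has an empty atom, hence
  probability 0.\<close>

definition vals :: "'x set" where "vals = (\<Union>n\<in>{1..N}. s n ` space M)"

definition prefix :: "nat \<Rightarrow> 'w \<Rightarrow> 'x list" where
  "prefix k w = map (\<lambda>j. s (Suc j) w) [0..<k]"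

definition atom :: "'x list \<Rightarrow> 'w set" where
  "atom a = {w\<in>space M. prefix (length a) w = a}"

definition P :: "'x list \<Rightarrow> real" where "P a = prob (atom a)"

text \<open>The conditional mean of the next value on the atom of \<open>a\<close>; on a null atom
  the division by zero makes it 0.\<close>

definition mean :: "'x list \<Rightarrow> 'x" where
  "mean a = (\<Sum>b\<in>vals. (P (a @ [b]) / P a) *\<^sub>R b)"

definition diff :: "'x list \<Rightarrow> 'x" where
  "diff a = (if a = [] then mean [] else last a - mean (butlast a))"

lemma finite_vals: "finite vals"
  unfolding vals_def by (intro finite_UN_I simple_functionD(1) simple) auto

lemma s_vals: "n \<in> {1..N} \<Longrightarrow> w \<in> space M \<Longrightarrow> s n w \<in> vals"
  unfolding vals_def by blast

lemma length_prefix [simp]: "length (prefix k w) = k"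
  by (simp add: prefix_def)

lemma prefix_0 [simp]: "prefix 0 w = []"
  by (simp add: prefix_def)

lemma prefix_Suc: "prefix (Suc k) w = prefix k w @ [s (Suc k) w]"
  by (simp add: prefix_def)

lemma take_prefix: "j \<le> k \<Longrightarrow> take j (prefix k w) = prefix j w"
  by (simp add: prefix_def take_map)

lemma prefix_words: "w \<in> space M \<Longrightarrow> k \<le> N \<Longrightarrow> prefix k w \<in> words vals k"
  unfolding words_def prefix_def by (auto intro!: s_vals)

lemma atom_snoc: "atom (a @ [b]) = {w\<in>atom a. s (Suc (length a)) w = b}"
  by (auto simp: atom_def prefix_Suc)

lemma atom_Nil [simp]: "atom [] = space M"
  by (auto simp: atom_def)

text \<open>\<open>G\<close> is general because the atoms of the first \<open>n - 1\<close> values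
  are later needed as members of the filtration at index \<open>n - 1\<close>.\<close>

lemma atom_sets_sub:
  assumes G: "space G = space M"
  shows "(\<And>n. n \<in> {1..length a} \<Longrightarrow> simple_function G (s n)) \<Longrightarrow> atom a \<in> sets G"
proof (induction a rule: rev_induct)
  case Nil
  then show ?case by (simp add: G[symmetric])
next
  case (snoc b a)
  have "simple_function G (s (Suc (length a)))" by (rule snoc.prems) auto
  then have "s (Suc (length a)) -` {b} \<inter> space G \<in> sets G" by (rule simple_functionD)
  moreover have "atom a \<in> sets G" by (rule snoc.IH, rule snoc.prems) auto
  moreover have "atom (a @ [b]) = atom a \<inter> (s (Suc (length a)) -` {b} \<inter> space G)"
    by (auto simp: atom_snoc G) (auto simp: atom_def)
  ultimately show ?case by (metis sets.Int)
qed

lemma atom_sets: "length a \<le> N \<Longrightarrow> atom a \<in> sets M"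
  by (rule atom_sets_sub) (auto intro!: simple)

lemma P_step:
  assumes "length a < N"
  shows "(\<Sum>b\<in>vals. P (a @ [b])) = P a"
proof -
  have "P a = prob (\<Union>b\<in>vals. atom (a @ [b]))"
  proof -
    have "s (Suc (length a)) w \<in> vals" if "w \<in> atom a" for w
      using that assms by (intro s_vals) (auto simp: atom_def)
    then have "atom a = (\<Union>b\<in>vals. atom (a @ [b]))" by (auto simp: atom_snoc)
    then show ?thesis by (simp add: P_def)
  qed
  also have "\<dots> = (\<Sum>b\<in>vals. P (a @ [b]))"
    unfolding P_def using assms
    by (intro finite_measure_finite_Union finite_vals)
       (auto simp: disjoint_family_on_def atom_snoc intro!: atom_sets[of "a @ [_]", unfolded atom_snoc])
  finally show ?thesis ..
qed

lemma prob_tree: "prob_tree vals P N"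
  by standard (auto simp: finite_vals P_step, auto simp: P_def prob_space)

lemma diff_snoc [simp]: "diff (a @ [b]) = b - mean a"
  by (simp add: diff_def)

text \<open>The factor \<open>P a\<close> removes the division: on a null atom both sides vanish,
  since the atoms of its children are null too.\<close>

lemma mean_scale:
  assumes "length a < N" shows "P a *\<^sub>R mean a = (\<Sum>b\<in>vals. P (a @ [b]) *\<^sub>R b)"
proof (cases "P a = 0")
  case True
  then have "(\<Sum>b\<in>vals. P (a @ [b])) = 0" using P_step[OF assms] by simp
  then have "\<forall>b\<in>vals. P (a @ [b]) = 0"
    by (subst (asm) sum_nonneg_eq_0_iff) (auto simp: finite_vals P_def)
  with True show ?thesis by simp
qed (simp add: mean_def scaleR_sum_right)

lemma nn_integral_prefix:
  assumes k: "k \<le> N" and \<Phi>: "\<And>a. 0 \<le> \<Phi> a"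
  shows "(\<integral>\<^sup>+w. ennreal (\<Phi> (prefix k w)) \<partial>M) = ennreal (\<Sum>a\<in>words vals k. P a * \<Phi> a)"
proof -
  have at: "atom a \<in> sets M" if "a \<in> words vals k" for a
    using that k by (intro atom_sets) (simp add: words_def)
  have "(\<integral>\<^sup>+w. ennreal (\<Phi> (prefix k w)) \<partial>M) = (\<integral>\<^sup>+w. (\<Sum>a\<in>words vals k. ennreal (\<Phi> a) * indicator (atom a) w) \<partial>M)"
  proof (rule nn_integral_cong)
    fix w assume w: "w \<in> space M"
    have "(\<Sum>a\<in>words vals k. ennreal (\<Phi> a) * indicator (atom a) w)
      = (\<Sum>a\<in>words vals k. if a = prefix k w then ennreal (\<Phi> a) else 0)"
      using w by (intro sum.cong refl) (auto simp: atom_def words_def)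
    also have "\<dots> = ennreal (\<Phi> (prefix k w))"
      using prefix_words[OF w k] by (simp add: finite_words finite_vals)
    finally show "ennreal (\<Phi> (prefix k w)) = (\<Sum>a\<in>words vals k. ennreal (\<Phi> a) * indicator (atom a) w)" ..
  qed
  also have "\<dots> = (\<Sum>a\<in>words vals k. ennreal (\<Phi> a) * emeasure M (atom a))"
    using at by (subst nn_integral_sum) (auto simp: nn_integral_cmult_indicator)
  also have "\<dots> = (\<Sum>a\<in>words vals k. ennreal (P a * \<Phi> a))"
    by (intro sum.cong refl) (simp add: P_def emeasure_eq_measure ennreal_mult'[symmetric] \<Phi> mult.commute)
  also have "\<dots> = ennreal (\<Sum>a\<in>words vals k. P a * \<Phi> a)"
    using \<Phi> by (intro sum_ennreal) (simp add: P_def)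
  finally show ?thesis .
qed

text \<open>The first difference is not centered: its mean becomes the root value of the tree, with the
  same multiplier as level 1.\<close>

definition cond_mean :: "nat \<Rightarrow> 'w \<Rightarrow> 'x" where
  "cond_mean n w = (if n \<le> 1 then 0 else mean (prefix (n - 1) w))"

lemma simple_cond_mean:
  assumes "n \<le> N" shows "simple_function M (cond_mean n)"
proof (cases "n \<le> 1")
  case False
  have "simple_function M (\<lambda>w. \<Sum>a\<in>words vals (n - 1). indicator (atom a) w *\<^sub>R mean a)"
  proof (rule simple_function_sum)
    fix a assume "a \<in> words vals (n - 1)"
    then have "atom a \<in> sets M" using assms by (intro atom_sets) (simp add: words_def)
    then have "simple_function M (indicator (atom a) :: 'w \<Rightarrow> real)" by (rule simple_function_indicator)
    then show "simple_function M (\<lambda>w. indicator (atom a) w *\<^sub>R mean a)"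
      by (rule simple_function_compose1)
  qed
  moreover have "(\<Sum>a\<in>words vals (n - 1). indicator (atom a) w *\<^sub>R mean a) = cond_mean n w" if w: "w \<in> space M" for w
  proof -
    have "(\<Sum>a\<in>words vals (n - 1). indicator (atom a) w *\<^sub>R mean a)
      = (\<Sum>a\<in>words vals (n - 1). if a = prefix (n - 1) w then mean a else 0)"
      using w by (intro sum.cong refl) (auto simp: atom_def words_def)
    then show ?thesis
      using prefix_words[OF w, of "n - 1"] assms False by (simp add: finite_words finite_vals cond_mean_def)
  qed
  ultimately show ?thesis by (subst (asm) simple_function_cong)
qed (simp add: cond_mean_def[abs_def])

end

context even_homogeneous_multiplier
begin

lemma simple_process_bound:
  fixes s :: "nat \<Rightarrow> 'w \<Rightarrow> 'x"
  assumes sp: "simple_process M s N" and N: "N \<ge> 1"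
    and \<epsilon>: "\<And>n. \<epsilon> n \<in> m ` (UNIV - {0})"
  shows "norm_pow M p (\<lambda>w. \<Sum>n=1..N. cs (\<epsilon> n) (s n w - simple_process.cond_mean M s N n w))
    \<le> ennreal (C powr p) * norm_pow M p (\<lambda>w. \<Sum>n=1..N. s n w - simple_process.cond_mean M s N n w)"
proof -
  interpret simple_process M s N by (rule sp)
  have "\<exists>\<xi>. \<forall>n. \<xi> n \<noteq> 0 \<and> m (\<xi> n) = \<epsilon> n"
    by (intro choice allI) (metis \<epsilon> DiffD2 imageE singletonI)
  then obtain \<xi>' where \<xi>': "\<And>n. \<xi>' n \<noteq> 0" "\<And>n. m (\<xi>' n) = \<epsilon> n" by blast
  \<comment> \<open>Equal multipliers at levels 0 and 1 let \<open>mean []\<close> cancel in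
    \<open>sum_eq\<close>.\<close>
  define \<xi> where "\<xi> n = (if n = 0 then \<xi>' 1 else \<xi>' n)" for n
  have \<xi>: "\<xi> n \<noteq> 0" for n by (simp add: \<xi>_def \<xi>')
  interpret prob_tree "vals" P N by (rule prob_tree)
  have tree: "tree_martingale vals P N cs diff"
  proof (intro tree_martingale.intro tree_martingale_axioms.intro prob_tree complex_scaling_axioms)
    fix a assume a: "set a \<subseteq> vals" "length a < N"
    have "(\<Sum>b\<in>vals. P (a @ [b]) *\<^sub>R diff (a @ [b]))
      = (\<Sum>b\<in>vals. P (a @ [b]) *\<^sub>R b) - (\<Sum>b\<in>vals. P (a @ [b])) *\<^sub>R mean a"
      by (simp add: scaleR_diff_right sum_subtractf scaleR_sum_left)
    then show "(\<Sum>b\<in>vals. P (a @ [b]) *\<^sub>R diff (a @ [b])) = 0"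
      using mean_scale[OF a(2)] simple_process.P_step[OF sp a(2)] by simp
  qed
  have sum_eq: "(\<Sum>n\<le>N. cs (\<kappa> n) (diff (take n (prefix N w))))
      = (\<Sum>n=1..N. cs (\<kappa> n) (s n w - cond_mean n w))" if \<kappa>: "\<kappa> 0 = \<kappa> (1::nat)" for \<kappa> w
  proof -
    have t: "diff (take n (prefix N w)) = s n w - mean (prefix (n - 1) w)" if n: "n \<in> {1..N}" for n
    proof -
      obtain k where k: "n = Suc k" using n by (cases n) auto
      show ?thesis using n by (simp add: take_prefix prefix_Suc k)
    qed
    have "(\<Sum>n\<le>N. cs (\<kappa> n) (diff (take n (prefix N w))))
       = cs (\<kappa> 1) (mean []) + (\<Sum>n=1..N. cs (\<kappa> n) (diff (take n (prefix N w))))"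
      using \<kappa> by (simp add: atMost_atLeast0 sum.atLeast_Suc_atMost[of 0 N] diff_def)
    also have "\<dots> = cs (\<kappa> 1) (mean []) + (\<Sum>n=1..N. cs (\<kappa> n) (s n w - mean (prefix (n - 1) w)))"
      by (simp add: t)
    also have "\<dots> = cs (\<kappa> 1) (mean []) + (cs (\<kappa> 1) (s 1 w - mean []) + (\<Sum>n=2..N. cs (\<kappa> n) (s n w - mean (prefix (n - 1) w))))"
      by (subst sum.atLeast_Suc_atMost[OF N]) (simp add: numeral_2_eq_2)
    also have "\<dots> = cs (\<kappa> 1) (s 1 w - cond_mean 1 w) + (\<Sum>n=2..N. cs (\<kappa> n) (s n w - cond_mean n w))"
      by (simp add: cs_diff_right cond_mean_def)
    also have "\<dots> = (\<Sum>n=1..N. cs (\<kappa> n) (s n w - cond_mean n w))"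
      by (subst sum.atLeast_Suc_atMost[OF N]) (simp add: numeral_2_eq_2)
    finally show ?thesis .
  qed
  have I: "norm_pow M p (\<lambda>w. \<Sum>n=1..N. cs (\<kappa> n) (s n w - cond_mean n w))
    = ennreal (\<Sum>a\<in>words vals N. P a * norm (\<Sum>n\<le>N. cs (\<kappa> n) (diff (take n a))) powr p)" if \<kappa>: "\<kappa> 0 = \<kappa> 1" for \<kappa>
    unfolding norm_pow_def sum_eq[OF \<kappa>, symmetric] by (rule nn_integral_prefix) auto
  have "norm_pow M p (\<lambda>w. \<Sum>n=1..N. cs (m (\<xi> n)) (s n w - cond_mean n w))
    \<le> ennreal (C powr p) * norm_pow M p (\<lambda>w. \<Sum>n=1..N. cs 1 (s n w - cond_mean n w))"
    using finite_tree_bound[OF tree \<xi>]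
    by (subst I, simp add: \<xi>_def, subst I, simp)
       (auto simp: ennreal_mult'[symmetric] intro!: ennreal_leI)
  then show ?thesis by (simp add: \<xi>_def \<xi>' cong: sum.cong_simp)
qed

end

text \<open>Convexity of the power at \<open>a / (1 - t)\<close> and \<open>b / t\<close> with
  weights \<open>1 - t\<close> and \<open>t\<close>. As \<open>t\<close> tends to 0 the factor of
  \<open>a\<close> tends to 1, so adding a small \<open>b\<close> costs nothing in the
  constant.\<close>

lemma powr_add_split:
  fixes a b t p :: real
  assumes ab: "0 \<le> a" "0 \<le> b" and t: "0 < t" "t < 1" and p: "1 \<le> p"
  shows "(a + b) powr p \<le> (1 - t) powr (1 - p) * a powr p + t powr (1 - p) * b powr p"
proof -
  have ge1: "1 \<le> r powr (1 - p)" if "0 < r" "r < 1" for r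
    using powr_mono'[of "1 - p" 0 r] that p by simp
  consider "a = 0" | "b = 0" | "a > 0" "b > 0" using ab by linarith
  then show ?thesis
  proof cases
    case 1
    then show ?thesis using mult_right_mono[OF ge1[OF t], of "b powr p"] by simp
  next
    case 2
    then show ?thesis using mult_right_mono[OF ge1[of "1 - t"], of "a powr p"] t by simp
  next
    case 3
    have s: "r * (x / r) powr p = r powr (1 - p) * x powr p" if "r > 0" "x > 0" for r x :: real
    proof -
      have "r * (x / r) powr p = (r powr 1 * r powr (- p)) * x powr p"
        using that by (simp add: powr_divide powr_minus field_simps)
      also have "r powr 1 * r powr (- p) = r powr (1 - p)"
        by (simp only: powr_add[symmetric] diff_conv_add_uminus)
      finally show ?thesis .
    qed
    have "((1 - t) *\<^sub>R (a / (1 - t)) + t *\<^sub>R (b / t)) powr p \<le> (1 - t) * (a / (1 - t)) powr p + t * (b / t) powr p"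
      using convex_onD[OF powr_convex[OF p], of t "a / (1 - t)" "b / t"] t 3 by simp
    then show ?thesis using t 3 s[of "1 - t" a] s[of t b] by simp
  qed
qed

text \<open>A convex function lies above its tangent; integrated over an atom this yields Jensen's
  inequality. For positive \<open>c\<close> and \<open>h\<close> it is Young's inequality with
  exponents \<open>p\<close> and its conjugate.\<close>

lemma powr_tangent:
  fixes c h p :: real
  assumes "0 \<le> c" "0 \<le> h" "1 < p"
  shows "c powr p + p * c powr (p - 1) * (h - c) \<le> h powr p"
proof (cases "c = 0 \<or> h = 0")
  case True
  have "c powr (p - 1) * c = c powr p"
    using assms by (cases "c = 0") (simp_all add: powr_diff)
  then have "p * c powr (p - 1) * c = p * c powr p" by simp
  moreover have "1 * c powr p \<le> p * c powr p" using assms by (intro mult_right_mono) auto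
  ultimately show ?thesis using True by (auto simp: mult.assoc)
next
  case False
  have "(h powr p) powr (1 / p) * (c powr p) powr (1 - 1 / p) \<le> (1 / p) * h powr p + (1 - 1 / p) * c powr p"
    using assms False by (intro Youngs_inequality_0) auto
  moreover have "(h powr p) powr (1 / p) = h" using assms by (simp add: powr_powr)
  moreover have "(c powr p) powr (1 - 1 / p) = c powr (p - 1)"
    using assms by (simp add: powr_powr right_diff_distrib)
  ultimately have "h * c powr (p - 1) \<le> (1 / p) * h powr p + (1 - 1 / p) * c powr p" by simp
  then have "p * (h * c powr (p - 1)) \<le> p * ((1 / p) * h powr p + (1 - 1 / p) * c powr p)"
    using assms by (intro mult_left_mono) auto
  also have "\<dots> = h powr p + (p - 1) * c powr p" using assms by (simp add: field_simps)
  finally have "p * (h * c powr (p - 1)) \<le> h powr p + (p - 1) * c powr p" .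
  moreover have "c powr (p - 1) * c = c powr p"
    using assms by (cases "c = 0") (simp_all add: powr_diff)
  ultimately show ?thesis by (simp add: algebra_simps)
qed

text \<open>The sum is at most the number of terms times the maximum. The constant is not sharp,
  which is good enough for error terms and for finiteness.\<close>

lemma sum_powr_le:
  fixes x :: "'i \<Rightarrow> real"
  assumes S: "finite S" and x: "\<And>i. i \<in> S \<Longrightarrow> 0 \<le> x i" and p: "0 < p"
  shows "(\<Sum>i\<in>S. x i) powr p \<le> real (card S) powr p * (\<Sum>i\<in>S. x i powr p)"
proof (cases "S = {}")
  case False
  define y where "y = Max (x ` S)"
  have "y \<in> x ` S" unfolding y_def using S False by (intro Max_in) auto
  then obtain i where i: "i \<in> S" "y = x i" by blast
  have y: "x j \<le> y" if "j \<in> S" for j using that S by (simp add: y_def)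
  have "(\<Sum>i\<in>S. x i) powr p \<le> (real (card S) * y) powr p"
    using sum_bounded_above[of S x y] y x p by (intro powr_mono2) (auto intro: sum_nonneg)
  also have "\<dots> = real (card S) powr p * y powr p" using x i by (simp add: powr_mult)
  also have "y powr p \<le> (\<Sum>i\<in>S. x i powr p)"
    unfolding i(2) using S i by (intro member_le_sum) auto
  finally show ?thesis by (simp add: mult_left_mono)
qed simp

lemma norm_pow_add_le:
  fixes f g :: "'w \<Rightarrow> 'x::banach"
  assumes f: "strongly_measurable M f" and g: "strongly_measurable M g"
    and t: "0 < t" "t < 1" and p: "1 \<le> p"
  shows "norm_pow M p (\<lambda>w. f w + g w)
     \<le> ennreal ((1 - t) powr (1 - p)) * norm_pow M p f + ennreal (t powr (1 - p)) * norm_pow M p g"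
proof -
  have "norm_pow M p (\<lambda>w. f w + g w) \<le> (\<integral>\<^sup>+w. ennreal ((1 - t) powr (1 - p)) * ennreal (norm (f w) powr p)
     + ennreal (t powr (1 - p)) * ennreal (norm (g w) powr p) \<partial>M)"
    unfolding norm_pow_def
  proof (rule nn_integral_mono)
    fix w
    have "norm (f w + g w) powr p \<le> (norm (f w) + norm (g w)) powr p"
      using p by (intro powr_mono2 norm_triangle_ineq) auto
    also have "\<dots> \<le> (1 - t) powr (1 - p) * norm (f w) powr p + t powr (1 - p) * norm (g w) powr p"
      by (rule powr_add_split[OF norm_ge_zero norm_ge_zero t p])
    finally show "ennreal (norm (f w + g w) powr p) \<le> ennreal ((1 - t) powr (1 - p)) * ennreal (norm (f w) powr p)
     + ennreal (t powr (1 - p)) * ennreal (norm (g w) powr p)"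
      by (simp add: ennreal_mult'[symmetric] ennreal_plus[symmetric] ennreal_leI del: ennreal_plus)
  qed
  also have "\<dots> = ennreal ((1 - t) powr (1 - p)) * norm_pow M p f + ennreal (t powr (1 - p)) * norm_pow M p g"
    unfolding norm_pow_def using norm_pow_measurable[OF f] norm_pow_measurable[OF g]
    by (simp add: nn_integral_add nn_integral_cmult)
  finally show ?thesis .
qed

lemma norm_pow_sum_le:
  fixes f g :: "'i \<Rightarrow> 'w \<Rightarrow> 'x::banach"
  assumes S: "finite S" and f: "\<And>i. i \<in> S \<Longrightarrow> strongly_measurable M (f i)"
    and K: "0 \<le> K" "\<And>i w. i \<in> S \<Longrightarrow> w \<in> space M \<Longrightarrow> norm (g i w) \<le> K * norm (f i w)" and p: "0 < p"
  shows "norm_pow M p (\<lambda>w. \<Sum>i\<in>S. g i w) \<le> ennreal ((K * real (card S)) powr p) * (\<Sum>i\<in>S. norm_pow M p (f i))"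
proof -
  have "norm_pow M p (\<lambda>w. \<Sum>i\<in>S. g i w)
     \<le> (\<integral>\<^sup>+w. ennreal ((K * real (card S)) powr p) * (\<Sum>i\<in>S. ennreal (norm (f i w) powr p)) \<partial>M)"
    unfolding norm_pow_def
  proof (rule nn_integral_mono)
    fix w assume w: "w \<in> space M"
    have "norm (\<Sum>i\<in>S. g i w) \<le> (\<Sum>i\<in>S. K * norm (f i w))"
      using K w by (intro sum_norm_le) auto
    then have "norm (\<Sum>i\<in>S. g i w) powr p \<le> (K * (\<Sum>i\<in>S. norm (f i w))) powr p"
      using p by (intro powr_mono2) (auto simp: sum_distrib_left)
    also have "\<dots> = K powr p * (\<Sum>i\<in>S. norm (f i w)) powr p"
      by (rule powr_mult)
    also have "\<dots> \<le> K powr p * (real (card S) powr p * (\<Sum>i\<in>S. norm (f i w) powr p))"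
      using S p by (intro mult_left_mono sum_powr_le) auto
    finally show "ennreal (norm (\<Sum>i\<in>S. g i w) powr p)
        \<le> ennreal ((K * real (card S)) powr p) * (\<Sum>i\<in>S. ennreal (norm (f i w) powr p))"
      using K by (simp add: sum_ennreal ennreal_mult'[symmetric] powr_mult ennreal_leI mult.assoc)
  qed
  also have "\<dots> = ennreal ((K * real (card S)) powr p) * (\<Sum>i\<in>S. norm_pow M p (f i))"
    unfolding norm_pow_def using norm_pow_measurable[OF f]
    by (subst nn_integral_cmult) (auto simp: nn_integral_sum simp del: sum_ennreal intro!: borel_measurable_sum)
  finally show ?thesis .
qed

text \<open>The functionals in the martingale property are turned into a norm estimate by a norming
  functional (Hahn-Banach); the \<open>p\<close>-th power is then handled by Jensen's inequality on each atom.\<close>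

lemma cond_mean_bound:
  fixes s :: "nat \<Rightarrow> 'w \<Rightarrow> 'x::banach" and d :: "'w \<Rightarrow> 'x"
  assumes sp: "simple_process M s N" and p: "1 < p" and n: "2 \<le> n" "n \<le> N"
    and d: "strongly_measurable M d" and fin: "norm_pow M p d < \<top>"
    and mart: "\<And>a \<phi>. length a = n - 1 \<Longrightarrow> bounded_linear (\<phi> :: 'x \<Rightarrow> real) \<Longrightarrow>
      (LINT w:simple_process.atom M s a|M. \<phi> (d w)) = 0"
  shows "norm_pow M p (simple_process.cond_mean M s N n) \<le> norm_pow M p (\<lambda>w. d w - s n w)"
proof -
  interpret simple_process M s N by (rule sp)
  have int_norm: "integrable M (\<lambda>w. norm (f w))" and int_pow: "integrable M (\<lambda>w. norm (f w) powr p)"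
    if f: "strongly_measurable M f" "norm_pow M p f < \<top>" for f :: "'w \<Rightarrow> 'x"
  proof -
    have [measurable]: "(\<lambda>w. norm (f w)) \<in> borel_measurable M" by (rule strongly_measurable_norm[OF f(1)])
    show i: "integrable M (\<lambda>w. norm (f w) powr p)"
      using f(2) by (intro integrableI_bounded) (auto simp: norm_pow_def)
    show "integrable M (\<lambda>w. norm (f w))"
    proof (rule Bochner_Integration.integrable_bound)
      show "integrable M (\<lambda>w. 1 + norm (f w) powr p)" using i by simp
      \<comment> \<open>Constants are integrable on a probability space, so this bound makes
        functions in \<open>L^p\<close> integrable.\<close>
      have "r \<le> 1 + r powr p" if "r \<ge> 0" for r :: real
      proof (cases "r \<le> 1")
        case True
        then show ?thesis using powr_ge_zero[of r p] by linarith
      qed (use powr_mono[of 1 p r] p in auto)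
      then show "AE w in M. norm (norm (f w)) \<le> norm (1 + norm (f w) powr p)" by simp
    qed measurable
  qed
  have s: "strongly_measurable M (s n)" using n by (intro strongly_measurable_simple simple) auto
  have sfin: "norm_pow M p (s n) < \<top>"
  proof -
    have "finite ((\<lambda>w. norm (s n w) powr p) ` space M)"
      using simple_functionD(1)[OF simple_function_compose1[OF simple, of n "\<lambda>x. norm x powr p"]] n by simp
    then obtain B where B: "\<And>w. w \<in> space M \<Longrightarrow> norm (s n w) powr p \<le> B"
      by (metis finite_imp_bounded bounded_real abs_le_D1 imageI)
    have "norm_pow M p (s n) \<le> (\<integral>\<^sup>+w. ennreal B \<partial>M)"
      unfolding norm_pow_def by (intro nn_integral_mono ennreal_leI B)
    also have "\<dots> < \<top>" by (simp add: emeasure_space_1)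
    finally show ?thesis .
  qed
  define h where "h w = norm (d w - s n w)" for w
  have ns: "strongly_measurable M (\<lambda>w. - s n w)"
    using n by (intro strongly_measurable_simple simple_function_compose1[OF simple]) auto
  have dsm: "strongly_measurable M (\<lambda>w. d w - s n w)"
    using strongly_measurable_add[OF d ns] by simp
  have hfin: "norm_pow M p (\<lambda>w. d w - s n w) < \<top>"
  proof -
    have "norm_pow M p (\<lambda>w. d w + - s n w) \<le> ennreal ((1 - 1/2) powr (1 - p)) * norm_pow M p d
       + ennreal ((1/2) powr (1 - p)) * norm_pow M p (\<lambda>w. - s n w)"
      using p by (intro norm_pow_add_le d ns) auto
    also have "norm_pow M p (\<lambda>w. - s n w) = norm_pow M p (s n)" by (simp add: norm_pow_def)
    finally show ?thesis using fin sfin by (auto simp: ennreal_mult_less_top order.strict_trans1)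
  qed
  have hi: "integrable M h" "integrable M (\<lambda>w. h w powr p)"
    unfolding h_def by (intro int_norm int_pow dsm hfin)+
  have at: "atom a \<in> sets M" if "a \<in> words vals (n - 1)" for a
    using that n by (intro atom_sets) (simp add: words_def)
  have atom_le: "ennreal (P a * norm (mean a) powr p) \<le> (\<integral>\<^sup>+w. ennreal (h w powr p) * indicator (atom a) w \<partial>M)"
    if a: "a \<in> words vals (n - 1)" for a
  proof -
    note A [measurable] = at[OF a]
    have la: "length a = n - 1" "length a < N" "Suc (length a) = n" using a n by (auto simp: words_def)
    \<comment> \<open>The norm of the scaled mean is attained by one functional, chosen separately
      for each atom.\<close>
    obtain \<phi> :: "'x \<Rightarrow> real" where \<phi>: "bounded_linear \<phi>" "\<phi> (P a *\<^sub>R mean a) = norm (P a *\<^sub>R mean a)"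
      and \<phi>_le: "\<And>x. \<bar>\<phi> x\<bar> \<le> norm x" by (rule norming_functional_exists[of "P a *\<^sub>R mean a"]) (rule that)
    have cont: "continuous_on UNIV \<phi>" by (rule linear_continuous_on[OF \<phi>(1)])
    have \<phi>i: "integrable M (\<lambda>w. \<phi> (f w))" if "strongly_measurable M f" "norm_pow M p f < \<top>" for f
    proof (rule Bochner_Integration.integrable_bound[OF int_norm[OF that]])
      show "(\<lambda>w. \<phi> (f w)) \<in> borel_measurable M"
        by (rule strongly_measurable_imp_borel[OF strongly_measurable_compose[OF that(1) cont]])
    qed (use \<phi>_le in auto)
    have ind: "integrable M (\<lambda>w. indicator (atom a) w * f w)" if "integrable M f" for f :: "'w \<Rightarrow> real"
      using integrable_mult_indicator[OF A that] by simp
    have "norm (P a *\<^sub>R mean a) = \<phi> (P a *\<^sub>R mean a)" by (rule \<phi>(2)[symmetric])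
    also have "\<dots> = (\<Sum>b\<in>vals. P (a @ [b]) * \<phi> b)"
      unfolding mean_scale[OF la(2)]
      by (simp add: linear_sum[OF bounded_linear.linear[OF \<phi>(1)]] linear_scale[OF bounded_linear.linear[OF \<phi>(1)]])
    also have "\<dots> = (\<integral>w. (\<Sum>b\<in>vals. indicator (atom (a @ [b])) w * \<phi> b) \<partial>M)"
    proof -
      have sb: "atom (a @ [b]) \<in> sets M" for b using la by (intro atom_sets) auto
      have "integrable M (indicator (atom (a @ [b])) :: 'w \<Rightarrow> real)" for b
        using sb[of b] by (simp add: integrable_real_indicator emeasure_eq_measure)
      then show ?thesis using sb by (subst Bochner_Integration.integral_sum) (auto simp: P_def)
    qed
    also have "\<dots> = (\<integral>w. indicator (atom a) w * \<phi> (s n w) \<partial>M)"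
    proof (rule Bochner_Integration.integral_cong[OF refl])
      fix w assume w: "w \<in> space M"
      have "(\<Sum>b\<in>vals. indicator (atom (a @ [b])) w * \<phi> b)
        = (\<Sum>b\<in>vals. if b = s n w then indicator (atom a) w * \<phi> b else 0)"
        by (intro sum.cong refl) (auto simp: atom_snoc la(3) indicator_def)
      also have "\<dots> = indicator (atom a) w * \<phi> (s n w)"
        using s_vals[of n w] w n by (simp add: finite_vals)
      finally show "(\<Sum>b\<in>vals. indicator (atom (a @ [b])) w * \<phi> b) = indicator (atom a) w * \<phi> (s n w)" .
    qed
    \<comment> \<open>The integral of \<open>\<phi> (d w)\<close> over the atom is 0 and may be
      subtracted; this brings in the approximation error \<open>d w - s n w\<close>.\<close>
    also have "\<dots> = (\<integral>w. indicator (atom a) w * \<phi> (s n w) \<partial>M) - (\<integral>w. indicator (atom a) w * \<phi> (d w) \<partial>M)"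
      using mart[OF la(1) \<phi>(1)] by (simp add: set_lebesgue_integral_def)
    also have "\<dots> = (\<integral>w. indicator (atom a) w * \<phi> (s n w) - indicator (atom a) w * \<phi> (d w) \<partial>M)"
      by (intro Bochner_Integration.integral_diff[symmetric] ind \<phi>i s sfin d fin)
    also have "\<dots> \<le> (\<integral>w. indicator (atom a) w * h w \<partial>M)"
    proof (rule integral_mono)
      fix w
      have "\<phi> (s n w) - \<phi> (d w) = - \<phi> (d w - s n w)"
        by (simp add: linear_diff[OF bounded_linear.linear[OF \<phi>(1)]])
      also have "\<dots> \<le> h w" unfolding h_def using \<phi>_le[of "d w - s n w"] by linarith
      finally show "indicator (atom a) w * \<phi> (s n w) - indicator (atom a) w * \<phi> (d w) \<le> indicator (atom a) w * h w"
        by (auto simp: indicator_def)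
    qed (intro Bochner_Integration.integrable_diff ind \<phi>i s sfin d fin hi)+
    finally have le: "P a * norm (mean a) \<le> (\<integral>w. indicator (atom a) w * h w \<partial>M)" by (simp add: P_def)
    define c where "c = norm (mean a)"
    \<comment> \<open>The added term is nonnegative by \<open>le\<close>, and the two terms together
      are the integral over the atom of the tangent at \<open>c\<close>.\<close>
    have "P a * c powr p \<le> P a * c powr p + p * c powr (p - 1) * ((\<integral>w. indicator (atom a) w * h w \<partial>M) - P a * c)"
      using le p by (simp add: c_def)
    also have "\<dots> = (\<integral>w. c powr p * indicator (atom a) w + p * c powr (p - 1) * (indicator (atom a) w * h w - c * indicator (atom a) w) \<partial>M)"
      using ind[OF hi(1)] A
      by (simp add: P_def integrable_real_indicator emeasure_eq_measure Bochner_Integration.integral_add Bochner_Integration.integral_diff)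
    also have "\<dots> \<le> (\<integral>w. indicator (atom a) w * h w powr p \<partial>M)"
    proof (rule integral_mono)
      fix w
      have "c powr p + p * c powr (p - 1) * (h w - c) \<le> h w powr p"
        using p by (intro powr_tangent) (auto simp: c_def h_def)
      then show "c powr p * indicator (atom a) w + p * c powr (p - 1) * (indicator (atom a) w * h w - c * indicator (atom a) w)
          \<le> indicator (atom a) w * h w powr p"
        by (auto simp: indicator_def)
    qed (use ind[OF hi(1)] ind[OF hi(2)] A in \<open>auto simp: integrable_real_indicator emeasure_eq_measure\<close>)
    finally have "ennreal (P a * norm (mean a) powr p) \<le> ennreal (\<integral>w. indicator (atom a) w * h w powr p \<partial>M)"
      unfolding c_def by (rule ennreal_leI)
    also have "\<dots> = (\<integral>\<^sup>+w. ennreal (indicator (atom a) w * h w powr p) \<partial>M)"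
      by (intro nn_integral_eq_integral[symmetric] ind hi) auto
    also have "\<dots> = (\<integral>\<^sup>+w. ennreal (h w powr p) * indicator (atom a) w \<partial>M)"
      by (intro nn_integral_cong) (auto simp: indicator_def)
    finally show ?thesis .
  qed
  have hm: "(\<lambda>w. ennreal (h w powr p)) \<in> borel_measurable M"
    unfolding h_def by (rule norm_pow_measurable[OF dsm])
  have "norm_pow M p (cond_mean n) = (\<integral>\<^sup>+w. ennreal (norm (mean (prefix (n - 1) w)) powr p) \<partial>M)"
    using n by (simp add: norm_pow_def cond_mean_def)
  also have "\<dots> = ennreal (\<Sum>a\<in>words vals (n - 1). P a * norm (mean a) powr p)"
    using n by (intro nn_integral_prefix) auto
  also have "\<dots> = (\<Sum>a\<in>words vals (n - 1). ennreal (P a * norm (mean a) powr p))"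
    by (intro sum_ennreal[symmetric]) (simp add: P_def)
  also have "\<dots> \<le> (\<Sum>a\<in>words vals (n - 1). \<integral>\<^sup>+w. ennreal (h w powr p) * indicator (atom a) w \<partial>M)"
    by (intro sum_mono atom_le)
  also have "\<dots> = (\<integral>\<^sup>+w. (\<Sum>a\<in>words vals (n - 1). ennreal (h w powr p) * indicator (atom a) w) \<partial>M)"
    using at hm by (intro nn_integral_sum[symmetric]) auto
  also have "\<dots> = (\<integral>\<^sup>+w. ennreal (h w powr p) \<partial>M)"
  proof (rule nn_integral_cong)
    fix w assume w: "w \<in> space M"
    have "(\<Sum>a\<in>words vals (n - 1). ennreal (h w powr p) * indicator (atom a) w)
      = (\<Sum>a\<in>words vals (n - 1). if a = prefix (n - 1) w then ennreal (h w powr p) else 0)"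
      using w by (intro sum.cong refl) (auto simp: atom_def words_def)
    then show "(\<Sum>a\<in>words vals (n - 1). ennreal (h w powr p) * indicator (atom a) w) = ennreal (h w powr p)"
      using prefix_words[OF w, of "n - 1"] n by (simp add: finite_words finite_vals)
  qed
  finally show ?thesis unfolding norm_pow_def h_def .
qed

section \<open>General martingales\<close>

lemma simple_function_subalgebra:
  assumes "subalgebra M G" "simple_function G f" shows "simple_function M f"
  using assms unfolding simple_function_def subalgebra_def by auto

lemma strongly_measurable_subalgebra:
  assumes "subalgebra M G" "strongly_measurable G f" shows "strongly_measurable M f"
  using assms simple_function_subalgebra[OF assms(1)]
  unfolding strongly_measurable_iff_simple subalgebra_def by metis

text \<open>Approximants with norm above \<open>2 * norm (f w)\<close> are replaced by 0. Where
  \<open>f w \<noteq> 0\<close> the factor 2 leaves room, so this happens only finitely often; where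
  \<open>f w = 0\<close> the new sequence is 0.\<close>

lemma strongly_measurable_dominated_sequence:
  fixes f :: "'w \<Rightarrow> 'x::banach"
  assumes f: "strongly_measurable G f"
  shows "\<exists>s. (\<forall>i. simple_function G (s i)) \<and> (\<forall>w\<in>space G. (\<lambda>i. s i w) \<longlonglongrightarrow> f w) \<and>
     (\<forall>i. \<forall>w\<in>space G. norm (s i w) \<le> 2 * norm (f w))"
proof -
  obtain s where s: "\<And>i. simple_function G (s i)" "\<And>w. w \<in> space G \<Longrightarrow> (\<lambda>i. s i w) \<longlonglongrightarrow> f w"
    by (rule strongly_measurableE[OF f]) (rule that)
  note [measurable] = strongly_measurable_norm[OF f] strongly_measurable_norm[OF strongly_measurable_simple[OF s(1)]]
  define s' where "s' i w = (if norm (s i w) \<le> 2 * norm (f w) then s i w else 0)" for i w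
  have "simple_function G (s' i)" for i
  proof -
    have "{w \<in> space G. norm (s i w) \<le> 2 * norm (f w)} \<in> sets G" by measurable
    then show ?thesis unfolding s'_def[abs_def] by (intro simple_function_If s(1) simple_function_const)
  qed
  moreover have "(\<lambda>i. s' i w) \<longlonglongrightarrow> f w" if w: "w \<in> space G" for w
  proof (cases "f w = 0")
    case True
    then have "s' i w = 0" for i by (simp add: s'_def)
    with True show ?thesis by simp
  next
    case False
    then have "norm (f w) < 2 * norm (f w)" by simp
    from order_tendstoD(2)[OF tendsto_norm[OF s(2)[OF w]] this]
    have "\<forall>\<^sub>F i in sequentially. s i w = s' i w"
      by eventually_elim (simp add: s'_def)
    with s(2)[OF w] show ?thesis by (rule Lim_transform_eventually)
  qed
  moreover have "norm (s' i w) \<le> 2 * norm (f w)" for i w by (simp add: s'_def)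
  ultimately show ?thesis by blast
qed

lemma norm_pow_tendsto_0:
  fixes f :: "'w \<Rightarrow> 'x::banach"
  assumes f: "strongly_measurable M f" and s: "\<And>i. strongly_measurable M (s i)"
    and lim: "\<And>w. w \<in> space M \<Longrightarrow> (\<lambda>i. s i w) \<longlonglongrightarrow> f w"
    and bd: "\<And>i w. w \<in> space M \<Longrightarrow> norm (s i w) \<le> 2 * norm (f w)"
    and fin: "norm_pow M p f < \<top>" and p: "0 < p"
  shows "(\<lambda>i. norm_pow M p (\<lambda>w. f w - s i w)) \<longlonglongrightarrow> 0"
proof -
  have dm: "strongly_measurable M (\<lambda>w. f w - s i w)" for i
    using strongly_measurable_add[OF f strongly_measurable_compose[OF s[of i], of uminus]]
    by (simp add: continuous_on_minus)
  have "(\<lambda>i. norm_pow M p (\<lambda>w. f w - s i w)) \<longlonglongrightarrow> (\<integral>\<^sup>+w. 0 \<partial>M)"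
    unfolding norm_pow_def
  proof (rule nn_integral_dominated_convergence[where w = "\<lambda>w. ennreal (3 powr p) * ennreal (norm (f w) powr p)"])
    show "(\<lambda>w. ennreal (norm (f w - s i w) powr p)) \<in> borel_measurable M" for i
      by (rule norm_pow_measurable[OF dm])
    show "(\<lambda>w. ennreal (3 powr p) * ennreal (norm (f w) powr p)) \<in> borel_measurable M"
      using norm_pow_measurable[OF f] by simp
    show "(\<integral>\<^sup>+w. ennreal (3 powr p) * ennreal (norm (f w) powr p) \<partial>M) < \<infinity>"
      using fin norm_pow_measurable[OF f] by (simp add: nn_integral_cmult norm_pow_def ennreal_mult_less_top)
    show "AE w in M. ennreal (norm (f w - s i w) powr p) \<le> ennreal (3 powr p) * ennreal (norm (f w) powr p)" for i
    proof (rule AE_I2)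
      fix w assume w: "w \<in> space M"
      have "norm (f w - s i w) \<le> 3 * norm (f w)"
        using bd[OF w, of i] norm_triangle_ineq4[of "f w" "s i w"] by linarith
      then have "norm (f w - s i w) powr p \<le> (3 * norm (f w)) powr p"
        using p by (intro powr_mono2) auto
      then show "ennreal (norm (f w - s i w) powr p) \<le> ennreal (3 powr p) * ennreal (norm (f w) powr p)"
        by (simp add: powr_mult ennreal_mult'[symmetric] ennreal_leI)
    qed
    show "AE w in M. (\<lambda>i. ennreal (norm (f w - s i w) powr p)) \<longlonglongrightarrow> 0"
    proof (rule AE_I2)
      fix w assume w: "w \<in> space M"
      have "(\<lambda>i. ennreal (norm (f w - s i w) powr p)) \<longlonglongrightarrow> ennreal (norm (f w - f w) powr p)"
        using p by (intro tendsto_ennrealI tendsto_powr' tendsto_norm tendsto_diff tendsto_const lim[OF w]) auto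
      then show "(\<lambda>i. ennreal (norm (f w - s i w) powr p)) \<longlonglongrightarrow> 0" by simp
    qed
  qed simp
  then show ?thesis by simp
qed

lemma norm_pow_less_top:
  "integrable M (\<lambda>w. norm (f w) powr p) \<Longrightarrow> norm_pow M p f < \<top>"
  unfolding norm_pow_def by (subst nn_integral_eq_integral) auto

context even_homogeneous_multiplier
begin

proposition martingale_transform_bound:
  fixes M :: "'w measure" and d :: "nat \<Rightarrow> 'w \<Rightarrow> 'x"
  assumes M: "prob_space M" and mds: "martingale_diff_seq p M F d N"
    and \<epsilon>: "\<And>n. \<epsilon> n \<in> m ` (UNIV - {0})"
  shows "norm_pow M p (\<lambda>w. \<Sum>n=1..N. cs (\<epsilon> n) (d n w))
    \<le> ennreal (C powr p) * norm_pow M p (\<lambda>w. \<Sum>n=1..N. d n w)"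
proof (cases "N = 0")
  case True
  then show ?thesis by (simp add: norm_pow_def)
next
  case False
  then have N: "N \<ge> 1" by simp
  let ?I = "\<lambda>f. norm_pow M p (\<lambda>w. \<Sum>n=1..N. f n w)"
  interpret prob_space M by (rule M)
  have sub: "subalgebra M (F n)" if "n \<in> {1..N}" for n using mds that by (auto simp: martingale_diff_seq_def)
  have mono: "subalgebra (F n) (F k)" if "1 \<le> k" "k \<le> n" "n \<le> N" for k n
    using mds that sub[of n] sub[of k] by (auto simp: martingale_diff_seq_def subalgebra_def)
  have dF: "strongly_measurable (F n) (d n)" and di: "norm_pow M p (d n) < \<top>" if "n \<in> {1..N}" for n
    using mds that by (auto simp: martingale_diff_seq_def intro!: norm_pow_less_top)
  have mart: "(LINT w:B|M. \<phi> (d n w)) = 0"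
    if "n \<in> {2..N}" "B \<in> sets (F (n - 1))" "bounded_linear \<phi>" for n B and \<phi> :: "'x \<Rightarrow> real"
    using mds that unfolding martingale_diff_seq_def by blast
  have dM: "strongly_measurable M (d n)" if "n \<in> {1..N}" for n
    by (rule strongly_measurable_subalgebra[OF sub[OF that] dF[OF that]])
  have "\<forall>n. \<exists>s. n \<in> {1..N} \<longrightarrow> (\<forall>i. simple_function (F n) (s i)) \<and> (\<forall>w\<in>space M. (\<lambda>i. s i w) \<longlonglongrightarrow> d n w) \<and>
     (\<forall>i. \<forall>w\<in>space M. norm (s i w) \<le> 2 * norm (d n w))"
    using strongly_measurable_dominated_sequence[OF dF] sub by (auto simp: subalgebra_def)
  then obtain S where SF: "\<And>n i. n \<in> {1..N} \<Longrightarrow> simple_function (F n) (S n i)"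
    and Slim: "\<And>n w. n \<in> {1..N} \<Longrightarrow> w \<in> space M \<Longrightarrow> (\<lambda>i. S n i w) \<longlonglongrightarrow> d n w"
    and Sbd: "\<And>n i w. n \<in> {1..N} \<Longrightarrow> w \<in> space M \<Longrightarrow> norm (S n i w) \<le> 2 * norm (d n w)"
    unfolding choice_iff by blast
  have SM: "simple_function M (S n i)" if "n \<in> {1..N}" for n i
    by (rule simple_function_subalgebra[OF sub[OF that] SF[OF that]])
  have sp: "simple_process M (\<lambda>n. S n i) N" for i
    by (intro simple_process.intro simple_process_axioms.intro M SM)
  \<comment> \<open>The conditional means of the simple approximants. Subtracting them makes
    \<open>u i\<close> a martingale difference sequence of simple functions, and \<open>r i\<close>
    collects the error.\<close>
  define e where "e i n = simple_process.cond_mean M (\<lambda>n. S n i) N n" for i n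
  define u where "u i n w = S n i w - e i n w" for i n w
  define r where "r i n w = (d n w - S n i w) + e i n w" for i n w
  define \<eta> where "\<eta> i n = norm_pow M p (\<lambda>w. d n w - S n i w)" for i n
  have \<eta>: "(\<lambda>i. \<eta> i n) \<longlonglongrightarrow> 0" if n: "n \<in> {1..N}" for n
    unfolding \<eta>_def using p
    by (intro norm_pow_tendsto_0 dM[OF n] strongly_measurable_simple SM[OF n] Slim[OF n] Sbd[OF n] di[OF n]) auto
  have eM: "simple_function M (e i n)" if "n \<in> {1..N}" for i n
    unfolding e_def using that by (intro simple_process.simple_cond_mean[OF sp]) auto
  have uM: "strongly_measurable M (u i n)" if "n \<in> {1..N}" for i n
    unfolding u_def[abs_def] using that by (intro strongly_measurable_simple simple_function_diff SM eM)
  have dSM: "strongly_measurable M (\<lambda>w. d n w - S n i w)" if n: "n \<in> {1..N}" for i n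
    using strongly_measurable_add[OF dM[OF n] strongly_measurable_simple[OF simple_function_compose1[OF SM[OF n], of uminus]]]
    by simp
  have rM: "strongly_measurable M (r i n)" if n: "n \<in> {1..N}" for i n
    unfolding r_def[abs_def] by (rule strongly_measurable_add[OF dSM[OF n] strongly_measurable_simple[OF eM[OF n]]])
  have e_le: "norm_pow M p (e i n) \<le> \<eta> i n" if n: "n \<in> {1..N}" for i n
  proof (cases "n = 1")
    case True
    have "e i 1 = (\<lambda>w. 0)" by (simp add: e_def simple_process.cond_mean_def[OF sp] fun_eq_iff)
    then show ?thesis using True by (simp add: norm_pow_def)
  next
    case False
    then have n2: "2 \<le> n" "n \<le> N" using n by auto
    show ?thesis unfolding e_def \<eta>_def
    proof (rule cond_mean_bound[OF sp p n2 dM[OF n] di[OF n]])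
      fix a :: "'x list" and \<phi> :: "'x \<Rightarrow> real" assume a: "length a = n - 1" and \<phi>: "bounded_linear \<phi>"
      \<comment> \<open>The approximant of index \<open>k\<close> is measurable for
        \<open>F k\<close>, so the atoms of the first \<open>n - 1\<close> values belong to
        \<open>F (n - 1)\<close>, where the martingale property of \<open>d n\<close>
        applies.\<close>
      have "simple_process.atom M (\<lambda>n. S n i) a \<in> sets (F (n - 1))"
      proof (rule simple_process.atom_sets_sub[OF sp])
        show "space (F (n - 1)) = space M" 
        proof -
          have "n - 1 \<in> {1..N}" using n2 by auto
          from sub[OF this] show ?thesis by (simp add: subalgebra_def)
        qed
        show "simple_function (F (n - 1)) (S k i)" if "k \<in> {1..length a}" for k
          using that a n2 by (intro simple_function_subalgebra[OF mono SF]) auto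
      qed
      then show "(LINT w:simple_process.atom M (\<lambda>n. S n i) a|M. \<phi> (d n w)) = 0"
        using n2 \<phi> by (intro mart) auto
    qed
  qed
  define k where "k = (1/2::real) powr (1 - p)"
  have r_le: "norm_pow M p (r i n) \<le> ennreal k * \<eta> i n + ennreal k * \<eta> i n" if n: "n \<in> {1..N}" for i n
  proof -
    have "norm_pow M p (r i n) \<le> ennreal ((1 - 1/2) powr (1 - p)) * \<eta> i n + ennreal ((1/2) powr (1 - p)) * norm_pow M p (e i n)"
      unfolding r_def[abs_def] \<eta>_def using p
      by (intro norm_pow_add_le dSM[OF n] strongly_measurable_simple eM[OF n]) auto
    also have "\<dots> \<le> ennreal k * \<eta> i n + ennreal k * \<eta> i n"
      using mult_left_mono[OF e_le[OF n, of i], of "ennreal k"] by (simp add: k_def)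
    finally show ?thesis .
  qed
  define \<delta> where "\<delta> i = (\<Sum>n=1..N. ennreal k * \<eta> i n + ennreal k * \<eta> i n)" for i
  have \<delta>: "\<delta> \<longlonglongrightarrow> 0"
  proof -
    have "\<delta> \<longlonglongrightarrow> (\<Sum>n=1..N. ennreal k * 0 + ennreal k * 0)"
      unfolding \<delta>_def by (intro tendsto_sum tendsto_add ennreal_tendsto_cmult \<eta>) auto
    then show ?thesis by simp
  qed
  define K where "K = (\<Sum>n=1..N. cmod (\<epsilon> n))"
  have K: "cmod (\<epsilon> n) \<le> K" if "n \<in> {1..N}" for n unfolding K_def using that by (intro member_le_sum) auto
  have K0: "0 \<le> K" unfolding K_def by (intro sum_nonneg) auto
  define A where "A = ?I (\<lambda>n w. cs (\<epsilon> n) (d n w))"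
  define B where "B = ?I (\<lambda>n w. d n w)"
  define l1 l2 where "l1 = (K * real (card {1..N})) powr p" and "l2 = (1 * real (card {1..N})) powr p"
  have err1: "?I (\<lambda>n w. cs (\<epsilon> n) (r i n w)) \<le> ennreal l1 * \<delta> i" for i
  proof -
    have "?I (\<lambda>n w. cs (\<epsilon> n) (r i n w)) \<le> ennreal l1 * (\<Sum>n=1..N. norm_pow M p (r i n))"
      unfolding l1_def using p K K0
      by (intro norm_pow_sum_le rM) (auto simp: norm_cs intro!: mult_right_mono)
    also have "\<dots> \<le> ennreal l1 * \<delta> i" unfolding \<delta>_def by (intro mult_left_mono sum_mono r_le) auto
    finally show ?thesis .
  qed
  have err2: "?I (\<lambda>n w. - r i n w) \<le> ennreal l2 * \<delta> i" for i
  proof -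
    have "?I (\<lambda>n w. - r i n w) \<le> ennreal l2 * (\<Sum>n=1..N. norm_pow M p (r i n))"
      unfolding l2_def using p by (intro norm_pow_sum_le rM) auto
    also have "\<dots> \<le> ennreal l2 * \<delta> i" unfolding \<delta>_def by (intro mult_left_mono sum_mono r_le) auto
    finally show ?thesis .
  qed
  have minus: "strongly_measurable M (\<lambda>w. - f w)" if "strongly_measurable M f" for f :: "'w \<Rightarrow> 'x"
    by (rule strongly_measurable_compose[OF that, of uminus]) (intro continuous_intros)
  \<comment> \<open>Finiteness enters the last limit, where \<open>B\<close> is multiplied by
    converging constants.\<close>
  have Bfin: "B < \<top>"
  proof -
    have "B \<le> ennreal ((1 * real (card {1..N})) powr p) * (\<Sum>n=1..N. norm_pow M p (d n))"
      unfolding B_def using p by (intro norm_pow_sum_le dM) auto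
    also have "\<dots> < \<top>" using di by (auto simp: ennreal_mult_less_top)
    finally show ?thesis .
  qed
  \<comment> \<open>The splitting is applied twice, to \<open>u = d - r\<close> and to
    \<open>d = u + r\<close>, hence the repeated factor. For fixed \<open>t\<close> the errors
    vanish as \<open>i\<close> grows, although their own factors are large for small
    \<open>t\<close>; only afterwards \<open>t\<close> tends to 0.\<close>
  have step: "A \<le> ennreal ((1 - t) powr (1 - p) * (C powr p * (1 - t) powr (1 - p))) * B" if t: "0 < t" "t < 1" for t
  proof -
    define a b where "a = (1 - t) powr (1 - p)" and "b = t powr (1 - p)"
    have ineq: "A \<le> ennreal a * (ennreal (C powr p) * (ennreal a * B + ennreal b * (ennreal l2 * \<delta> i))) + ennreal b * (ennreal l1 * \<delta> i)" for i
    proof -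
      have du: "d n w = u i n w + r i n w" for n w by (simp add: u_def r_def)
      have ud: "u i n w = d n w + - r i n w" for n w by (simp add: u_def r_def)
      have "?I (\<lambda>n w. u i n w) = norm_pow M p (\<lambda>w. (\<Sum>n=1..N. d n w) + (\<Sum>n=1..N. - r i n w))"
        by (simp add: ud sum.distrib sum_negf sum_subtractf)
      also have "\<dots> \<le> ennreal a * B + ennreal b * ?I (\<lambda>n w. - r i n w)"
        unfolding B_def a_def b_def using t p
        by (intro norm_pow_add_le strongly_measurable_sum dM minus rM) auto
      also have "\<dots> \<le> ennreal a * B + ennreal b * (ennreal l2 * \<delta> i)"
        by (intro add_left_mono mult_left_mono err2) auto
      finally have 1: "?I (\<lambda>n w. u i n w) \<le> ennreal a * B + ennreal b * (ennreal l2 * \<delta> i)" .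
      have "?I (\<lambda>n w. cs (\<epsilon> n) (u i n w)) \<le> ennreal (C powr p) * ?I (\<lambda>n w. u i n w)"
        unfolding u_def e_def by (rule simple_process_bound[OF sp N \<epsilon>])
      also have "\<dots> \<le> ennreal (C powr p) * (ennreal a * B + ennreal b * (ennreal l2 * \<delta> i))"
        by (intro mult_left_mono 1) auto
      finally have 2: "?I (\<lambda>n w. cs (\<epsilon> n) (u i n w))
          \<le> ennreal (C powr p) * (ennreal a * B + ennreal b * (ennreal l2 * \<delta> i))" .
      have "A = norm_pow M p (\<lambda>w. (\<Sum>n=1..N. cs (\<epsilon> n) (u i n w)) + (\<Sum>n=1..N. cs (\<epsilon> n) (r i n w)))"
        unfolding A_def by (simp add: du cs_add_right sum.distrib)
      also have "\<dots> \<le> ennreal a * ?I (\<lambda>n w. cs (\<epsilon> n) (u i n w))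
          + ennreal b * ?I (\<lambda>n w. cs (\<epsilon> n) (r i n w))"
        unfolding a_def b_def using t p
        by (intro norm_pow_add_le strongly_measurable_sum strongly_measurable_cs_right uM rM) auto
      also have "\<dots> \<le> ennreal a * (ennreal (C powr p) * (ennreal a * B + ennreal b * (ennreal l2 * \<delta> i))) + ennreal b * (ennreal l1 * \<delta> i)"
        by (intro add_mono mult_left_mono 2 err1) auto
      finally show ?thesis .
    qed
    have "(\<lambda>i. ennreal a * (ennreal (C powr p) * (ennreal a * B + ennreal b * (ennreal l2 * \<delta> i))) + ennreal b * (ennreal l1 * \<delta> i))
      \<longlonglongrightarrow> ennreal a * (ennreal (C powr p) * (ennreal a * B + ennreal b * (ennreal l2 * 0))) + ennreal b * (ennreal l1 * 0)"
      by (intro tendsto_add ennreal_tendsto_cmult tendsto_const \<delta>) auto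
    then have "A \<le> ennreal a * (ennreal (C powr p) * (ennreal a * B + ennreal b * (ennreal l2 * 0))) + ennreal b * (ennreal l1 * 0)"
      by (rule LIMSEQ_le_const) (use ineq in blast)
    also have "\<dots> = ennreal (a * (C powr p * a)) * B"
      by (simp add: ennreal_mult' a_def mult.assoc)
    finally show ?thesis unfolding a_def .
  qed
  \<comment> \<open>A null sequence inside the open unit interval; the shift by 2 excludes the value
    1.\<close>
  define t where "t j = 1 / real (j + 2)" for j
  have t: "0 < t j" "t j < 1" for j by (auto simp: t_def)
  have tl: "t \<longlonglongrightarrow> 0"
    using LIMSEQ_ignore_initial_segment[OF lim_inverse_n', of 2] by (simp add: t_def[abs_def])
  have "(\<lambda>j. B * ennreal ((1 - t j) powr (1 - p) * (C powr p * (1 - t j) powr (1 - p))))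
    \<longlonglongrightarrow> B * ennreal ((1 - 0) powr (1 - p) * (C powr p * (1 - 0) powr (1 - p)))"
    using Bfin by (intro ennreal_tendsto_cmult tendsto_ennrealI tendsto_mult tendsto_const tendsto_powr tendsto_diff tl) auto
  then have "A \<le> B * ennreal ((1 - 0) powr (1 - p) * (C powr p * (1 - 0) powr (1 - p)))"
    by (rule LIMSEQ_le_const) (use step[OF t] in \<open>auto simp: mult.commute\<close>)
  then show ?thesis unfolding A_def B_def by (simp add: mult.commute)
qed

end

section \<open>From two multiplier values to the unit circle\<close>

context complex_scaling
begin

lemma norm_pow_cs:
  assumes "strongly_measurable M f"
  shows "norm_pow M p (\<lambda>w. cs a (f w)) = ennreal (cmod a powr p) * norm_pow M p f"
  unfolding norm_pow_def using norm_pow_measurable[OF assms, of p]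
  by (simp add: norm_cs powr_mult ennreal_mult' nn_integral_cmult)

text \<open>From two distinct multipliers to signs by an affine change, from signs to \<open>[-1, 1]\<close> by
  convexity in each coordinate, and from there to the circle by splitting into real and imaginary part.\<close>

lemma circle_transform_bound:
  fixes d :: "nat \<Rightarrow> 'w \<Rightarrow> 'x"
  assumes p: "1 < p" and b: "0 \<le> b" and ab: "a1 \<noteq> a2"
    and d: "\<And>n. n \<in> {1..N} \<Longrightarrow> strongly_measurable M (d n)"
    and bound: "\<And>\<epsilon>. (\<And>n::nat. \<epsilon> n \<in> {a1, a2}) \<Longrightarrow> norm_pow M p (\<lambda>w. \<Sum>n=1..N. cs (\<epsilon> n) (d n w)) \<le> ennreal b * T"
    and T: "T = norm_pow M p (\<lambda>w. \<Sum>n=1..N. d n w)"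
    and \<epsilon>: "\<And>n. cmod (\<epsilon> n) = 1"
  defines "k \<equiv> (1/2::real) powr (1 - p)"
  defines "Q \<equiv> k * (cmod (2 / (a1 - a2)) powr p * b) + k * cmod ((a1 + a2) / (a1 - a2)) powr p"
  shows "norm_pow M p (\<lambda>w. \<Sum>n=1..N. cs (\<epsilon> n) (d n w)) \<le> ennreal (k * Q + k * Q) * T"
proof -
  let ?I = "\<lambda>f. norm_pow M p (\<lambda>w. \<Sum>n=1..N. f n w)"
  have k0: "0 \<le> k" by (simp add: k_def)
  have Q0: "0 \<le> Q" using b k0 by (simp add: Q_def)
  have half: "norm_pow M p (\<lambda>w. f w + g w) \<le> ennreal k * norm_pow M p f + ennreal k * norm_pow M p g"
    if "strongly_measurable M f" "strongly_measurable M g" for f g :: "'w \<Rightarrow> 'x"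
    using norm_pow_add_le[OF that, of "1/2" p] p by (simp add: k_def)
  have sm: "strongly_measurable M (\<lambda>w. \<Sum>n=1..N. cs (c n) (d n w))" for c
    by (intro strongly_measurable_sum strongly_measurable_cs_right d)
  have sm': "strongly_measurable M (\<lambda>w. \<Sum>n=1..N. d n w)"
    by (intro strongly_measurable_sum d)
  have signs: "?I (\<lambda>n w. cs (of_real (\<rho> n)) (d n w)) \<le> ennreal Q * T"
    if \<rho>: "\<And>n. n \<in> {1..N} \<Longrightarrow> \<rho> n = 1 \<or> \<rho> n = -1" for \<rho> :: "nat \<Rightarrow> real"
  proof -
    define \<alpha> where "\<alpha> n = (if \<rho> n = 1 then a1 else a2)" for n
    \<comment> \<open>The affine map that sends \<open>a1\<close> to 1 and \<open>a2\<close> to -1;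
      its constant term acts as a multiple of the untransformed sum.\<close>
    have "complex_of_real (\<rho> n) = 2 / (a1 - a2) * \<alpha> n + - ((a1 + a2) / (a1 - a2))" if "n \<in> {1..N}" for n
    proof -
      have "2 / (a1 - a2) * \<alpha> n + - ((a1 + a2) / (a1 - a2)) = (2 * \<alpha> n - (a1 + a2)) / (a1 - a2)"
        by (simp add: diff_divide_distrib)
      also have "2 * \<alpha> n - (a1 + a2) = of_real (\<rho> n) * (a1 - a2)"
        using \<rho>[OF that] by (auto simp: \<alpha>_def)
      finally show ?thesis using ab by simp
    qed
    then have "(\<Sum>n=1..N. cs (of_real (\<rho> n)) (d n w)) = (\<Sum>n=1..N. cs (2 / (a1 - a2) * \<alpha> n + - ((a1 + a2) / (a1 - a2))) (d n w))" for w
      by (intro sum.cong) auto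
    also have "\<dots> w = cs (2 / (a1 - a2)) (\<Sum>n=1..N. cs (\<alpha> n) (d n w)) + cs (- ((a1 + a2) / (a1 - a2))) (\<Sum>n=1..N. d n w)" for w
      by (simp only: cs_add_left sum.distrib cs_sum_right cs_mult)
    finally have "?I (\<lambda>n w. cs (of_real (\<rho> n)) (d n w))
      \<le> ennreal k * norm_pow M p (\<lambda>w. cs (2 / (a1 - a2)) (\<Sum>n=1..N. cs (\<alpha> n) (d n w)))
       + ennreal k * norm_pow M p (\<lambda>w. cs (- ((a1 + a2) / (a1 - a2))) (\<Sum>n=1..N. d n w))"
      using half[OF strongly_measurable_cs_right[OF sm] strongly_measurable_cs_right[OF sm']] by simp
    also have "\<dots> \<le> ennreal k * (ennreal (cmod (2 / (a1 - a2)) powr p) * (ennreal b * T))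
       + ennreal k * (ennreal (cmod ((a1 + a2) / (a1 - a2)) powr p) * T)"
      unfolding norm_pow_cs[OF sm] norm_pow_cs[OF sm'] norm_minus_cancel T[symmetric]
      by (intro add_mono mult_left_mono bound) (auto simp: \<alpha>_def)
    also have "\<dots> = ennreal Q * T"
      unfolding Q_def using k0 b by (simp add: ennreal_plus ennreal_mult distrib_right mult.assoc)
    finally show ?thesis .
  qed
  \<comment> \<open>\<open>S\<close> collects the coordinates where \<rho> may lie strictly between
    the signs; the induction removes them one at a time.\<close>
  have cube: "?I (\<lambda>n w. cs (of_real (\<rho> n)) (d n w)) \<le> ennreal Q * T"
    if "finite S" "\<And>n. n \<in> {1..N} - S \<Longrightarrow> \<rho> n = 1 \<or> \<rho> n = -1" "\<And>n. n \<in> {1..N} \<Longrightarrow> \<bar>\<rho> n\<bar> \<le> 1"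
    for S and \<rho> :: "nat \<Rightarrow> real"
    using that
  proof (induction S arbitrary: \<rho>)
    case empty
    then show ?case by (intro signs) auto
  next
    case (insert i S)
    show ?case
    proof (cases "i \<in> {1..N} \<and> \<rho> i \<noteq> 1 \<and> \<rho> i \<noteq> -1")
      case False
      then show ?thesis using insert.prems by (intro insert.IH) auto
    next
      case True
      then have i: "i \<in> {1..N}" by simp
      then have \<rho>i: "\<bar>\<rho> i\<bar> < 1" using insert.prems(2)[OF i] True by linarith
      \<comment> \<open>Chosen so that \<open>\<rho> i = (1 - t) - t\<close>, a convex combination
        of the two signs.\<close>
      define t where "t = (1 - \<rho> i) / 2"
      have t: "0 < t" "t < 1" using \<rho>i by (auto simp: t_def)
      define G where "G x w = (\<Sum>n=1..N. cs (of_real ((\<rho>(i := x)) n)) (d n w))" for x w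
      have Gm: "strongly_measurable M (G x)" for x unfolding G_def[abs_def] by (rule sm)
      have G_le: "norm_pow M p (G x) \<le> ennreal Q * T" if "x = 1 \<or> x = -1" for x
        unfolding G_def[abs_def] using that insert.prems by (intro insert.IH) auto
      have "(\<Sum>n=1..N. cs (of_real (\<rho> n)) (d n w)) = cs (of_real (1 - t)) (G 1 w) + cs (of_real t) (G (-1) w)" for w
      proof -
        have "complex_of_real (\<rho> n) = of_real (1 - t) * of_real ((\<rho>(i := 1)) n) + of_real t * of_real ((\<rho>(i := -1)) n)" for n
          unfolding of_real_mult[symmetric] of_real_add[symmetric]
          by (intro arg_cong[where f = of_real]) (auto simp: t_def field_simps)
        then have "(\<Sum>n=1..N. cs (of_real (\<rho> n)) (d n w)) = (\<Sum>n=1..N. cs (of_real (1 - t) * of_real ((\<rho>(i := 1)) n)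
            + of_real t * of_real ((\<rho>(i := -1)) n)) (d n w))" by (intro sum.cong refl) (simp only:)
        then show ?thesis
          unfolding G_def by (simp only: cs_add_left sum.distrib cs_sum_right cs_mult)
      qed
      then have "?I (\<lambda>n w. cs (of_real (\<rho> n)) (d n w))
        \<le> ennreal ((1 - t) powr (1 - p)) * norm_pow M p (\<lambda>w. cs (of_real (1 - t)) (G 1 w))
         + ennreal (t powr (1 - p)) * norm_pow M p (\<lambda>w. cs (of_real t) (G (-1) w))"
        using norm_pow_add_le[OF strongly_measurable_cs_right[OF Gm] strongly_measurable_cs_right[OF Gm] t] p by simp
      also have "\<dots> = ennreal (1 - t) * norm_pow M p (G 1) + ennreal t * norm_pow M p (G (-1))"
      proof -
        \<comment> \<open>Pulling the weight out of the norm gives \<open>s powr p\<close>, which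
          reduces the factor \<open>s powr (1 - p)\<close> to \<open>s\<close>. The result is a
          convex combination, so the constant \<open>Q\<close> is the same however many coordinates
          are treated.\<close>
        have *: "ennreal (s powr (1 - p)) * norm_pow M p (\<lambda>w. cs (of_real s) (G x w)) = ennreal s * norm_pow M p (G x)"
          if "0 < s" for s x
        proof -
          have "s powr (1 - p) * s powr p = s" using that by (simp add: powr_add[symmetric])
          then show ?thesis
            using that unfolding norm_pow_cs[OF Gm] by (simp add: mult.assoc[symmetric] ennreal_mult'[symmetric])
        qed
        show ?thesis using t by (simp only: * diff_gt_0_iff_gt)
      qed
      also have "\<dots> \<le> ennreal (1 - t) * (ennreal Q * T) + ennreal t * (ennreal Q * T)"
        by (intro add_mono mult_left_mono G_le) auto
      also have "\<dots> = ennreal Q * T"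
        using t by (simp add: distrib_right[symmetric] ennreal_plus[symmetric] del: ennreal_plus)
      finally show ?thesis .
    qed
  qed
  have Re: "?I (\<lambda>n w. cs (of_real (Re (\<epsilon> n))) (d n w)) \<le> ennreal Q * T"
    using \<epsilon> abs_Re_le_cmod by (intro cube[of "{1..N}"]) (auto, metis)
  have Im: "?I (\<lambda>n w. cs (of_real (Im (\<epsilon> n))) (d n w)) \<le> ennreal Q * T"
    using \<epsilon> abs_Im_le_cmod by (intro cube[of "{1..N}"]) (auto, metis)
  have "(\<Sum>n=1..N. cs (\<epsilon> n) (d n w)) = (\<Sum>n=1..N. cs (of_real (Re (\<epsilon> n))) (d n w))
      + cs \<i> (\<Sum>n=1..N. cs (of_real (Im (\<epsilon> n))) (d n w))" for w
    by (simp only: cs_sum_right sum.distrib[symmetric] cs_mult[symmetric] cs_add_left[symmetric] complex_eq[symmetric])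
  then have "?I (\<lambda>n w. cs (\<epsilon> n) (d n w))
     \<le> ennreal k * ?I (\<lambda>n w. cs (of_real (Re (\<epsilon> n))) (d n w))
      + ennreal k * norm_pow M p (\<lambda>w. cs \<i> (\<Sum>n=1..N. cs (of_real (Im (\<epsilon> n))) (d n w)))"
    using half[OF sm strongly_measurable_cs_right[OF sm]] by simp
  also have "norm_pow M p (\<lambda>w. cs \<i> (\<Sum>n=1..N. cs (of_real (Im (\<epsilon> n))) (d n w)))
     = ?I (\<lambda>n w. cs (of_real (Im (\<epsilon> n))) (d n w))"
    unfolding norm_pow_cs[OF sm] by simp
  also have "ennreal k * ?I (\<lambda>n w. cs (of_real (Re (\<epsilon> n))) (d n w))
      + ennreal k * ?I (\<lambda>n w. cs (of_real (Im (\<epsilon> n))) (d n w))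
     \<le> ennreal k * (ennreal Q * T) + ennreal k * (ennreal Q * T)"
    by (intro add_mono mult_left_mono Re Im) auto
  also have "\<dots> = ennreal (k * Q + k * Q) * T"
    using k0 Q0 by (simp only: ennreal_plus ennreal_mult mult_nonneg_nonneg distrib_right mult.assoc)
  finally show ?thesis .
qed

end

section \<open>Comparison of the multiplier norm with the UMD constants\<close>

theorem theorem4p1:
  fixes p :: real
    and cs :: "complex \<Rightarrow> 'x::banach \<Rightarrow> 'x"
    and m :: "real^'n::finite \<Rightarrow> complex"
  assumes "1 < p"
    and "complex_banach_scaling cs"
    and "\<And>\<xi>. m (- \<xi>) = m \<xi>"
    and "\<And>c \<xi>. c > 0 \<Longrightarrow> m (c *\<^sub>R \<xi>) = m \<xi>"
    and "continuous_on (UNIV - {0}) m"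
  shows "umd_constant TYPE('w) p cs (m ` (UNIV - {0})) \<le> multiplier_norm p cs m
       \<and> ((umd_constant TYPE('w) p cs {z. cmod z = 1} = \<top>
            \<and> \<not> (\<exists>c. \<forall>\<xi>. \<xi> \<noteq> 0 \<longrightarrow> m \<xi> = c))
           \<longrightarrow> multiplier_norm p cs m = \<top>)"
proof -
  interpret complex_scaling cs by standard (rule assms(2))
  define mult_ok where "mult_ok C \<longleftrightarrow> C \<ge> 0 \<and> (\<forall>L. (\<forall>k<length L. schwartz (fst (L ! k))) \<longrightarrow>
          Lp_pow p (fourier_mult cs m L) \<le> ennreal (C powr p) * Lp_pow p (tensor_fun cs L))" for C
  have mult_eq: "multiplier_norm p cs m = Inf {ennreal C | C. mult_ok C}"
    unfolding multiplier_norm_def mult_ok_def ..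
  define umd_ok where "umd_ok A b \<longleftrightarrow> b \<ge> 0 \<and>
     (\<forall>(M::'w measure) F (d :: nat \<Rightarrow> 'w \<Rightarrow> 'x) N \<epsilon>.
        prob_space M \<longrightarrow> martingale_diff_seq p M F d N \<longrightarrow> (\<forall>n. \<epsilon> n \<in> A) \<longrightarrow>
        norm_pow M p (\<lambda>w. \<Sum>n=1..N. cs (\<epsilon> n) (d n w))
          \<le> ennreal (b powr p) * norm_pow M p (\<lambda>w. \<Sum>n=1..N. d n w))" for A b
  have umd_eq: "umd_constant TYPE('w) p cs A = Inf {ennreal b | b. umd_ok A b}" for A
    unfolding umd_constant_def umd_ok_def norm_pow_def ..
  \<comment> \<open>This inclusion of sets of admissible constants reverses the order of the infima,
    also when the smaller set is empty.\<close>
  have transfer: "umd_ok (m ` (UNIV - {0})) C" if C: "mult_ok C" for C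
  proof -
    interpret even_homogeneous_multiplier cs p C m
      using C assms unfolding mult_ok_def by unfold_locales auto
    show ?thesis
      unfolding umd_ok_def using C martingale_transform_bound unfolding mult_ok_def by blast
  qed
  have le: "umd_constant TYPE('w) p cs (m ` (UNIV - {0})) \<le> multiplier_norm p cs m"
    unfolding mult_eq umd_eq using transfer by (intro Inf_superset_mono) auto
  moreover have "multiplier_norm p cs m = \<top>"
    if top: "umd_constant TYPE('w) p cs {z. cmod z = 1} = \<top>"
      and nonconst: "\<not> (\<exists>c. \<forall>\<xi>. \<xi> \<noteq> 0 \<longrightarrow> m \<xi> = c)"
  proof (rule ccontr)
    assume "multiplier_norm p cs m \<noteq> \<top>"
    \<comment> \<open>The infimum over the empty set is infinite, so a finite norm provides an
      admissible constant.\<close>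
    then have "{ennreal C | C. mult_ok C} \<noteq> {}" unfolding mult_eq by (intro notI) simp
    then obtain C where C: "mult_ok C" by blast
    then have ok: "umd_ok (m ` (UNIV - {0})) C" by (rule transfer)
    obtain \<xi>1 \<xi>2 where \<xi>: "\<xi>1 \<noteq> 0" "\<xi>2 \<noteq> 0" "m \<xi>1 \<noteq> m \<xi>2" using nonconst by metis
    \<comment> \<open>\<open>k\<close> and \<open>Q\<close> are the constants of
      \<open>circle_transform_bound\<close> for the values \<open>m \<xi>1\<close> and
      \<open>m \<xi>2\<close> with \<open>b = C powr p\<close>.\<close>
    define k where "k = (1/2::real) powr (1 - p)"
    define Q where "Q = k * (cmod (2 / (m \<xi>1 - m \<xi>2)) powr p * C powr p)
        + k * cmod ((m \<xi>1 + m \<xi>2) / (m \<xi>1 - m \<xi>2)) powr p"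
    have Q0: "0 \<le> k * Q + k * Q" by (simp add: k_def Q_def)
    \<comment> \<open>The UMD inequality is stated with \<open>b powr p\<close>, hence the
      \<open>p\<close>-th root.\<close>
    have "umd_ok {z. cmod z = 1} ((k * Q + k * Q) powr (1 / p))"
      unfolding umd_ok_def
    proof (intro conjI allI impI)
      fix M :: "'w measure" and F and d :: "nat \<Rightarrow> 'w \<Rightarrow> 'x" and N and \<epsilon> :: "nat \<Rightarrow> complex"
      assume M: "prob_space M" and mds: "martingale_diff_seq p M F d N" and \<epsilon>: "\<forall>n. \<epsilon> n \<in> {z. cmod z = 1}"
      let ?I = "\<lambda>f. norm_pow M p (\<lambda>w. \<Sum>n=1..N. f n w)"
      have d: "strongly_measurable M (d n)" if "n \<in> {1..N}" for n
        using mds that by (auto simp: martingale_diff_seq_def intro!: strongly_measurable_subalgebra[of M "F n"])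
      have "?I (\<lambda>n w. cs (\<epsilon>' n) (d n w)) \<le> ennreal (C powr p) * ?I (\<lambda>n w. d n w)"
        if "\<And>n. \<epsilon>' n \<in> {m \<xi>1, m \<xi>2}" for \<epsilon>'
      proof -
        have "\<epsilon>' n \<in> m ` (UNIV - {0})" for n using that[of n] \<xi> by auto
        with ok M mds show ?thesis unfolding umd_ok_def by blast
      qed
      then have "?I (\<lambda>n w. cs (\<epsilon> n) (d n w))
          \<le> ennreal (k * Q + k * Q) * ?I (\<lambda>n w. d n w)"
        unfolding k_def Q_def using \<epsilon> assms(1) \<xi> d by (intro circle_transform_bound refl) auto
      moreover have "((k * Q + k * Q) powr (1 / p)) powr p = k * Q + k * Q"
        using Q0 assms(1) by (simp add: powr_powr)
      ultimately show "?I (\<lambda>n w. cs (\<epsilon> n) (d n w))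
          \<le> ennreal (((k * Q + k * Q) powr (1 / p)) powr p) * ?I (\<lambda>n w. d n w)" by simp
    qed simp
    then have "umd_constant TYPE('w) p cs {z. cmod z = 1} \<le> ennreal ((k * Q + k * Q) powr (1 / p))"
      unfolding umd_eq by (intro Inf_lower) blast
    with top show False by (simp add: top_unique)
  qed
  ultimately show ?thesis by blast
qed

end
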